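(* Let $b=(b_n)_{n\ge1}$ be an Erdős–Taylor sequence. Then the following are equivalent: (i) $\sum_{n\ge1}\left(\frac{b_n}{b_{n+1}}\right)^2<\infty$; (ii) $b\in\mathrm{IPRWM}$; (iii) $|G_2(b)|>\aleph_0$.
   Context: $\mathbb T=\mathbb R/\mathbb Z$, $\|x\|:=\min_{n\in\mathbb Z}|x-n|$, $\mathbb N=\{1,2,\dots\}$. $G_2(b):=\{t\in\mathbb T:\ \sum_{n=1}^\infty\|b_nt\|^2<\infty\}$. The Erdős–Taylor sequence associated to $(a_1,a_2,\dots)\in\mathbb N^{\mathbb N}$ is the strictly increasing sequence $b=(b_1,b_2,\dots)$ of natural numbers defined by $b_1:=1$, $b_{n+1}:=a_nb_n+1$. An Erdős–Taylor sequence is one associated to some $(a_1,a_2,\dots)\in\mathbb N^{\mathbb N}$. $(X,\mathcal B,m)$ denotes a standard non-atomic probability space and $\mathrm{MPT}(X,\mathcal B,m)$ the collection of its invertible $m$-preserving transformations. Let $\mathcal F$ be the collection of finite nonempty subsets of $\mathbb N$, and $b(F):=\sum_{j\in F}b_j$ for $F\in\mathcal F$. $T\in\mathrm{MPT}(X,\mathcal B,m)$ is IP-rigid along $b$ if for every $A\in\mathcal B$, $m(A\,\triangle\,T^{b(F)}A)\to0$ as $\min F\to\infty$, $F\in\mathcal F$. $\mathrm{IPRWM}$ is the set of strictly increasing sequences $b$ of natural numbers such that there exists a weakly mixing $T\in\mathrm{MPT}(X,\mathcal B,m)$ which is IP-rigid along $b$. *)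

theory Defs
  imports "HOL-Probability.Probability"
begin

text \<open>
  Sequences are functions on \<^typ>\<open>nat\<close> read at the indices \<open>1, 2, \<dots>\<close>; the value at \<open>0\<close> is
  never used.
\<close>

definition erdos_taylor_assoc :: "(nat \<Rightarrow> nat) \<Rightarrow> (nat \<Rightarrow> nat) \<Rightarrow> bool" where
  "erdos_taylor_assoc a b \<longleftrightarrow> b 1 = 1 \<and> (\<forall>n\<ge>1. b (n + 1) = a n * b n + 1)"

definition erdos_taylor :: "(nat \<Rightarrow> nat) \<Rightarrow> bool" where
  "erdos_taylor b \<longleftrightarrow> (\<exists>a. (\<forall>n\<ge>1. a n \<ge> 1) \<and> erdos_taylor_assoc a b)"

quotient_type circle = real / "\<lambda>x y :: real. x - y \<in> \<int>"
proof (rule equivpI)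
  show "reflp (\<lambda>x y :: real. x - y \<in> \<int>)"
    by (simp add: reflp_def)
  show "symp (\<lambda>x y :: real. x - y \<in> \<int>)"
    by (metis (mono_tags, lifting) Ints_minus minus_diff_eq sympI)
  show "transp (\<lambda>x y :: real. x - y \<in> \<int>)"
    by (rule transpI) (metis Ints_add diff_add_cancel add_diff_eq)
qed

text \<open>The infimum below is a minimum, attained at \<^term>\<open>round x\<close>.\<close>

lift_definition circle_norm :: "circle \<Rightarrow> real" is "\<lambda>x. INF n::int. \<bar>x - of_int n\<bar>"
proof -
  fix x y :: real
  assume "x - y \<in> \<int>"
  then obtain k :: int where k: "x = y + of_int k"
    by (metis Ints_cases add.commute diff_add_cancel)
  have "range (\<lambda>n::int. \<bar>x - of_int n\<bar>) = range (\<lambda>n::int. \<bar>y - of_int n\<bar>)"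
  proof (intro equalityI subsetI)
    fix z assume "z \<in> range (\<lambda>n::int. \<bar>x - of_int n\<bar>)"
    then obtain n :: int where "z = \<bar>x - of_int n\<bar>" by blast
    then have "z = \<bar>y - of_int (n - k)\<bar>" by (simp add: k algebra_simps)
    then show "z \<in> range (\<lambda>n::int. \<bar>y - of_int n\<bar>)" by blast
  next
    fix z assume "z \<in> range (\<lambda>n::int. \<bar>y - of_int n\<bar>)"
    then obtain n :: int where "z = \<bar>y - of_int n\<bar>" by blast
    then have "z = \<bar>x - of_int (n + k)\<bar>" by (simp add: k algebra_simps)
    then show "z \<in> range (\<lambda>n::int. \<bar>x - of_int n\<bar>)" by blast
  qed
  then show "(INF n::int. \<bar>x - of_int n\<bar>) = (INF n::int. \<bar>y - of_int n\<bar>)"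
    by simp
qed

lift_definition circle_mult :: "nat \<Rightarrow> circle \<Rightarrow> circle" is "\<lambda>k x. real k * x"
  by (metis Ints_mult Ints_of_nat right_diff_distrib)

definition G2 :: "(nat \<Rightarrow> nat) \<Rightarrow> circle set" where
  "G2 b = {t. summable (\<lambda>n. (circle_norm (circle_mult (b (Suc n)) t))\<^sup>2)}"

definition standard_borel :: "'a measure \<Rightarrow> bool" where
  "standard_borel M \<longleftrightarrow>
    (\<exists>X. completely_metrizable_space X \<and> second_countable X \<and> topspace X = space M \<and>
         sets M = sigma_sets (topspace X) {U. openin X U})"

definition atom :: "'a measure \<Rightarrow> 'a set \<Rightarrow> bool" where
  "atom M A \<longleftrightarrow> A \<in> sets M \<and> measure M A > 0 \<and>
    (\<forall>B\<in>sets M. B \<subseteq> A \<longrightarrow> measure M B = 0 \<or> measure M B = measure M A)"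

definition standard_nonatomic_prob_space :: "'a measure \<Rightarrow> bool" where
  "standard_nonatomic_prob_space M \<longleftrightarrow> prob_space M \<and> standard_borel M \<and> (\<nexists>A. atom M A)"

definition MPT :: "'a measure \<Rightarrow> ('a \<Rightarrow> 'a) set" where
  "MPT M = {T. bij_betw T (space M) (space M) \<and> T \<in> measurable M M \<and>
               the_inv_into (space M) T \<in> measurable M M \<and> distr M M T = M}"

definition weakly_mixing :: "'a measure \<Rightarrow> ('a \<Rightarrow> 'a) \<Rightarrow> bool" where
  "weakly_mixing M T \<longleftrightarrow> (\<forall>A\<in>sets M. \<forall>B\<in>sets M.
    (\<lambda>N. (\<Sum>n<N. \<bar>measure M ((T ^^ n) -` A \<inter> B) - measure M A * measure M B\<bar>) / real N)
      \<longlonglongrightarrow> 0)"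

definition nonempty_finsets :: "nat set set" where
  "nonempty_finsets = {F. finite F \<and> F \<noteq> {} \<and> F \<subseteq> {1..}}"

text \<open>The filter of \<open>min F \<rightarrow> \<infinity>\<close> along finite nonempty sets of positive integers.\<close>

definition IP_filter :: "nat set filter" where
  "IP_filter = inf (filtercomap Min at_top) (principal nonempty_finsets)"

definition IP_rigid :: "'a measure \<Rightarrow> ('a \<Rightarrow> 'a) \<Rightarrow> (nat \<Rightarrow> nat) \<Rightarrow> bool" where
  "IP_rigid M T b \<longleftrightarrow> (\<forall>A\<in>sets M.
    ((\<lambda>F. measure M (sym_diff A ((T ^^ (\<Sum>j\<in>F. b j)) ` A))) \<longlongrightarrow> 0) IP_filter)"

definition IPRWM :: "'a measure \<Rightarrow> (nat \<Rightarrow> nat) set" where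
  "IPRWM M = {b. strict_mono_on {1..} b \<and> (\<forall>n\<ge>1. b n \<ge> 1) \<and>
                 (\<exists>T\<in>MPT M. weakly_mixing M T \<and> IP_rigid M T b)}"

end

theory Submission
  imports Defs
begin

text \<open>
  Write \<open>b\<^sub>n\<^sub>+\<^sub>1 = a\<^sub>n b\<^sub>n + 1\<close>, so that condition (i) is summability of \<open>1 / a\<^sub>n\<^sup>2\<close>. If \<open>t\<close> is a
  nonzero point of \<open>G\<^sub>2(b)\<close>, then \<open>\<parallel>t\<parallel> \<le> \<parallel>b\<^sub>n\<^sub>+\<^sub>1 t\<parallel> + a\<^sub>n \<parallel>b\<^sub>n t\<parallel>\<close> bounds \<open>1 / a\<^sub>n\<close> by a square
  summable sequence; hence (iii) implies (i). The same inequality for the Koopman operator \<open>U\<close> of an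
  IP-rigid transformation, applied to the averages \<open>g = \<Prod> (1 + U\<^bsup>b\<^sub>n\<^esup>) / 2 f\<close>, for which the
  parallelogram law bounds \<open>\<Sum> \<parallel>U\<^bsup>b\<^sub>n\<^esup> g - g\<parallel>\<^sup>2\<close> by \<open>4 \<parallel>f\<parallel>\<^sup>2\<close> and which are close to \<open>f\<close> by
  rigidity, shows that \<open>U f = f\<close> for all \<open>f\<close> if (i) fails; hence (ii) implies (i).

  Conversely, let \<open>\<tau>\<^sub>n\<^sub>+\<^sub>1 = \<tau>\<^sub>n + (m\<^sub>n - \<tau>\<^sub>n) / b\<^sub>n\<^sub>+\<^sub>1\<close> with \<open>m\<^sub>n \<in> {0, 1}\<close>; then \<open>b\<^sub>n \<tau>\<^sub>n\<close> stays an
  integer. The limits for all choices of \<open>m\<close> form a Cantor set, contained in \<open>G\<^sub>2(b)\<close> under (i). If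
  \<open>m\<^sub>n = 1\<close> with probability \<open>\<tau>\<^sub>n\<close>, then \<open>\<tau>\<close> is a martingale, and orthogonality of its increments
  shows that \<open>exp (2 \<pi> \<i> b(F) t)\<close> is close to \<open>1\<close> in mean square for the law of the limit \<open>t\<close>, with
  error controlled by \<open>\<Sum> (b\<^sub>j / b\<^sub>j\<^sub>+\<^sub>1)\<^sup>2\<close> over \<open>j \<ge> min F\<close>. This law has no atoms, so the stationary
  Gaussian process with this spectral measure is weakly mixing, and it is IP-rigid along \<open>b\<close>. Standard
  non-atomic probability spaces are all isomorphic up to null sets, which moves the shift of this process to
  \<open>M\<close>.
\<close>

section \<open>Averages of a measure-preserving map along an IP set\<close>

text \<open>The law of the martingale limit is never built as a measure. The Gaussian process needs
  only the numbers \<open>corr n\<close>, limits of finite-step expectations of cos (2 pi n x), and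
  positive definiteness, rigidity and Wiener's criterion for the absence of atoms are all proved
  from the finite expectations, with bounds that do not depend on the number of steps. Taking
  cosines symmetrises the law, so Wiener's sum involves both x - y and x + y for two independent
  walks. The walk is therefore confined to [1/10, 2/5]: there x + y stays away from the integers,
  and only walks that remain together contribute. Confinement also keeps the step probabilities away
  from 0 and 1, so that two walks stay together for J steps with probability at most (9/10)^J.

  Under (i) the ratios of consecutive terms tend to infinity. Passing to a tail of \<open>b\<close>
  makes them at least 8, so each step dominates the sum of all later ones; neither membership in G_2
  nor IP-rigidity is affected by finitely many terms.

  In the direction (ii) to (i), U f = f for all indicators makes every set invariant, weak mixing
  then leaves only the measures 0 and 1, and the whole space would be an atom.\<close>

definition bounded_rv :: "'a measure \<Rightarrow> ('a \<Rightarrow> real) \<Rightarrow> bool" where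
  "bounded_rv M f \<longleftrightarrow> f \<in> borel_measurable M \<and> (\<exists>B. \<forall>x. \<bar>f x\<bar> \<le> B)"

definition sqnorm :: "'a measure \<Rightarrow> ('a \<Rightarrow> real) \<Rightarrow> real" where
  "sqnorm M f = (\<integral>x. (f x)\<^sup>2 \<partial>M)"

locale measure_preserving_map = prob_space M for M :: "'a measure" +
  fixes T :: "'a \<Rightarrow> 'a"
  assumes T_measurable [measurable]: "T \<in> measurable M M"
    and distr_T: "distr M M T = M"
begin

lemma funpow_measurable [measurable]: "T ^^ k \<in> measurable M M"
  by (induction k) (auto intro: measurable_comp simp: measurable_ident)

lemma distr_funpow: "distr M M (T ^^ k) = M"
proof (induction k)
  case 0
  show ?case by (simp add: distr_id2)
next
  case (Suc k)
  have "distr M M (T ^^ Suc k) = distr (distr M M (T ^^ k)) M T"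
    by (simp add: distr_distr)
  then show ?case by (simp only: Suc distr_T)
qed

lemma bounded_rv_comp: "bounded_rv M f \<Longrightarrow> bounded_rv M (\<lambda>x. f ((T ^^ k) x))"
  unfolding bounded_rv_def by (auto intro!: measurable_compose[OF funpow_measurable])

lemma bounded_rv_comp1: "bounded_rv M f \<Longrightarrow> bounded_rv M (\<lambda>x. f (T x))"
  using bounded_rv_comp[of f 1] by simp

lemma bounded_rv_diff: 
  assumes "bounded_rv M f" "bounded_rv M g" shows "bounded_rv M (\<lambda>x. f x - g x)"
proof -
  obtain B C where B: "\<And>x. \<bar>f x\<bar> \<le> B" and C: "\<And>x. \<bar>g x\<bar> \<le> C"
    using assms unfolding bounded_rv_def by blast
  have "\<bar>f x - g x\<bar> \<le> B + C" for x
    using abs_triangle_ineq4[of "f x" "g x"] B[of x] C[of x] by linarith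
  then have "\<exists>b. \<forall>x. \<bar>f x - g x\<bar> \<le> b" by blast
  moreover have [measurable]: "f \<in> borel_measurable M" "g \<in> borel_measurable M"
    using assms by (auto simp: bounded_rv_def)
  ultimately show ?thesis by (simp add: bounded_rv_def)
qed

lemma bounded_rv_mean: 
  assumes "bounded_rv M f" "bounded_rv M g" shows "bounded_rv M (\<lambda>x. (f x + g x) / 2)"
proof -
  obtain B C where B: "\<And>x. \<bar>f x\<bar> \<le> B" and C: "\<And>x. \<bar>g x\<bar> \<le> C"
    using assms unfolding bounded_rv_def by blast
  have "\<bar>(f x + g x) / 2\<bar> \<le> (B + C) / 2" for x
    using abs_triangle_ineq[of "f x" "g x"] B[of x] C[of x] by simp
  then have "\<exists>b. \<forall>x. \<bar>(f x + g x) / 2\<bar> \<le> b" by blast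
  moreover have [measurable]: "f \<in> borel_measurable M" "g \<in> borel_measurable M"
    using assms by (auto simp: bounded_rv_def)
  ultimately show ?thesis by (simp add: bounded_rv_def)
qed

lemma bounded_rv_sq: "bounded_rv M f \<Longrightarrow> integrable M (\<lambda>x. (f x)\<^sup>2)"
proof -
  assume f: "bounded_rv M f"
  then obtain B where B: "\<And>x. \<bar>f x\<bar> \<le> B" unfolding bounded_rv_def by blast
  have "(f x)\<^sup>2 \<le> B\<^sup>2" for x
    using power_mono[OF B[of x], of 2] by simp
  then show ?thesis
    using f by (intro integrable_const_bound[where B = "B\<^sup>2"]) (auto simp: bounded_rv_def)
qed

lemma sqnorm_comp: "bounded_rv M f \<Longrightarrow> sqnorm M (\<lambda>x. f ((T ^^ k) x)) = sqnorm M f"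
  unfolding sqnorm_def bounded_rv_def
  by (subst (2) distr_funpow[of k, symmetric], subst integral_distr) auto

lemma sqnorm_comp1: "bounded_rv M f \<Longrightarrow> sqnorm M (\<lambda>x. f (T x)) = sqnorm M f"
  using sqnorm_comp[of f 1] by simp

lemma sqnorm_nonneg: "sqnorm M f \<ge> 0"
  unfolding sqnorm_def by simp

lemma sqnorm_parallelogram:
  assumes "bounded_rv M f" "bounded_rv M g"
  shows "sqnorm M (\<lambda>x. (f x + g x) / 2) + sqnorm M (\<lambda>x. g x - f x) / 4
    = (sqnorm M f + sqnorm M g) / 2"
proof -
  have "(\<integral>x. ((f x + g x) / 2)\<^sup>2 + (g x - f x)\<^sup>2 / 4 \<partial>M) = (\<integral>x. ((f x)\<^sup>2 + (g x)\<^sup>2) / 2 \<partial>M)"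
    by (rule Bochner_Integration.integral_cong) (auto simp: power2_eq_square field_simps)
  moreover note bounded_rv_sq[OF assms(1)] bounded_rv_sq[OF assms(2)]
    bounded_rv_sq[OF bounded_rv_mean[OF assms]] bounded_rv_sq[OF bounded_rv_diff[OF assms(2,1)]]
  ultimately show ?thesis
    unfolding sqnorm_def by simp
qed

lemma sqnorm_diff_le:
  assumes "bounded_rv M f" "bounded_rv M g"
  shows "sqnorm M (\<lambda>x. f x - g x) \<le> 2 * sqnorm M f + 2 * sqnorm M g"
proof -
  have "sqnorm M (\<lambda>x. f x - g x) \<le> (\<integral>x. 2 * (f x)\<^sup>2 + 2 * (g x)\<^sup>2 \<partial>M)"
    unfolding sqnorm_def
  proof (rule integral_mono)
    show "(f x - g x)\<^sup>2 \<le> 2 * (f x)\<^sup>2 + 2 * (g x)\<^sup>2" for x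
      using zero_le_power2[of "f x + g x"] by (simp add: power2_eq_square algebra_simps)
  qed (auto intro!: bounded_rv_sq bounded_rv_diff assms)
  also have "\<dots> = 2 * sqnorm M f + 2 * sqnorm M g"
    unfolding sqnorm_def using assms by (simp add: bounded_rv_sq)
  finally show ?thesis .
qed

text \<open>The parallelogram law with the square of the difference dropped.\<close>

lemma sqnorm_mean_le:
  assumes "bounded_rv M f" "bounded_rv M g" "sqnorm M f \<le> c" "sqnorm M g \<le> c"
  shows "sqnorm M (\<lambda>x. (f x + g x) / 2) \<le> c"
proof -
  have "u \<le> c" if "u + v / 4 = (p + q) / 2" "v \<ge> 0" "p \<le> c" "q \<le> c" for u v p q :: real
    using that by simp
  from this[OF sqnorm_parallelogram[OF assms(1,2)] sqnorm_nonneg assms(3,4)] show ?thesis .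
qed

text \<open>The displacement under \<open>T ^^ (a * m)\<close> telescopes into \<open>a\<close>
  translates of the displacement under \<open>T ^^ m\<close>. Cauchy-Schwarz costs one factor
  \<open>a\<close>, the number of summands the other, as all translates have the same norm.\<close>

lemma sqnorm_funpow_mult_le:
  assumes "bounded_rv M g"
  shows "sqnorm M (\<lambda>x. g ((T ^^ (a * m)) x) - g x)
    \<le> (real a)\<^sup>2 * sqnorm M (\<lambda>x. g ((T ^^ m) x) - g x)"
proof -
  define h where "h = (\<lambda>x. g ((T ^^ m) x) - g x)"
  have h: "bounded_rv M h" unfolding h_def by (intro bounded_rv_diff bounded_rv_comp assms)
  have tel: "g ((T ^^ (a * m)) x) - g x = (\<Sum>i<a. h ((T ^^ (i * m)) x))" for x
  proof (induction a)
    case (Suc a)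
    have "(T ^^ (Suc a * m)) x = (T ^^ m) ((T ^^ (a * m)) x)" by (simp add: funpow_add)
    then show ?case using Suc by (simp add: h_def)
  qed simp
  have "sqnorm M (\<lambda>x. g ((T ^^ (a * m)) x) - g x)
      \<le> (\<integral>x. real a * (\<Sum>i<a. (h ((T ^^ (i * m)) x))\<^sup>2) \<partial>M)"
    unfolding sqnorm_def
  proof (rule integral_mono)
    fix x
    show "(g ((T ^^ (a * m)) x) - g x)\<^sup>2 \<le> real a * (\<Sum>i<a. (h ((T ^^ (i * m)) x))\<^sup>2)"
      unfolding tel
      using Cauchy_Schwarz_ineq_sum[of "\<lambda>_. 1" "\<lambda>i. h ((T ^^ (i * m)) x)" "{..<a}"] by simp
  qed (auto intro!: bounded_rv_sq bounded_rv_diff bounded_rv_comp assms h)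
  also have "\<dots> = real a * (\<Sum>i<a. sqnorm M (\<lambda>x. h ((T ^^ (i * m)) x)))"
    unfolding sqnorm_def 
    by (subst Bochner_Integration.integral_mult_right) 
       (auto intro!: bounded_rv_sq[OF bounded_rv_comp[OF h]] Bochner_Integration.integral_sum)
  also have "\<dots> = real a * (\<Sum>i<a. sqnorm M h)"
    by (simp add: sqnorm_comp[OF h])
  also have "\<dots> = (real a)\<^sup>2 * sqnorm M h" by (simp add: power2_eq_square)
  finally show ?thesis unfolding h_def .
qed

text \<open>To compare g with g o T, go from x to \<open>(T ^^ (a * m + 1)) x\<close> and back to T
  x. The way back is the displacement under \<open>T ^^ (a * m)\<close> seen from T x, so invariance
  of the norm applies.\<close>

lemma sqnorm_step_le:
  assumes "bounded_rv M g"
  shows "sqnorm M (\<lambda>x. g (T x) - g x) \<le> 2 * sqnorm M (\<lambda>x. g ((T ^^ (a * m + 1)) x) - g x)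
    + 2 * (real a)\<^sup>2 * sqnorm M (\<lambda>x. g ((T ^^ m) x) - g x)"
proof -
  define h where "h = (\<lambda>x. g ((T ^^ (a * m)) x) - g x)"
  have h: "bounded_rv M h" unfolding h_def by (intro bounded_rv_diff bounded_rv_comp assms)
  have "sqnorm M (\<lambda>x. g (T x) - g x) = sqnorm M (\<lambda>x. (g ((T ^^ (a * m + 1)) x) - g x) - h (T x))"
    unfolding h_def by (simp add: funpow_swap1)
  moreover have "\<dots> \<le> 2 * sqnorm M (\<lambda>x. g ((T ^^ (a * m + 1)) x) - g x) + 2 * sqnorm M (\<lambda>x. h (T x))"
    by (intro sqnorm_diff_le bounded_rv_diff bounded_rv_comp bounded_rv_comp1 assms h)
  moreover have "sqnorm M (\<lambda>x. h (T x)) = sqnorm M h" by (rule sqnorm_comp1[OF h])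
  moreover have "sqnorm M h \<le> (real a)\<^sup>2 * sqnorm M (\<lambda>x. g ((T ^^ m) x) - g x)"
    unfolding h_def by (rule sqnorm_funpow_mult_le[OF assms])
  ultimately show ?thesis by linarith
qed

text \<open>This is the average of f (T^(c(F)) x) over all subsets F of {..<k}, that is, the product
  of the operators (1 + U^(c j)) / 2 over j < k applied to f.\<close>

primrec ip_mean :: "(nat \<Rightarrow> nat) \<Rightarrow> ('a \<Rightarrow> real) \<Rightarrow> nat \<Rightarrow> 'a \<Rightarrow> real" where
  "ip_mean c f 0 = f"
| "ip_mean c f (Suc k) = (\<lambda>x. (ip_mean c f k x + ip_mean c f k ((T ^^ c k) x)) / 2)"

lemma bounded_rv_ip_mean: "bounded_rv M f \<Longrightarrow> bounded_rv M (ip_mean c f k)"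
  by (induction k) (auto intro!: bounded_rv_mean bounded_rv_comp)

text \<open>By the parallelogram law, one averaging step lowers the square norm by exactly a quarter
  of the squared displacement, and the losses telescope.\<close>

lemma sum_sqnorm_ip_mean:
  assumes f: "bounded_rv M f"
  shows "(\<Sum>k<K. sqnorm M (\<lambda>x. ip_mean c f k ((T ^^ c k) x) - ip_mean c f k x))
    = 4 * (sqnorm M f - sqnorm M (ip_mean c f K))"
proof (induction K)
  case (Suc K)
  have b: "bounded_rv M (ip_mean c f K)" using f by (rule bounded_rv_ip_mean)
  show ?case
    using sqnorm_parallelogram[OF b bounded_rv_comp[OF b, of "c K"]] Suc sqnorm_comp[OF b, of "c K"]
    by simp
qed simp

text \<open>The later averaging operators commute with U^m and are contractions, so they can only
  shrink a displacement. This replaces the different averages in the telescoping sum by the final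
  one.\<close>

lemma sqnorm_ip_mean_antimono:
  assumes f: "bounded_rv M f" and "k \<le> K"
  shows "sqnorm M (\<lambda>x. ip_mean c f K ((T ^^ m) x) - ip_mean c f K x)
    \<le> sqnorm M (\<lambda>x. ip_mean c f k ((T ^^ m) x) - ip_mean c f k x)"
  using assms(2)
proof (induction K rule: dec_induct)
  case (step K)
  define h where "h = (\<lambda>x. ip_mean c f K ((T ^^ m) x) - ip_mean c f K x)"
  have h: "bounded_rv M h"
    unfolding h_def by (intro bounded_rv_diff bounded_rv_comp bounded_rv_ip_mean f)
  have "(T ^^ c K) ((T ^^ m) x) = (T ^^ m) ((T ^^ c K) x)" for x
    by (metis add.commute comp_apply funpow_add)
  then have "(\<lambda>x. ip_mean c f (Suc K) ((T ^^ m) x) - ip_mean c f (Suc K) x)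
      = (\<lambda>x. (h x + h ((T ^^ c K) x)) / 2)"
    by (auto simp: h_def fun_eq_iff field_simps)
  then have "sqnorm M (\<lambda>x. ip_mean c f (Suc K) ((T ^^ m) x) - ip_mean c f (Suc K) x) \<le> sqnorm M h"
    using sqnorm_mean_le[OF h bounded_rv_comp[OF h]] sqnorm_comp[OF h] by simp
  then show ?case using step.IH unfolding h_def by linarith
qed simp

text \<open>The induction needs a stronger claim, with f shifted along any finite F of indices not
  yet averaged: stage k + 1 at F is the mean of stage k at F and at F with k added.\<close>

lemma sqnorm_ip_mean_diff_le:
  assumes f: "bounded_rv M f"
    and F: "\<And>F. finite F \<Longrightarrow> sqnorm M (\<lambda>x. f ((T ^^ (\<Sum>j\<in>F. c j)) x) - f x) \<le> d"
  shows "sqnorm M (\<lambda>x. ip_mean c f k x - f x) \<le> d"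
proof -
  have "sqnorm M (\<lambda>x. ip_mean c f k ((T ^^ (\<Sum>j\<in>F. c j)) x) - f x) \<le> d"
    if "finite F" "F \<subseteq> {k..}" for F
    using that
  proof (induction k arbitrary: F)
    case 0
    then show ?case using F by simp
  next
    case (Suc k)
    have "k \<notin> F" using Suc.prems by auto
    define G where "G = insert k F"
    have G: "finite G" "G \<subseteq> {k..}" "F \<subseteq> {k..}" using Suc.prems by (auto simp: G_def)
    have "(\<Sum>j\<in>G. c j) = c k + (\<Sum>j\<in>F. c j)" using \<open>k \<notin> F\<close> Suc.prems by (simp add: G_def)
    then have "(\<lambda>x. ip_mean c f (Suc k) ((T ^^ (\<Sum>j\<in>F. c j)) x) - f x) =
        (\<lambda>x. ((ip_mean c f k ((T ^^ (\<Sum>j\<in>F. c j)) x) - f x)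
          + (ip_mean c f k ((T ^^ (\<Sum>j\<in>G. c j)) x) - f x)) / 2)"
      by (auto simp: fun_eq_iff funpow_add field_simps)
    then show ?case
      by (simp only:)
         (intro sqnorm_mean_le Suc.IH[OF Suc.prems(1) G(3)] Suc.IH[OF G(1,2)]
           bounded_rv_diff bounded_rv_comp bounded_rv_ip_mean f)
  qed
  from this[of "{}"] show ?thesis by simp
qed

text \<open>If the sum of 1 / a^2 diverges, this bounds the displacement of f under T by 12 d. The
  step inequality summed over k gives 16 times the square norm for the averaged function g;
  replacing g by f, which is d-close, costs another factor 6 and the error 12 d.\<close>

lemma sum_inverse_square_sqnorm_le:
  assumes f: "bounded_rv M f"
    and F: "\<And>F. finite F \<Longrightarrow> sqnorm M (\<lambda>x. f ((T ^^ (\<Sum>j\<in>F. c j)) x) - f x) \<le> d"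
    and c: "\<And>k. c (Suc k) = a k * c k + 1" and a: "\<And>k. a k \<ge> 1"
  shows "(\<Sum>k<K. 1 / (real (a k))\<^sup>2) * (sqnorm M (\<lambda>x. f (T x) - f x) - 12 * d) \<le> 96 * sqnorm M f"
proof -
  \<comment> \<open>The index is \<open>Suc K\<close> because the k-th inequality involves the
    displacements at both \<open>c k\<close> and \<open>c (Suc k)\<close>.\<close>
  define g where "g = ip_mean c f (Suc K)"
  define s where "s = (\<lambda>k. sqnorm M (\<lambda>x. g ((T ^^ c k) x) - g x))"
  define Z where "Z = (\<Sum>k<K. 1 / (real (a k))\<^sup>2)"
  define D where "D = sqnorm M (\<lambda>x. g (T x) - g x)"
  have g: "bounded_rv M g" unfolding g_def by (rule bounded_rv_ip_mean[OF f])
  have S1: "(\<Sum>k<Suc K. s k)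
      \<le> (\<Sum>k<Suc K. sqnorm M (\<lambda>x. ip_mean c f k ((T ^^ c k) x) - ip_mean c f k x))"
    unfolding s_def g_def by (intro sum_mono sqnorm_ip_mean_antimono[OF f]) auto
  have S: "(\<Sum>k<Suc K. s k) \<le> 4 * sqnorm M f"
    using S1 sqnorm_nonneg[of "ip_mean c f (Suc K)"] unfolding sum_sqnorm_ip_mean[OF f] by simp
  have s0: "s k \<ge> 0" for k unfolding s_def by (rule sqnorm_nonneg)
  have "Z * D = (\<Sum>k<K. D / (real (a k))\<^sup>2)"
    unfolding Z_def sum_distrib_right by simp
  also have "\<dots> \<le> (\<Sum>k<K. 2 * s (Suc k) + 2 * s k)"
  proof (rule sum_mono)
    fix k
    have a1: "(real (a k))\<^sup>2 \<ge> 1" using a[of k] by (simp add: one_le_power)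
    have "D \<le> 2 * s (Suc k) + 2 * (real (a k))\<^sup>2 * s k"
      unfolding D_def s_def c by (rule sqnorm_step_le[OF g])
    also have "\<dots> \<le> (2 * s (Suc k) + 2 * s k) * (real (a k))\<^sup>2"
      using mult_left_mono[OF a1, of "2 * s (Suc k)"] s0[of "Suc k"] by (simp add: algebra_simps)
    finally show "D / (real (a k))\<^sup>2 \<le> 2 * s (Suc k) + 2 * s k"
      using a1 a[of k] by (subst pos_divide_le_eq) auto
  qed
  also have "\<dots> = 2 * (\<Sum>k<K. s (Suc k)) + 2 * (\<Sum>k<K. s k)"
    unfolding sum.distrib sum_distrib_left ..
  also have "\<dots> \<le> 4 * (\<Sum>k<Suc K. s k)"
    using s0[of 0] s0[of K] sum.lessThan_Suc_shift[of s K] sum.lessThan_Suc[of s K] by linarith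
  finally have 1: "Z * D \<le> 16 * sqnorm M f" using S by linarith
  have close: "sqnorm M (\<lambda>x. g x - f x) \<le> d"
    unfolding g_def by (rule sqnorm_ip_mean_diff_le[OF f F])
  have gf: "bounded_rv M (\<lambda>x. g x - f x)" by (intro bounded_rv_diff g f)
  define h where "h = (\<lambda>x. g x - f x)"
  have h: "bounded_rv M h" unfolding h_def by (rule gf)
  have "sqnorm M (\<lambda>x. f (T x) - f x) = sqnorm M (\<lambda>x. (g (T x) - g x) - (h (T x) - h x))"
    by (simp add: algebra_simps h_def)
  moreover have "\<dots> \<le> 2 * D + 2 * sqnorm M (\<lambda>x. h (T x) - h x)"
    unfolding D_def by (intro sqnorm_diff_le bounded_rv_diff bounded_rv_comp1 g h)
  moreover have "sqnorm M (\<lambda>x. h (T x) - h x) \<le> 2 * sqnorm M (\<lambda>x. h (T x)) + 2 * sqnorm M h"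
    by (intro sqnorm_diff_le bounded_rv_comp1 h)
  moreover have "sqnorm M (\<lambda>x. h (T x)) = sqnorm M h"
    by (rule sqnorm_comp1[OF h])
  ultimately have "sqnorm M (\<lambda>x. f (T x) - f x) \<le> 2 * D + 8 * d"
    using close unfolding h_def[symmetric] by linarith
  moreover have "d \<ge> 0" using close sqnorm_nonneg[of "\<lambda>x. g x - f x"] by linarith
  ultimately have "sqnorm M (\<lambda>x. f (T x) - f x) - 12 * d \<le> 6 * D" 
    using sqnorm_nonneg[of "\<lambda>x. g (T x) - g x"] unfolding D_def[symmetric] by linarith
  then have "Z * (sqnorm M (\<lambda>x. f (T x) - f x) - 12 * d) \<le> Z * (6 * D)"
    by (intro mult_left_mono) (auto simp: Z_def intro!: sum_nonneg)
  also have "\<dots> = 6 * (Z * D)" by (rule mult.left_commute)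
  finally have "Z * (sqnorm M (\<lambda>x. f (T x) - f x) - 12 * d) \<le> 96 * sqnorm M f"
    using 1 by simp
  then show ?thesis unfolding Z_def .
qed

end

section \<open>Condition (ii) implies condition (i)\<close>

lemma eventually_IP_filter:
  "eventually P IP_filter \<longleftrightarrow>
    (\<exists>K. \<forall>F. finite F \<and> F \<noteq> {} \<and> F \<subseteq> {1..} \<and> (\<forall>j\<in>F. K \<le> j) \<longrightarrow> P F)" (is "_ \<longleftrightarrow> ?R")
proof
  assume "eventually P IP_filter"
  then have "eventually (\<lambda>F. F \<in> nonempty_finsets \<longrightarrow> P F) (filtercomap Min at_top)"
    unfolding IP_filter_def eventually_inf_principal .
  then obtain Q where Q: "eventually Q at_top" "\<And>F. Q (Min F) \<Longrightarrow> F \<in> nonempty_finsets \<longrightarrow> P F"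
    unfolding eventually_filtercomap by blast
  then obtain K :: nat where K: "\<And>k. k \<ge> K \<Longrightarrow> Q k" unfolding eventually_at_top_linorder by blast
  show ?R
  proof (intro exI allI impI)
    fix F :: "nat set" assume F: "finite F \<and> F \<noteq> {} \<and> F \<subseteq> {1..} \<and> (\<forall>j\<in>F. K \<le> j)"
    then have "Min F \<ge> K" by simp
    then show "P F" using Q(2) K F unfolding nonempty_finsets_def by blast
  qed
next
  assume ?R
  then obtain K where K: "\<And>F. finite F \<Longrightarrow> F \<noteq> {} \<Longrightarrow> F \<subseteq> {1..} \<Longrightarrow> (\<forall>j\<in>F. K \<le> j) \<Longrightarrow> P F" by blast
  have "eventually (\<lambda>F. F \<in> nonempty_finsets \<longrightarrow> P F) (filtercomap Min at_top)"
    unfolding eventually_filtercomap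
  proof (intro exI conjI allI impI)
    show "eventually (\<lambda>k. K \<le> k) at_top" by (rule eventually_ge_at_top)
    fix F :: "nat set" assume "K \<le> Min F" "F \<in> nonempty_finsets"
    then show "P F" by (intro K) (auto simp: nonempty_finsets_def)
  qed
  then show "eventually P IP_filter" unfolding IP_filter_def eventually_inf_principal .
qed

lemma MPT_measure_preserving_map:
  assumes "prob_space M" "T \<in> MPT M" shows "measure_preserving_map M T"
  using assms unfolding measure_preserving_map_def measure_preserving_map_axioms_def MPT_def by auto

text \<open>Rigidity speaks of forward images, measurability of preimages. The forward image is the
  preimage under the inverse, which is measurable too.\<close>

lemma MPT_image_sets:
  assumes T: "T \<in> MPT M" and A: "A \<in> sets M"
  shows "T ` A \<in> sets M"
proof -
  have bij: "bij_betw T (space M) (space M)" and inv: "the_inv_into (space M) T \<in> measurable M M"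
    using T by (auto simp: MPT_def)
  have sub: "A \<subseteq> space M" using A by (rule sets.sets_into_space)
  have inj: "inj_on T (space M)" and im: "T ` space M = space M"
    using bij by (auto simp: bij_betw_def)
  have "T ` A = the_inv_into (space M) T -` A \<inter> space M"
  proof (intro equalityI subsetI)
    fix y assume "y \<in> T ` A"
    then show "y \<in> the_inv_into (space M) T -` A \<inter> space M"
      using sub inj im by (auto simp: the_inv_into_f_f)
  next
    fix y assume "y \<in> the_inv_into (space M) T -` A \<inter> space M"
    then show "y \<in> T ` A" using inj im by (auto simp: image_iff f_the_inv_into_f intro!: bexI[of _ "the_inv_into (space M) T y"])
  qed
  then show ?thesis using measurable_sets[OF inv A] by simp
qed

lemma MPT_funpow_bij: "T \<in> MPT M \<Longrightarrow> bij_betw (T ^^ k) (space M) (space M)"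
  by (rule bij_betw_funpow) (auto simp: MPT_def)

lemma MPT_funpow_image_sets:
  assumes "T \<in> MPT M" "A \<in> sets M" shows "(T ^^ k) ` A \<in> sets M"
proof (induction k)
  case (Suc k)
  then show ?case using MPT_image_sets[OF assms(1) Suc] by (simp add: image_comp)
qed (use assms in simp)

text \<open>Pulling the symmetric difference back by \<open>T ^^ k\<close> preserves its measure and
  turns the image of A into A, and A into its preimage; what remains is the integral of a squared
  difference of indicators.\<close>

lemma measure_sym_diff_funpow_image:
  assumes "prob_space M" "T \<in> MPT M" "A \<in> sets M"
  shows "measure M (sym_diff A ((T ^^ k) ` A))
    = sqnorm M (\<lambda>x. indicator A ((T ^^ k) x) - indicator A x)"
proof -
  interpret measure_preserving_map M T by (rule MPT_measure_preserving_map[OF assms(1,2)])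
  note A[measurable] = assms(3)
  define B where "B = (T ^^ k) ` A"
  have B[measurable]: "B \<in> sets M" unfolding B_def by (rule MPT_funpow_image_sets[OF assms(2,3)])
  have inj: "inj_on (T ^^ k) (space M)" using MPT_funpow_bij[OF assms(2)] by (auto simp: bij_betw_def)
  have sub: "A \<subseteq> space M" using A by (rule sets.sets_into_space)
  have mem: "(T ^^ k) x \<in> B \<longleftrightarrow> x \<in> A" if "x \<in> space M" for x
    unfolding B_def using inj_on_image_mem_iff[OF inj that sub] .
  have "measure M (sym_diff A B) = measure (distr M M (T ^^ k)) (sym_diff A B)"
    by (simp only: distr_funpow)
  also have "\<dots> = measure M ((T ^^ k) -` sym_diff A B \<inter> space M)"
    by (intro measure_distr) auto
  also have "\<dots> = (\<integral>x. indicator ((T ^^ k) -` sym_diff A B \<inter> space M) x \<partial>M)"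
    by simp
  also have "\<dots> = (\<integral>x. (indicator A ((T ^^ k) x) - indicator A x)\<^sup>2 \<partial>M)"
  proof (rule Bochner_Integration.integral_cong)
    fix x assume "x \<in> space M"
    then show "indicator ((T ^^ k) -` sym_diff A B \<inter> space M) x = (indicator A ((T ^^ k) x) - indicator A x :: real)\<^sup>2"
      using mem[of x] by (auto simp: indicator_def)
  qed simp
  finally show ?thesis unfolding sqnorm_def B_def .
qed

lemma erdos_taylorE:
  assumes "erdos_taylor b"
  obtains a where "\<And>n. n \<ge> 1 \<Longrightarrow> a n \<ge> 1" "b 1 = 1" "\<And>n. n \<ge> 1 \<Longrightarrow> b (Suc n) = a n * b n + 1"
  using assms unfolding erdos_taylor_def erdos_taylor_assoc_def by auto

lemma erdos_taylor_pos:
  assumes "erdos_taylor b" "n \<ge> 1" shows "b n \<ge> 1"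
proof -
  obtain a where "b 1 = 1" "\<And>n. n \<ge> 1 \<Longrightarrow> b (Suc n) = a n * b n + 1"
    using erdos_taylorE[OF assms(1)] by metis
  then show ?thesis using assms(2) by (cases n; cases "n = 1") auto
qed

text \<open>Since b_(n+1) exceeds a_n b_n, each ratio is at most 1 / a_n, and the start of the
  series does not affect convergence.\<close>

lemma summable_ratio_if_inverse_square:
  assumes a: "\<And>n. n \<ge> 1 \<Longrightarrow> a n \<ge> 1" and b: "\<And>n. n \<ge> 1 \<Longrightarrow> b (Suc n) = a n * b n + (1::nat)"
    and m: "m \<ge> 1" and s: "summable (\<lambda>k. 1 / (real (a (m + k)))\<^sup>2)"
  shows "summable (\<lambda>n. (real (b (Suc n)) / real (b (Suc (Suc n))))\<^sup>2)"
proof -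
  have le: "(real (b n) / real (b (Suc n)))\<^sup>2 \<le> 1 / (real (a n))\<^sup>2" if "n \<ge> 1" for n
  proof -
    have "real (b n) / real (b (Suc n)) \<le> 1 / real (a n)"
    proof -
      have *: "x / r \<le> 1 / y" if "y > 0" "r > 0" "x * y \<le> r" for x y r :: real
        using that by (simp add: field_simps)
      have "real (b n) * real (a n) \<le> real (b (Suc n))" unfolding b[OF that] by (simp add: mult.commute[of "real (b n)"])
      then show ?thesis using a[OF that] by (intro *) (auto simp: b[OF that] simp del: of_nat_add of_nat_mult)
    qed
    then have "(real (b n) / real (b (Suc n)))\<^sup>2 \<le> (1 / real (a n))\<^sup>2" by (rule power_mono) simp
    then show ?thesis by (simp add: power_divide)
  qed
  have "summable (\<lambda>k. (real (b (m + k)) / real (b (Suc (m + k))))\<^sup>2)"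
    by (rule summable_comparison_test'[OF s]) (use le m in auto)
  moreover obtain l where "m = Suc l" using m by (cases m) auto
  ultimately have "summable (\<lambda>k. (\<lambda>n. (real (b (Suc n)) / real (b (Suc (Suc n))))\<^sup>2) (k + l))"
    by (simp add: add.commute)
  then show ?thesis by (subst (asm) summable_iff_shift)
qed

lemma IPRWM_imp_summable:
  assumes M: "standard_nonatomic_prob_space M" and b: "erdos_taylor b" and ip: "b \<in> IPRWM M"
  shows "summable (\<lambda>n. (real (b (Suc n)) / real (b (Suc (Suc n))))\<^sup>2)"
proof (rule ccontr)
  assume ns: "\<not> ?thesis"
  obtain a where a: "\<And>n. n \<ge> 1 \<Longrightarrow> a n \<ge> 1" and rec: "\<And>n. n \<ge> 1 \<Longrightarrow> b (Suc n) = a n * b n + 1"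
    using erdos_taylorE[OF b] by metis
  obtain T where T: "T \<in> MPT M" and wm: "weakly_mixing M T" and rig: "IP_rigid M T b"
    using ip unfolding IPRWM_def by blast
  have P: "prob_space M" using M by (simp add: standard_nonatomic_prob_space_def)
  interpret measure_preserving_map M T by (rule MPT_measure_preserving_map[OF P T])
  have zero: "sqnorm M (\<lambda>x. indicator A (T x) - indicator A x) = 0" if A: "A \<in> sets M" for A
  proof -
    define f where "f = (\<lambda>x. indicator A x :: real)"
    define s where "s = sqnorm M (\<lambda>x. f (T x) - f x)"
    have f: "bounded_rv M f" unfolding bounded_rv_def f_def
      using A by (auto intro!: exI[of _ 1] simp: indicator_def)
    have "s \<le> 12 * d" if "d > 0" for d
    proof (rule ccontr)
      assume "\<not> s \<le> 12 * d"
      have "eventually (\<lambda>F. dist (measure M (sym_diff A ((T ^^ (\<Sum>j\<in>F. b j)) ` A))) 0 < d) IP_filter"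
        using rig A \<open>d > 0\<close> unfolding IP_rigid_def by (intro tendstoD) auto
      then obtain K where K: "\<forall>F. finite F \<and> F \<noteq> {} \<and> F \<subseteq> {1..} \<and> (\<forall>j\<in>F. K \<le> j)
          \<longrightarrow> dist (measure M (sym_diff A ((T ^^ (\<Sum>j\<in>F. b j)) ` A))) 0 < d"
        unfolding eventually_IP_filter ..
      \<comment> \<open>One more than \<open>K\<close>, so that every index \<open>m + j\<close> is
        both at least \<open>K\<close> and at least 1, as \<open>IP_filter\<close> demands.\<close>
      define m where "m = Suc K"
      have m: "m \<ge> 1" by (simp add: m_def)
      have F: "sqnorm M (\<lambda>x. f ((T ^^ (\<Sum>j\<in>F. b (m + j))) x) - f x) \<le> d" if "finite F" for F
      proof (cases "F = {}")
        case True
        then show ?thesis using \<open>d > 0\<close> by (simp add: sqnorm_def)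
      next
        case False
        have "(\<Sum>j\<in>(+) m ` F. b j) = (\<Sum>j\<in>F. b (m + j))"
          by (subst sum.reindex) auto
        moreover have "dist (measure M (sym_diff A ((T ^^ (\<Sum>j\<in>(+) m ` F. b j)) ` A))) 0 < d"
          by (rule K[rule_format]) (use that False in \<open>auto simp: m_def\<close>)
        ultimately show ?thesis
          using measure_sym_diff_funpow_image[OF P T A, of "\<Sum>j\<in>F. b (m + j)"]
          unfolding f_def dist_real_def by simp
      qed
      have "(\<Sum>k<N. 1 / (real (a (m + k)))\<^sup>2) * (s - 12 * d) \<le> 96 * sqnorm M f" for N
        unfolding s_def using m by (intro sum_inverse_square_sqnorm_le[OF f F]) (auto simp: rec intro!: a[unfolded One_nat_def])
      then have "(\<Sum>k<N. 1 / (real (a (m + k)))\<^sup>2) \<le> 96 * sqnorm M f / (s - 12 * d)" for N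
        using \<open>\<not> s \<le> 12 * d\<close> by (subst pos_le_divide_eq) auto
      then have "summable (\<lambda>k. 1 / (real (a (m + k)))\<^sup>2)"
        by (intro summableI_nonneg_bounded) auto
      then show False using summable_ratio_if_inverse_square[of a b m] a rec m ns by blast
    qed
    then have "s \<le> 0 + e" if "e > 0" for e using that \<open>\<And>d. d > 0 \<Longrightarrow> s \<le> 12 * d\<close>[of "e / 12"] by simp
    then have "s \<le> 0" by (rule field_le_epsilon)
    then show ?thesis using sqnorm_nonneg[of "\<lambda>x. f (T x) - f x"] unfolding s_def f_def by linarith
  qed
  \<comment> \<open>Every set is invariant up to a null set, hence its correlation with itself is
    constantly m(A). Weak mixing with both sets equal to A forces m(A) = m(A)^2.\<close>
  have m01: "measure M A = 0 \<or> measure M A = 1" if A: "A \<in> sets M" for A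
  proof -
    define f where "f = (\<lambda>x. indicator A x :: real)"
    have f: "bounded_rv M f" unfolding bounded_rv_def f_def
      using A by (auto intro!: exI[of _ 1] simp: indicator_def)
    have inv: "measure M ((T ^^ n) -` A \<inter> A) = measure M A" for n
    proof -
      define D where "D = sym_diff ((T ^^ n) -` A \<inter> space M) A"
      have pre: "(T ^^ n) -` A \<inter> space M \<in> sets M" using A by measurable
      have D: "D \<in> sets M" unfolding D_def using A pre by auto
      have "sqnorm M (\<lambda>x. f ((T ^^ n) x) - f x) \<le> 0"
        using sqnorm_funpow_mult_le[OF f, of n 1] zero[OF A] by (simp add: f_def)
      moreover have "sqnorm M (\<lambda>x. f ((T ^^ n) x) - f x) = (\<integral>x. indicator D x \<partial>M)"
        unfolding sqnorm_def f_def D_def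
        by (rule Bochner_Integration.integral_cong) (auto simp: indicator_def)
      ultimately have "measure M D \<le> 0" using D by simp
      then have D0: "measure M D = 0" by (simp add: measure_le_0_iff)
      have AI: "(T ^^ n) -` A \<inter> A = ((T ^^ n) -` A \<inter> space M) \<inter> A" 
        using sets.sets_into_space[OF A] by auto
      have AD: "A - (T ^^ n) -` A = A - ((T ^^ n) -` A \<inter> space M)"
        using sets.sets_into_space[OF A] by auto
      have "measure M (((T ^^ n) -` A \<inter> A) \<union> (A - (T ^^ n) -` A))
          = measure M ((T ^^ n) -` A \<inter> A) + measure M (A - (T ^^ n) -` A)"
        using A pre AI AD by (intro finite_measure_Union) auto
      moreover have "((T ^^ n) -` A \<inter> A) \<union> (A - (T ^^ n) -` A) = A" by blast
      ultimately have "measure M A = measure M ((T ^^ n) -` A \<inter> A) + measure M (A - (T ^^ n) -` A)"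
        by simp
      moreover have "measure M (A - (T ^^ n) -` A) \<le> measure M D"
        using D by (intro finite_measure_mono) (auto simp: D_def)
      ultimately show ?thesis using D0 measure_nonneg[of M "A - (T ^^ n) -` A"] by linarith
    qed
    have "(\<lambda>N. (\<Sum>n<N. \<bar>measure M ((T ^^ n) -` A \<inter> A) - measure M A * measure M A\<bar>) / real N)
      \<longlonglongrightarrow> 0" using wm A unfolding weakly_mixing_def by blast
    then have "(\<lambda>N. (\<Sum>n<N. \<bar>measure M A - measure M A * measure M A\<bar>) / real N) \<longlonglongrightarrow> 0"
      unfolding inv .
    moreover have "(\<lambda>N. (\<Sum>n<N. \<bar>measure M A - measure M A * measure M A\<bar>) / real N)
        \<longlonglongrightarrow> \<bar>measure M A - measure M A * measure M A\<bar>"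
      by (rule tendsto_eventually, rule eventually_sequentiallyI[of 1]) simp
    ultimately have "\<bar>measure M A - measure M A * measure M A\<bar> = 0"
      using LIMSEQ_unique by blast
    then have "measure M A * (1 - measure M A) = 0" by (simp add: algebra_simps)
    then show ?thesis by simp
  qed
  \<comment> \<open>A probability that takes only the values 0 and 1 has the whole space as an atom,
    contrary to the choice of \<open>M\<close>.\<close>
  have "atom M (space M)"
    unfolding atom_def using m01 prob_space by auto
  then show False using M by (auto simp: standard_nonatomic_prob_space_def)
qed

section \<open>The group of square summability\<close>

definition dist_int :: "real \<Rightarrow> real" where
  "dist_int x = \<bar>x - of_int (round x)\<bar>"

lemma dist_int_le: "dist_int x \<le> \<bar>x - of_int n\<bar>"
  unfolding dist_int_def by (rule round_diff_minimal)

lemma dist_int_le_Ints: "z \<in> \<int> \<Longrightarrow> dist_int x \<le> \<bar>x - z\<bar>"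
  by (metis Ints_cases dist_int_le)

lemma dist_int_nonneg: "dist_int x \<ge> 0"
  by (simp add: dist_int_def)

lemma dist_int_eq_0_iff: "dist_int x = 0 \<longleftrightarrow> x \<in> \<int>"
proof
  assume "dist_int x = 0"
  then have "x = of_int (round x)" by (simp add: dist_int_def)
  then show "x \<in> \<int>" by (metis Ints_of_int)
next
  assume "x \<in> \<int>"
  then show "dist_int x = 0" using dist_int_le_Ints[of x x] dist_int_nonneg[of x] by simp
qed

lemma dist_int_eq_Inf: "(INF n::int. \<bar>x - of_int n\<bar>) = dist_int x"
  by (rule cInf_eq_minimum) (auto simp: dist_int_def round_diff_minimal)

lemma dist_int_add: "dist_int (x + y) \<le> dist_int x + dist_int y"
  using dist_int_le[of "x + y" "round x + round y"] unfolding dist_int_def by simp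

lemma dist_int_minus: "dist_int (- x) = dist_int x"
  using dist_int_le[of "- x" "- round x"] dist_int_le[of x "- round (- x)"]
  unfolding dist_int_def by simp

lemma dist_int_mult: "dist_int (real k * x) \<le> real k * dist_int x"
proof -
  have "dist_int (real k * x) \<le> \<bar>real k * x - of_int (int k * round x)\<bar>" by (rule dist_int_le)
  also have "\<dots> = \<bar>real k * (x - of_int (round x))\<bar>" by (simp add: algebra_simps)
  finally show ?thesis by (simp add: abs_mult dist_int_def)
qed

lemma circle_norm_mult_abs: "circle_norm (circle_mult k (abs_circle x)) = dist_int (real k * x)"
  by (simp add: circle_mult.abs_eq circle_norm.abs_eq dist_int_eq_Inf)

lemma abs_circle_in_G2_iff:
  "abs_circle x \<in> G2 b \<longleftrightarrow> summable (\<lambda>n. (dist_int (real (b (Suc n)) * x))\<^sup>2)"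
  by (simp add: G2_def circle_norm_mult_abs)

lemma abs_circle_cases: obtains x where "t = abs_circle x"
  by (rule that[of "rep_circle t"]) (simp add: Quotient_abs_rep[OF Quotient_circle])

lemma abs_circle_eq_iff: "abs_circle x = abs_circle y \<longleftrightarrow> x - y \<in> \<int>"
  using circle.abs_eq_iff by blast

lemma uncountable_G2_imp_summable:
  assumes b: "erdos_taylor b" and unc: "uncountable (G2 b)"
  shows "summable (\<lambda>n. (real (b (Suc n)) / real (b (Suc (Suc n))))\<^sup>2)"
proof -
  obtain a where a: "\<And>n. n \<ge> 1 \<Longrightarrow> a n \<ge> 1" and rec: "\<And>n. n \<ge> 1 \<Longrightarrow> b (Suc n) = a n * b n + 1"
    using erdos_taylorE[OF b] by metis
  \<comment> \<open>An uncountable set has a point other than 0, and a single such point yields the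
    bound on all the 1 / a_n.\<close>
  have "\<not> G2 b \<subseteq> {abs_circle 0}" using unc countable_subset by blast
  then obtain t where t: "t \<in> G2 b" "t \<noteq> abs_circle 0" by blast
  obtain x where x: "t = abs_circle x" by (rule abs_circle_cases)
  define D where "D = dist_int x"
  define e where "e = (\<lambda>n. dist_int (real (b n) * x))"
  have "x \<notin> \<int>" using t x abs_circle_eq_iff[of x 0] by auto
  then have D: "D > 0" using dist_int_eq_0_iff[of x] dist_int_nonneg[of x] by (auto simp: D_def)
  have sum: "summable (\<lambda>n. (e (Suc n))\<^sup>2)"
    using t x by (simp add: abs_circle_in_G2_iff e_def)
  have key: "D\<^sup>2 / (real (a n))\<^sup>2 \<le> 2 * (e (Suc n))\<^sup>2 + 2 * (e n)\<^sup>2" if n: "n \<ge> 1" for n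
  proof -
    have an: "real (a n) \<ge> 1" using a[OF n] by simp
    have eq: "x = real (b (Suc n)) * x + - (real (a n) * (real (b n) * x))"
      by (simp add: rec[OF n] algebra_simps)
    have "D \<le> e (Suc n) + dist_int (real (a n) * (real (b n) * x))"
      unfolding D_def e_def by (subst eq) (metis dist_int_add dist_int_minus)
    also have "\<dots> \<le> e (Suc n) + real (a n) * e n"
      unfolding e_def using dist_int_mult by simp
    also have "\<dots> \<le> real (a n) * (e (Suc n) + e n)"
      using mult_right_mono[OF an, of "e (Suc n)"] dist_int_nonneg by (simp add: e_def algebra_simps)
    finally have "D / real (a n) \<le> e (Suc n) + e n"
      using an by (simp add: divide_le_eq mult.commute)
    then have "(D / real (a n))\<^sup>2 \<le> (e (Suc n) + e n)\<^sup>2"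
      using D by (intro power_mono) auto
    also have "\<dots> \<le> 2 * (e (Suc n))\<^sup>2 + 2 * (e n)\<^sup>2"
      using zero_le_power2[of "e (Suc n) - e n"] by (simp add: power2_eq_square algebra_simps)
    finally show ?thesis by (simp add: power_divide)
  qed
  have "summable (\<lambda>k. 2 * (e (Suc (Suc k)))\<^sup>2 + 2 * (e (Suc k))\<^sup>2)"
    using sum summable_Suc_iff[of "\<lambda>n. (e (Suc n))\<^sup>2"] by (intro summable_add summable_mult) auto
  then have "summable (\<lambda>k. D\<^sup>2 / (real (a (1 + k)))\<^sup>2)"
    by (rule summable_comparison_test') (use key in auto)
  then have "summable (\<lambda>k. (1 / D\<^sup>2) * (D\<^sup>2 / (real (a (1 + k)))\<^sup>2))" by (rule summable_mult)
  then have "summable (\<lambda>k. 1 / (real (a (1 + k)))\<^sup>2)" using D by simp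
  then show ?thesis using summable_ratio_if_inverse_square[of a b 1] a rec by blast
qed

section \<open>Walks whose limits form a Cantor set\<close>

locale fast_growth =
  fixes c a :: "nat \<Rightarrow> nat"
  assumes rec: "c (Suc k) = a k * c k + 1"
    and growth: "8 * c k \<le> c (Suc k)"
    and c0: "8 \<le> c 0"
begin

lemma c_ge: "8 ^ Suc k \<le> c k"
proof (induction k)
  case (Suc k)
  then show ?case using growth[of k] by simp
qed (use c0 in simp)

lemma c_pos: "c k > 0" 
  using c_ge[of k] by (metis gr0I not_less_zero linorder_not_le zero_less_numeral zero_less_power)

text \<open>The factor 7 comes from 1/8 + 1/64 + ... = 1/7. In the form used later: a step of size 1
  / c_(k+1) followed by a movement within 1 / (7 c_(k+1)) adds up to 8 / (7 c_(k+1)) and so stays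
  within 1 / (7 c_k).\<close>

lemma inverse_c_step: "8 / (7 * real (c (Suc k))) \<le> 1 / (7 * real (c k))"
proof -
  have "8 * real (c k) \<le> real (c (Suc k))" using growth[of k] by linarith
  then show ?thesis using c_pos[of k] c_pos[of "Suc k"] by (simp add: field_simps)
qed

definition up :: "nat \<Rightarrow> real \<Rightarrow> real" where "up k t = t + (1 - t) / real (c (Suc k))"
definition dn :: "nat \<Rightarrow> real \<Rightarrow> real" where "dn k t = t - t / real (c (Suc k))"

lemma up_minus_dn: "up k t - dn k t = 1 / real (c (Suc k))"
  by (simp add: up_def dn_def diff_divide_distrib)

lemma up_dn_close:
  assumes "0 \<le> t" "t \<le> 1"
  shows "\<bar>up k t - t\<bar> \<le> 1 / real (c (Suc k))" "\<bar>dn k t - t\<bar> \<le> 1 / real (c (Suc k))"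
  using assms c_pos[of "Suc k"] by (auto simp: up_def dn_def divide_right_mono)

text \<open>This is where the Erdos-Taylor recursion enters: c_(k+1) - 1 = a_k c_k, so c_(k+1) times
  the lower point is a_k times the integer c_k t, and the upper point adds exactly 1.\<close>

lemma up_dn_Ints:
  assumes "real (c k) * t \<in> \<int>"
  shows "real (c (Suc k)) * up k t \<in> \<int>" "real (c (Suc k)) * dn k t \<in> \<int>"
proof -
  have *: "real (c (Suc k)) * dn k t = real (a k) * (real (c k) * t)"
    "real (c (Suc k)) * up k t = real (a k) * (real (c k) * t) + 1"
  proof -
    have C: "C * (t - t / C) = (C - 1) * t" "C * (t + (1 - t) / C) = (C - 1) * t + 1" if "C \<noteq> 0" for C :: real
      using that by (simp_all add: field_simps)
    have "real (c (Suc k)) - 1 = real (a k) * real (c k)" by (simp add: rec)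
    then show "real (c (Suc k)) * dn k t = real (a k) * (real (c k) * t)"
      "real (c (Suc k)) * up k t = real (a k) * (real (c k) * t) + 1"
      using C[of "real (c (Suc k))"] c_pos[of "Suc k"] by (simp_all add: up_def dn_def)
  qed
  show "real (c (Suc k)) * up k t \<in> \<int>" "real (c (Suc k)) * dn k t \<in> \<int>"
    unfolding * using assms by auto
qed

text \<open>The margin \<open>1 / (7 c\<^sub>k)\<close> bounds the sum of all later increments, so that every walk
  started at a safe point stays in \<open>[1/10, 2/5]\<close>.\<close>

definition safe :: "nat \<Rightarrow> real \<Rightarrow> bool" where
  "safe k t \<longleftrightarrow> 1 / 10 + 1 / (7 * real (c k)) \<le> t \<and> t \<le> 2 / 5 - 1 / (7 * real (c k))
    \<and> real (c k) * t \<in> \<int>"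

lemma safe_bounds: 
  assumes "safe k t" "\<bar>x - t\<bar> \<le> 1 / (7 * real (c k))" shows "1 / 10 \<le> x" "x \<le> 2 / 5"
  using assms by (auto simp: safe_def abs_le_iff)

lemma safe_bounds_self: 
  assumes "safe k t" shows "1 / 10 \<le> t" "t \<le> 2 / 5"
  using safe_bounds[OF assms, of t] by auto

lemma step_radius:
  assumes "\<bar>s - t\<bar> \<le> 1 / real (c (Suc k))" "\<bar>x - s\<bar> \<le> 1 / (7 * real (c (Suc k)))"
  shows "\<bar>x - t\<bar> \<le> 1 / (7 * real (c k))"
proof -
  have "1 / real (c (Suc k)) + 1 / (7 * real (c (Suc k))) = 8 / (7 * real (c (Suc k)))"
    using c_pos[of "Suc k"] by (simp add: field_simps)
  then show ?thesis using assms inverse_c_step[of k] by linarith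
qed

lemma safe_step:
  assumes "safe k t" shows "safe (Suc k) (up k t)" "safe (Suc k) (dn k t)"
proof -
  have t: "0 \<le> t" "t \<le> 1" using safe_bounds_self[OF assms] by auto
  have e: "1 / real (c (Suc k)) + 1 / (7 * real (c (Suc k))) = 8 / (7 * real (c (Suc k)))"
    using c_pos[of "Suc k"] by (simp add: field_simps)
  show "safe (Suc k) (up k t)" "safe (Suc k) (dn k t)"
    using assms up_dn_close[OF t, of k] up_dn_Ints[of k t] e inverse_c_step[of k]
    unfolding safe_def by (auto simp: abs_le_iff)
qed

text \<open>A multiple of 1 / c_0 just below 1/4, the midpoint of [1/10, 2/5]. The assumption 8
  \<le> c_0 makes the rounding error and the margin 1 / (7 c_0) fit into that interval.\<close>

definition t0 :: real where "t0 = real (c 0 div 4) / real (c 0)"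

lemma safe_t0: "safe 0 t0"
proof -
  have c: "real (c 0) \<ge> 8" using c0 by simp
  have up: "t0 \<le> 1 / 4"
    using c by (simp add: t0_def divide_le_eq)
  have "4 * (c 0 div 4) + 3 \<ge> c 0" by linarith
  then have "4 * real (c 0 div 4) + 3 \<ge> real (c 0)" by linarith
  then have "(real (c 0) - 3) / 4 / real (c 0) \<le> t0"
    unfolding t0_def using c by (intro divide_right_mono) auto
  moreover have "(real (c 0) - 3) / 4 / real (c 0) = 1 / 4 - (3 / 4) * (1 / real (c 0))"
    using c by (simp add: field_simps)
  moreover have "1 / real (c 0) \<le> 1 / 8" using c by (intro divide_left_mono) auto
  moreover have "1 / (7 * real (c 0)) = (1 / 7) * (1 / real (c 0))" by simp
  ultimately have "1 / 10 + 1 / (7 * real (c 0)) \<le> t0" "1 / 4 \<le> 2 / 5 - 1 / (7 * real (c 0))"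
    by linarith+
  moreover have "real (c 0) * t0 \<in> \<int>" using c by (simp add: t0_def)
  ultimately show ?thesis using up unfolding safe_def by linarith
qed

primrec walk :: "(nat \<Rightarrow> bool) \<Rightarrow> nat \<Rightarrow> real" where
  "walk m 0 = t0"
| "walk m (Suc k) = (if m k then up k (walk m k) else dn k (walk m k))"

lemma safe_walk: "safe k (walk m k)"
  by (induction k) (auto simp: safe_t0 safe_step)

lemma walk_step: "\<bar>walk m (Suc k) - walk m k\<bar> \<le> 1 / real (c (Suc k))"
  using up_dn_close[of "walk m k" k] safe_bounds_self[OF safe_walk[of k m]] by simp

text \<open>The subtracted term is the room left for future steps; with it the induction
  closes.\<close>

lemma walk_close: "\<bar>walk m (k + j) - walk m k\<bar> \<le> 1 / (7 * real (c k)) - 1 / (7 * real (c (k + j)))"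
proof (induction j)
  case (Suc j)
  have "1 / real (c (Suc (k + j))) + 1 / (7 * real (c (Suc (k + j)))) = 8 / (7 * real (c (Suc (k + j))))"
    using c_pos[of "Suc (k + j)"] by (simp add: field_simps)
  then show ?case using Suc walk_step[of m "k + j"] inverse_c_step[of "k + j"] 
    unfolding add_Suc_right by linarith
qed simp

lemma walk_close': "k \<le> n \<Longrightarrow> \<bar>walk m n - walk m k\<bar> \<le> 1 / (7 * real (c k))"
proof -
  assume "k \<le> n"
  then have "\<bar>walk m n - walk m k\<bar> \<le> 1 / (7 * real (c k)) - 1 / (7 * real (c n))"
    using walk_close[of m k "n - k"] by simp
  moreover have "1 / (7 * real (c n)) \<ge> 0" by simp
  ultimately show ?thesis by linarith
qed

lemma inverse_c_tendsto: "(\<lambda>k. 1 / (7 * real (c k))) \<longlonglongrightarrow> 0"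
proof (rule tendsto_sandwich[of "\<lambda>_. 0" _ _ "\<lambda>k. (1/8 :: real) ^ k"])
  have "1 / (7 * real (c k)) \<le> (1/8) ^ k" for k
  proof -
    have "(8::real) ^ k \<le> 8 ^ Suc k" by simp
    also have "\<dots> \<le> real (c k)" using c_ge[of k] by (metis of_nat_le_iff of_nat_numeral of_nat_power)
    also have "\<dots> \<le> 7 * real (c k)" by simp
    finally have "1 / (7 * real (c k)) \<le> 1 / 8 ^ k" 
      using c_pos[of k] by (intro divide_left_mono) auto
    then show ?thesis by (simp add: power_one_over)
  qed
  then show "\<forall>\<^sub>F k in sequentially. 1 / (7 * real (c k)) \<le> (1/8) ^ k" by simp
  show "(\<lambda>k. (1/8::real) ^ k) \<longlonglongrightarrow> 0" by (rule LIMSEQ_power_zero) simp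
qed auto

definition endpoint :: "(nat \<Rightarrow> bool) \<Rightarrow> real" where "endpoint m = lim (walk m)"

lemma walk_tendsto: "walk m \<longlonglongrightarrow> endpoint m"
proof -
  have "Cauchy (walk m)"
  proof (rule metric_CauchyI)
    fix e :: real assume "e > 0"
    then have "eventually (\<lambda>k. 1 / (7 * real (c k)) < e / 2) sequentially"
      using inverse_c_tendsto by (intro order_tendstoD) auto
    then obtain K where K: "1 / (7 * real (c K)) < e / 2" by (auto simp: eventually_sequentially)
    show "\<exists>K. \<forall>i\<ge>K. \<forall>j\<ge>K. dist (walk m i) (walk m j) < e"
    proof (intro exI allI impI)
      fix i j assume "K \<le> i" "K \<le> j"
      then show "dist (walk m i) (walk m j) < e"
        using walk_close'[of K i m] walk_close'[of K j m] K unfolding dist_real_def by linarith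
    qed
  qed
  then show ?thesis unfolding endpoint_def by (simp add: Cauchy_convergent convergent_LIMSEQ_iff[symmetric])
qed

lemma endpoint_close: "\<bar>endpoint m - walk m k\<bar> \<le> 1 / (7 * real (c k))"
proof (rule tendsto_upperbound)
  show "(\<lambda>n. \<bar>walk m n - walk m k\<bar>) \<longlonglongrightarrow> \<bar>endpoint m - walk m k\<bar>"
    by (intro tendsto_intros walk_tendsto)
  show "\<forall>\<^sub>F n in sequentially. \<bar>walk m n - walk m k\<bar> \<le> 1 / (7 * real (c k))"
    using walk_close' by (auto simp: eventually_sequentially)
qed simp

text \<open>At time k the walk is at a point whose product with c_k is an integer, and from there it
  moves by at most (1 + 1/7) / c_(k+1).\<close>

lemma dist_int_endpoint: "dist_int (real (c k) * endpoint m) \<le> 2 * (real (c k) / real (c (Suc k)))"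
proof -
  have "\<bar>endpoint m - walk m k\<bar> \<le> 2 / real (c (Suc k))"
  proof -
    have "1 / (7 * real (c (Suc k))) = (1 / 7) * (1 / real (c (Suc k)))" by simp
    moreover have "2 / real (c (Suc k)) = 2 * (1 / real (c (Suc k)))" by simp
    moreover have "1 / real (c (Suc k)) \<ge> 0" by simp
    ultimately show ?thesis using endpoint_close[of m "Suc k"] walk_step[of m k] by linarith
  qed
  then have "real (c k) * \<bar>endpoint m - walk m k\<bar> \<le> real (c k) * (2 / real (c (Suc k)))"
    by (rule mult_left_mono) simp
  moreover have "dist_int (real (c k) * endpoint m) \<le> \<bar>real (c k) * endpoint m - real (c k) * walk m k\<bar>"
    using safe_walk[of k m] by (intro dist_int_le_Ints) (simp add: safe_def)
  ultimately show ?thesis by (simp add: abs_mult right_diff_distrib[symmetric] mult.commute)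
qed

lemma endpoint_bounds: "0 < endpoint m" "endpoint m < 1"
  using safe_bounds[OF safe_walk[of 0 m] endpoint_close] by auto

text \<open>At the first disagreement the walks separate by 1 / c_(k+1), while afterwards each moves
  by at most a seventh of that.\<close>

lemma inj_endpoint: "inj endpoint"
proof (rule injI, rule ccontr)
  fix m m' assume eq: "endpoint m = endpoint m'" and "m \<noteq> m'"
  then obtain i where "m i \<noteq> m' i" by blast
  define k where "k = (LEAST i. m i \<noteq> m' i)"
  have k: "m k \<noteq> m' k" unfolding k_def by (rule LeastI) fact
  have less: "m i = m' i" if "i < k" for i using not_less_Least[OF that[unfolded k_def]] by blast
  have "walk m i = walk m' i" if "i \<le> k" for i
    using that by (induction i) (auto simp: less)
  then have "\<bar>walk m (Suc k) - walk m' (Suc k)\<bar> = 1 / real (c (Suc k))"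
    using k up_minus_dn[of k "walk m' k"] by (auto simp: abs_minus_commute[of "dn _ _"])
  moreover have "1 / (7 * real (c (Suc k))) = (1 / 7) * (1 / real (c (Suc k)))" by simp
  moreover have "1 / real (c (Suc k)) > 0" using c_pos by simp
  ultimately show False
    using endpoint_close[of m "Suc k"] endpoint_close[of m' "Suc k"] unfolding eq by linarith
qed

end

lemma uncountable_UNIV_nat_bool: "uncountable (UNIV :: (nat \<Rightarrow> bool) set)"
proof
  assume "countable (UNIV :: (nat \<Rightarrow> bool) set)"
  then have "range (from_nat_into (UNIV :: (nat \<Rightarrow> bool) set)) = UNIV"
    by (intro range_from_nat_into) auto
  then obtain n where "(\<lambda>k. \<not> from_nat_into UNIV k k) = from_nat_into (UNIV :: (nat \<Rightarrow> bool) set) n"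
    by (metis (mono_tags, lifting) UNIV_I imageE)
  then show False by metis
qed

lemma fast_growth_of_summable:
  assumes b: "erdos_taylor b"
    and s: "summable (\<lambda>n. (real (b (Suc n)) / real (b (Suc (Suc n))))\<^sup>2)"
  obtains n a where "n \<ge> 1" "fast_growth (\<lambda>k. b (n + k)) a"
proof -
  obtain a where a: "\<And>n. n \<ge> 1 \<Longrightarrow> a n \<ge> 1" and rec: "\<And>n. n \<ge> 1 \<Longrightarrow> b (Suc n) = a n * b n + 1"
    using erdos_taylorE[OF b] by metis
  have ge: "b n \<ge> n" if "n \<ge> 1" for n
    using that
  proof (induction n rule: dec_induct)
    case (step n)
    have "1 * b n \<le> a n * b n" using a[of n] step.hyps by (intro mult_right_mono) auto
    then show ?case using rec[of n] step by linarith
  qed (use erdos_taylor_pos[OF b] in simp)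
  have "eventually (\<lambda>n. (real (b (Suc n)) / real (b (Suc (Suc n))))\<^sup>2 < (1/8)\<^sup>2) sequentially"
    by (rule order_tendstoD(2)[OF summable_LIMSEQ_zero[OF s]]) simp
  then obtain N where N: "\<And>n. n \<ge> N \<Longrightarrow> (real (b (Suc n)) / real (b (Suc (Suc n))))\<^sup>2 < (1/8)\<^sup>2"
    unfolding eventually_sequentially by blast
  have gr: "8 * b n \<le> b (Suc n)" if n: "n \<ge> Suc N" for n
  proof -
    obtain l where l: "n = Suc l" "l \<ge> N" using n by (cases n) auto
    have "real (b n) / real (b (Suc n)) < 1 / 8"
      using N[OF l(2)] unfolding l(1)[symmetric] by (rule power_less_imp_less_base) simp
    moreover have "real (b (Suc n)) > 0" using ge[of "Suc n"] by simp
    ultimately have "8 * real (b n) < real (b (Suc n))" by (simp add: divide_less_eq)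
    then show ?thesis by linarith
  qed
  show ?thesis
  proof (rule that)
    \<comment> \<open>Beyond \<open>N\<close> the ratios are at least 8, and b_n \<ge> n supplies a
      first term of at least 8.\<close>
    show "fast_growth (\<lambda>k. b (N + 8 + k)) (\<lambda>k. a (N + 8 + k))"
    proof
      show "b (N + 8 + Suc k) = a (N + 8 + k) * b (N + 8 + k) + 1" for k
        using rec[of "N + 8 + k"] by simp
      show "8 * b (N + 8 + k) \<le> b (N + 8 + Suc k)" for k
        using gr[of "N + 8 + k"] by simp
      show "8 \<le> b (N + 8 + 0)" using ge[of "N + 8"] by simp
    qed
  qed simp
qed

lemma summable_imp_uncountable_G2:
  assumes b: "erdos_taylor b"
    and s: "summable (\<lambda>n. (real (b (Suc n)) / real (b (Suc (Suc n))))\<^sup>2)"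
  shows "uncountable (G2 b)"
proof -
  obtain n a where n: "n \<ge> 1" and fg: "fast_growth (\<lambda>k. b (n + k)) a"
    by (rule fast_growth_of_summable[OF b s])
  interpret fast_growth "\<lambda>k. b (n + k)" a by (rule fg)
  obtain l where l: "n = Suc l" using n by (cases n) auto
  have "abs_circle (endpoint m) \<in> G2 b" for m
  proof -
    have "summable (\<lambda>k. (\<lambda>n. (real (b (Suc n)) / real (b (Suc (Suc n))))\<^sup>2) (k + l))"
      using s by (subst summable_iff_shift)
    then have s': "summable (\<lambda>k. 4 * (real (b (n + k)) / real (b (n + Suc k)))\<^sup>2)"
      unfolding l by (intro summable_mult) (simp add: add.commute)
    have "(dist_int (real (b (n + k)) * endpoint m))\<^sup>2 \<le> 4 * (real (b (n + k)) / real (b (n + Suc k)))\<^sup>2" for k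
      using power_mono[OF dist_int_endpoint[of k m] dist_int_nonneg, of 2] 
      by (simp add: power_mult_distrib power_divide)
    then have "summable (\<lambda>k. (dist_int (real (b (n + k)) * endpoint m))\<^sup>2)"
      by (intro summable_comparison_test'[OF s']) auto
    then have "summable (\<lambda>k. (\<lambda>n. (dist_int (real (b (Suc n)) * endpoint m))\<^sup>2) (k + l))"
      unfolding l by (simp add: add.commute)
    then show ?thesis unfolding abs_circle_in_G2_iff by (subst (asm) summable_iff_shift)
  qed
  then have sub: "range (\<lambda>m. abs_circle (endpoint m)) \<subseteq> G2 b" by blast
  have "inj (\<lambda>m. abs_circle (endpoint m))"
  proof (rule injI)
    fix m m' assume "abs_circle (endpoint m) = abs_circle (endpoint m')"
    then obtain z :: int where z: "endpoint m - endpoint m' = of_int z"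
      unfolding abs_circle_eq_iff by (auto elim: Ints_cases)
    have "\<bar>of_int z :: real\<bar> < 1"
      unfolding z[symmetric] using endpoint_bounds[of m] endpoint_bounds[of m'] by linarith
    then have "z = 0" by linarith
    then show "m = m'" using z inj_endpoint by (auto dest: injD)
  qed
  then show ?thesis
    using sub uncountable_UNIV_nat_bool countable_subset countable_image_inj_on by blast
qed

section \<open>The martingale and its Fourier coefficients\<close>

lemma one_minus_cos_le: "1 - cos (2 * pi * y) \<le> 2 * pi\<^sup>2 * y\<^sup>2"
proof -
  have "1 - cos (2 * pi * y) = 2 * (sin (pi * y))\<^sup>2"
    using cos_double_sin[of "pi * y"] by (simp add: mult.assoc)
  also have "(sin (pi * y))\<^sup>2 \<le> (pi * y)\<^sup>2"
    using abs_sin_x_le_abs_x[of "pi * y"] by (simp add: abs_le_square_iff)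
  finally show ?thesis by (simp add: power_mult_distrib)
qed

text \<open>The Dirichlet kernel: multiplied by 2 sin (pi z), the sum telescopes. What matters later
  is that the bound depends neither on \<open>N\<close> nor on the shift \<open>m\<close>.\<close>

lemma abs_sum_cos_le:
  assumes "sin (pi * z) > 0"
  shows "\<bar>\<Sum>n<N. cos (2 * pi * (of_int (int n + m) * z))\<bar> \<le> 1 / sin (pi * z)"
proof -
  define s where "s = sin (pi * z)"
  define w where "w = (\<lambda>n. sin (pi * z * (2 * real n + 2 * of_int m - 1)))"
  have "2 * s * (\<Sum>n<N. cos (2 * pi * (of_int (int n + m) * z))) = w N - w 0"
  proof (induction N)
    case (Suc N)
    have "2 * s * cos (2 * pi * (of_int (int N + m) * z)) = w (Suc N) - w N"
    proof -
      define u where "u = 2 * pi * (of_int (int N + m) * z)"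
      have "w (Suc N) = sin (u + pi * z)" "w N = sin (u - pi * z)"
        by (simp_all add: w_def u_def algebra_simps)
      then show ?thesis unfolding u_def[symmetric] s_def by (simp add: sin_add sin_diff)
    qed
    then show ?case using Suc by (simp add: distrib_left)
  qed simp
  moreover have "\<bar>w n\<bar> \<le> 1" for n by (simp add: w_def)
  ultimately have *: "\<bar>2 * s * (\<Sum>n<N. cos (2 * pi * (of_int (int n + m) * z)))\<bar> \<le> 2"
  proof -
    assume a: "2 * s * (\<Sum>n<N. cos (2 * pi * (of_int (int n + m) * z))) = w N - w 0"
      and b: "\<And>n. \<bar>w n\<bar> \<le> 1"
    show "\<bar>2 * s * (\<Sum>n<N. cos (2 * pi * (of_int (int n + m) * z)))\<bar> \<le> 2" unfolding a using abs_triangle_ineq4[of "w N" "w 0"] b[of N] b[of 0] by linarith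
  qed
  then have "2 * s * \<bar>\<Sum>n<N. cos (2 * pi * (of_int (int n + m) * z))\<bar> \<le> 2"
    using assms by (simp add: abs_mult s_def)
  then show ?thesis using assms by (simp add: s_def pos_le_divide_eq mult.commute)
qed

context fast_growth begin

text \<open>\<open>EE L k t g\<close> is the expectation of \<open>g\<close> at the end of the \<open>L\<close>-step martingale that starts
  at \<open>t\<close> at time \<open>k\<close> and moves up with probability equal to its current value.\<close>

primrec EE :: "nat \<Rightarrow> nat \<Rightarrow> real \<Rightarrow> (real \<Rightarrow> real) \<Rightarrow> real" where
  "EE 0 k t g = g t"
| "EE (Suc L) k t g = t * EE L (Suc k) (up k t) g + (1 - t) * EE L (Suc k) (dn k t) g"

lemma EE_const: "EE L k t (\<lambda>_. v) = v"
  by (induction L arbitrary: k t) (auto simp: algebra_simps)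

lemma EE_add: "EE L k t (\<lambda>x. f x + g x) = EE L k t f + EE L k t g"
  by (induction L arbitrary: k t) (auto simp: algebra_simps)

lemma EE_mult: "EE L k t (\<lambda>x. v * f x) = v * EE L k t f"
  by (induction L arbitrary: k t) (auto simp: algebra_simps)

lemma EE_mult_right: "EE L k t (\<lambda>x. f x * v) = EE L k t f * v"
  using EE_mult[of L k t v f] by (simp add: mult.commute)

lemma EE_diff: "EE L k t (\<lambda>x. f x - g x) = EE L k t f - EE L k t g"
  using EE_add[of L k t f "\<lambda>x. (-1) * g x"] EE_mult[of L k t "-1" g] by simp

lemma EE_sum: "EE L k t (\<lambda>x. \<Sum>i\<in>I. f i x) = (\<Sum>i\<in>I. EE L k t (f i))"
  by (induction I rule: infinite_finite_induct) (auto simp: EE_add EE_const)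

text \<open>The two functions are compared only on the ball that a walk from t can reach, so bounds
  valid near the walk suffice.\<close>

lemma EE_mono:
  assumes "safe k t" "\<And>x. \<bar>x - t\<bar> \<le> 1 / (7 * real (c k)) \<Longrightarrow> f x \<le> g x"
  shows "EE L k t f \<le> EE L k t g"
  using assms
proof (induction L arbitrary: k t)
  case (Suc L)
  have t: "0 \<le> t" "t \<le> 1" using safe_bounds_self[OF Suc.prems(1)] by auto
  have "EE L (Suc k) s f \<le> EE L (Suc k) s g" 
    if "safe (Suc k) s" "\<bar>s - t\<bar> \<le> 1 / real (c (Suc k))" for s
    using that Suc.prems(2) step_radius[of s t k] by (intro Suc.IH) auto
  then show ?case using t safe_step[OF Suc.prems(1)] up_dn_close[OF t, of k]
    by (auto intro!: add_mono mult_left_mono)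
qed simp

lemma EE_abs_le:
  assumes "safe k t" "\<And>x. \<bar>x - t\<bar> \<le> 1 / (7 * real (c k)) \<Longrightarrow> \<bar>f x\<bar> \<le> B"
  shows "\<bar>EE L k t f\<bar> \<le> B"
proof -
  have "EE L k t f \<le> EE L k t (\<lambda>_. B)" "EE L k t (\<lambda>_. - B) \<le> EE L k t f"
    using assms by (auto intro!: EE_mono simp: abs_le_iff minus_le_iff)
  then show ?thesis by (simp add: EE_const abs_le_iff minus_le_iff)
qed

text \<open>The increments of the martingale are orthogonal, which is where the squares of
  \<open>c\<^sub>j / c\<^sub>j\<^sub>+\<^sub>1\<close> come from. The translate \<open>\<beta>\<close> absorbs the integers \<open>c\<^sub>k t\<close>.\<close>

lemma EE_one_minus_cos_le:
  assumes "safe k t" "finite F" "\<And>j. j \<in> F \<Longrightarrow> j < k + L"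
  shows "EE L k t (\<lambda>x. 1 - cos (2 * pi * (real (\<Sum>j\<in>F. c j) * x - \<beta>)))
    \<le> 2 * pi\<^sup>2 * ((real (\<Sum>j\<in>{j\<in>F. j < k}. c j) * t - \<beta>)\<^sup>2
        + (\<Sum>j=k..<k+L. (real (\<Sum>i\<in>{i\<in>F. i \<le> j}. c i) / real (c (Suc j)))\<^sup>2) / 4)"
  using assms
proof (induction L arbitrary: k t \<beta>)
  case 0
  then have "{j\<in>F. j < k} = F" by auto
  then show ?case using one_minus_cos_le[of "real (\<Sum>j\<in>F. c j) * t - \<beta>"] by (simp add: mult.assoc)
next
  case (Suc L)
  define C where "C = real (\<Sum>i\<in>{i\<in>F. i \<le> k}. c i)"
  define B where "B = real (\<Sum>j\<in>F. c j)"
  define R where "R = (\<Sum>j=Suc k..<Suc k+L. (real (\<Sum>i\<in>{i\<in>F. i \<le> j}. c i) / real (c (Suc j)))\<^sup>2)"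
  define q where "q = real (c (Suc k))"
  have q: "q > 0" using c_pos by (simp add: q_def)
  \<comment> \<open>The contribution of the index k at time k is the integer c_k t. Moving it into
    the translate leaves the cosine unchanged, and only indices below k remain in the mean.\<close>
  define z where "z = (if k \<in> F then real (c k) * t else 0)"
  define \<beta>' where "\<beta>' = \<beta> + z"
  have t: "0 \<le> t" "t \<le> 1" using safe_bounds_self[OF Suc.prems(1)] by auto
  have "z \<in> \<int>" using Suc.prems(1) by (auto simp: z_def safe_def)
  then obtain n where n: "z = of_int n" by (auto elim: Ints_cases)
  have cos_eq: "cos (2 * pi * (y - \<beta>')) = cos (2 * pi * (y - \<beta>))" for y
  proof -
    have "2 * pi * (y - \<beta>') = 2 * pi * (y - \<beta>) - 2 * pi * of_int n"
      by (simp add: \<beta>'_def n algebra_simps)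
    then show ?thesis by (simp add: cos_diff)
  qed
  have split: "{i\<in>F. i \<le> k} = (if k \<in> F then insert k {j\<in>F. j < k} else {j\<in>F. j < k})"
    by (auto simp: order_le_less)
  have C_eq: "C * t - \<beta>' = real (\<Sum>j\<in>{j\<in>F. j < k}. c j) * t - \<beta>"
    using Suc.prems(2) unfolding C_def split \<beta>'_def z_def by (auto simp: algebra_simps)
  have S: "{j \<in> F. j < Suc k} = {i\<in>F. i \<le> k}" by auto
  have step: "EE L (Suc k) s (\<lambda>x. 1 - cos (2 * pi * (B * x - \<beta>)))
      \<le> 2 * pi\<^sup>2 * ((C * s - \<beta>')\<^sup>2 + R / 4)" if "safe (Suc k) s" for s
    using Suc.IH[OF that Suc.prems(2), of \<beta>'] Suc.prems(3) 
    unfolding cos_eq B_def[symmetric] S C_def[symmetric] R_def by simp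
  have "EE (Suc L) k t (\<lambda>x. 1 - cos (2 * pi * (B * x - \<beta>)))
      \<le> t * (2 * pi\<^sup>2 * ((C * up k t - \<beta>')\<^sup>2 + R / 4)) + (1 - t) * (2 * pi\<^sup>2 * ((C * dn k t - \<beta>')\<^sup>2 + R / 4))"
    using t by (auto intro!: add_mono mult_left_mono step safe_step Suc.prems(1))
  also have "\<dots> = 2 * pi\<^sup>2 * (t * (C * up k t - \<beta>')\<^sup>2 + (1 - t) * (C * dn k t - \<beta>')\<^sup>2 + R / 4)"
  proof -
    have "t * (P * (X + Z)) + (1 - t) * (P * (Y + Z)) = P * (t * X + (1 - t) * Y + Z)" for P X Y Z :: real
      by (simp add: algebra_simps)
    then show ?thesis .
  qed
  \<comment> \<open>Mean square after one step equals squared mean plus variance. The cross term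
    vanishes because the step has mean 0, and its variance t (1 - t) / q^2 is at most 1 / (4
    q^2).\<close>
  also have "t * (C * up k t - \<beta>')\<^sup>2 + (1 - t) * (C * dn k t - \<beta>')\<^sup>2
      = (C * t - \<beta>')\<^sup>2 + (C / q)\<^sup>2 * (t * (1 - t))"
  proof -
    have "C * up k t - \<beta>' = (C * t - \<beta>') + (C / q) * (1 - t)" "C * dn k t - \<beta>' = (C * t - \<beta>') - (C / q) * t"
      by (simp_all add: up_def dn_def q_def algebra_simps)
    moreover have "t * (A + w * (1 - t))\<^sup>2 + (1 - t) * (A - w * t)\<^sup>2 = A\<^sup>2 + w\<^sup>2 * (t * (1 - t))"
      for A w by (simp add: power2_eq_square algebra_simps)
    ultimately show ?thesis by (simp only:)
  qed
  also have "2 * pi\<^sup>2 * ((C * t - \<beta>')\<^sup>2 + (C / q)\<^sup>2 * (t * (1 - t)) + R / 4)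
      \<le> 2 * pi\<^sup>2 * ((C * t - \<beta>')\<^sup>2 + (C / q)\<^sup>2 * (1 / 4) + R / 4)"
  proof -
    have "t * (1 - t) \<le> 1 / 4" using zero_le_power2[of "t - 1/2"] by (simp add: power2_eq_square algebra_simps)
    then show ?thesis by (intro mult_left_mono add_mono) auto
  qed
  also have "(C * t - \<beta>')\<^sup>2 + (C / q)\<^sup>2 * (1 / 4) + R / 4 = (C * t - \<beta>')\<^sup>2
      + (\<Sum>j=k..<k+Suc L. (real (\<Sum>i\<in>{i\<in>F. i \<le> j}. c i) / real (c (Suc j)))\<^sup>2) / 4"
    unfolding R_def C_def q_def by (simp add: sum.atLeast_Suc_lessThan)
  finally show ?case unfolding C_eq B_def .
qed

lemma sum_c_le: "(\<Sum>i\<le>j. c i) \<le> 2 * c j"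
proof (induction j)
  case (Suc j)
  then show ?case using growth[of j] by simp
qed simp

text \<open>The real part of the n-th Fourier coefficient of the law after L steps, that is, the
  coefficient of the symmetrised law. A real stationary process needs such an even real
  covariance.\<close>

definition corr_at :: "nat \<Rightarrow> int \<Rightarrow> real" where
  "corr_at L n = EE L 0 t0 (\<lambda>x. cos (2 * pi * (of_int n * x)))"

text \<open>For a walk started at time 0 the squared mean in the bound is 0 and only the variances
  remain. Those before time \<open>l\<close> vanish, and at time j the indices up to j contribute at
  most 2 c_j by geometric growth.\<close>

lemma corr_at_rigid:
  assumes F: "finite F" "\<And>j. j \<in> F \<Longrightarrow> l \<le> j" "\<And>j. j \<in> F \<Longrightarrow> j < L"
  shows "1 - corr_at L (int (\<Sum>j\<in>F. c j))
    \<le> 2 * pi\<^sup>2 * (\<Sum>j\<in>{l..<L}. (real (c j) / real (c (Suc j)))\<^sup>2)"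
proof -
  have "1 - corr_at L (int (\<Sum>j\<in>F. c j)) = EE L 0 t0 (\<lambda>x. 1 - cos (2 * pi * (real (\<Sum>j\<in>F. c j) * x - 0)))"
    unfolding corr_at_def EE_diff EE_const by simp
  also have "\<dots> \<le> 2 * pi\<^sup>2 * ((real (\<Sum>j\<in>{j\<in>F. j < 0}. c j) * t0 - 0)\<^sup>2
        + (\<Sum>j=0..<0+L. (real (\<Sum>i\<in>{i\<in>F. i \<le> j}. c i) / real (c (Suc j)))\<^sup>2) / 4)"
    by (rule EE_one_minus_cos_le) (use F safe_t0 in auto)
  also have "\<dots> = 2 * pi\<^sup>2 * ((\<Sum>j=0..<L. (real (\<Sum>i\<in>{i\<in>F. i \<le> j}. c i) / real (c (Suc j)))\<^sup>2) / 4)"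
    by simp
  also have "(\<Sum>j=0..<L. (real (\<Sum>i\<in>{i\<in>F. i \<le> j}. c i) / real (c (Suc j)))\<^sup>2)
      = (\<Sum>j=l..<L. (real (\<Sum>i\<in>{i\<in>F. i \<le> j}. c i) / real (c (Suc j)))\<^sup>2)"
  proof (rule sum.mono_neutral_right)
    show "\<forall>j\<in>{0..<L} - {l..<L}. (real (\<Sum>i\<in>{i\<in>F. i \<le> j}. c i) / real (c (Suc j)))\<^sup>2 = 0"
    proof
      fix j assume "j \<in> {0..<L} - {l..<L}"
      then have "{i\<in>F. i \<le> j} = {}" using F(2) by force
      then show "(real (\<Sum>i\<in>{i\<in>F. i \<le> j}. c i) / real (c (Suc j)))\<^sup>2 = 0" by (simp only: sum.empty) simp
    qed
  qed auto
  also have "2 * pi\<^sup>2 * ((\<Sum>j=l..<L. (real (\<Sum>i\<in>{i\<in>F. i \<le> j}. c i) / real (c (Suc j)))\<^sup>2) / 4)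
      \<le> 2 * pi\<^sup>2 * ((\<Sum>j=l..<L. 4 * (real (c j) / real (c (Suc j)))\<^sup>2) / 4)"
  proof (intro mult_left_mono divide_right_mono sum_mono)
    fix j
    have "(\<Sum>i\<in>{i\<in>F. i \<le> j}. c i) \<le> (\<Sum>i\<le>j. c i)" by (rule sum_mono2) auto
    then have "real (\<Sum>i\<in>{i\<in>F. i \<le> j}. c i) \<le> 2 * real (c j)" using sum_c_le[of j] by linarith
    then have "real (\<Sum>i\<in>{i\<in>F. i \<le> j}. c i) / real (c (Suc j)) \<le> 2 * real (c j) / real (c (Suc j))"
      by (rule divide_right_mono) simp
    then have "(real (\<Sum>i\<in>{i\<in>F. i \<le> j}. c i) / real (c (Suc j)))\<^sup>2 \<le> (2 * real (c j) / real (c (Suc j)))\<^sup>2"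
      by (rule power_mono) (intro divide_nonneg_nonneg of_nat_0_le_iff)
    also have "\<dots> = 4 * (real (c j) / real (c (Suc j)))\<^sup>2" by (simp add: power_mult_distrib power_divide)
    finally show "(real (\<Sum>i\<in>{i\<in>F. i \<le> j}. c i) / real (c (Suc j)))\<^sup>2 \<le> 4 * (real (c j) / real (c (Suc j)))\<^sup>2" .
  qed auto
  finally show ?thesis by (simp add: sum_distrib_left[symmetric])
qed

text \<open>The additional step comes last and moves the walk by at most 1 / c_(k+L+1), which a
  Lipschitz function sees with factor K. The induction removes first steps, since that is how
  \<open>EE\<close> recurses.\<close>

lemma EE_Suc_close:
  assumes "safe k t" "\<And>x y. \<bar>g x - g y\<bar> \<le> K * \<bar>x - y\<bar>" "K \<ge> 0"
  shows "\<bar>EE (Suc L) k t g - EE L k t g\<bar> \<le> K / real (c (Suc (k + L)))"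
  using assms(1)
proof (induction L arbitrary: k t)
  case 0
  have t: "0 \<le> t" "t \<le> 1" using safe_bounds_self[OF 0] by auto
  have g: "\<bar>g s - g t\<bar> \<le> K / real (c (Suc k))" if "\<bar>s - t\<bar> \<le> 1 / real (c (Suc k))" for s
    using order_trans[OF assms(2)[of s t] mult_left_mono[OF that assms(3)]] by simp
  have "EE (Suc 0) k t g - EE 0 k t g = t * (g (up k t) - g t) + (1 - t) * (g (dn k t) - g t)"
    by (simp add: algebra_simps)
  also have "\<bar>\<dots>\<bar> \<le> t * \<bar>g (up k t) - g t\<bar> + (1 - t) * \<bar>g (dn k t) - g t\<bar>"
    using t abs_triangle_ineq[of "t * (g (up k t) - g t)" "(1 - t) * (g (dn k t) - g t)"] by (simp add: abs_mult)
  also have "\<dots> \<le> t * (K / real (c (Suc k))) + (1 - t) * (K / real (c (Suc k)))"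
    using t up_dn_close[OF t, of k] by (intro add_mono mult_left_mono g) auto
  also have "\<dots> = K / real (c (Suc k))" unfolding distrib_right[symmetric] by simp
  finally show ?case by simp
next
  case (Suc L)
  have t: "0 \<le> t" "t \<le> 1" using safe_bounds_self[OF Suc.prems(1)] by auto
  define u where "u = EE (Suc L) (Suc k) (up k t) g - EE L (Suc k) (up k t) g"
  define v where "v = EE (Suc L) (Suc k) (dn k t) g - EE L (Suc k) (dn k t) g"
  define b where "b = K / real (c (Suc (k + Suc L)))"
  have uv: "\<bar>u\<bar> \<le> b" "\<bar>v\<bar> \<le> b"
    using Suc.IH[OF safe_step(1)[OF Suc.prems]] Suc.IH[OF safe_step(2)[OF Suc.prems]]
    unfolding u_def v_def b_def by simp_all
  have "EE (Suc (Suc L)) k t g - EE (Suc L) k t g = t * u + (1 - t) * v"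
    unfolding u_def v_def EE.simps(2)[of "Suc L"] EE.simps(2)[of L k] by (simp add: right_diff_distrib)
  also have "\<bar>\<dots>\<bar> \<le> t * \<bar>u\<bar> + (1 - t) * \<bar>v\<bar>"
    using t abs_triangle_ineq[of "t * u" "(1 - t) * v"] by (simp add: abs_mult)
  also have "\<dots> \<le> t * b + (1 - t) * b"
    using t uv by (intro add_mono mult_left_mono) auto
  also have "\<dots> = b" unfolding distrib_right[symmetric] by simp
  finally show ?case unfolding b_def .
qed

text \<open>The Fourier coefficients of the law of the martingale limit.\<close>

definition corr :: "int \<Rightarrow> real" where "corr n = lim (\<lambda>L. corr_at L n)"

text \<open>The cosine has Lipschitz constant 2 pi |n|, and the steps of the walk shrink
  geometrically, so the successive differences are summable.\<close>

lemma corr_tendsto: "(\<lambda>L. corr_at L n) \<longlonglongrightarrow> corr n"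
proof -
  define g where "g = (\<lambda>x. cos (2 * pi * (of_int n * x)))"
  define K where "K = 2 * pi * \<bar>of_int n\<bar>"
  have g: "\<bar>g x - g y\<bar> \<le> K * \<bar>x - y\<bar>" for x y
  proof -
    define u v where "u = 2 * pi * (of_int n * x)" and "v = 2 * pi * (of_int n * y)"
    have "cos u - cos v = 2 * sin ((u + v) / 2) * sin ((v - u) / 2)" by (rule cos_diff_cos)
    then have "\<bar>cos u - cos v\<bar> = 2 * \<bar>sin ((u + v) / 2)\<bar> * \<bar>sin ((v - u) / 2)\<bar>" by (simp add: abs_mult)
    also have "\<dots> \<le> 2 * 1 * \<bar>(v - u) / 2\<bar>"
      by (intro mult_mono abs_sin_x_le_abs_x) auto
    also have "\<dots> = \<bar>v - u\<bar>" by simp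
    also have "v - u = 2 * pi * of_int n * (y - x)" by (simp add: u_def v_def algebra_simps)
    finally show ?thesis unfolding g_def u_def v_def K_def by (simp add: abs_mult abs_minus_commute)
  qed
  have le: "\<bar>corr_at (Suc L) n - corr_at L n\<bar> \<le> K * (1 / 8) ^ L" for L
  proof -
    have "real (c (Suc L)) \<ge> 8 ^ L"
    proof -
      have "(8::nat) ^ L \<le> 8 ^ Suc (Suc L)" by (rule power_increasing) auto
      then have "8 ^ L \<le> c (Suc L)" using c_ge[of "Suc L"] by linarith
      then show ?thesis by (metis of_nat_le_iff of_nat_numeral of_nat_power)
    qed
    then have "K / real (c (Suc L)) \<le> K / 8 ^ L"
      by (intro divide_left_mono) (auto simp: K_def c_pos)
    moreover have "K / 8 ^ L = K * (1 / 8) ^ L" by (simp add: power_one_over)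
    moreover have "\<bar>corr_at (Suc L) n - corr_at L n\<bar> \<le> K / real (c (Suc (0 + L)))"
      unfolding corr_at_def g_def[symmetric] by (rule EE_Suc_close[OF safe_t0 g]) (simp add: K_def)
    ultimately show ?thesis by simp
  qed
  have "summable (\<lambda>L. K * (1 / 8) ^ L)"
    by (intro summable_mult summable_geometric) simp
  then have "summable (\<lambda>L. corr_at (Suc L) n - corr_at L n)"
    by (rule summable_comparison_test'[where N = 0]) (use le in simp)
  then have "convergent (\<lambda>N. \<Sum>L<N. corr_at (Suc L) n - corr_at L n)"
    by (simp add: summable_iff_convergent)
  then have "convergent (\<lambda>N. corr_at N n - corr_at 0 n)"
    by (simp only: sum_lessThan_telescope[of "\<lambda>L. corr_at L n"])
  then have "convergent (\<lambda>N. corr_at N n)"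
    by (simp only: convergent_diff_const_right_iff)
  then show ?thesis unfolding corr_def by (simp add: convergent_LIMSEQ_iff)
qed

lemma abs_corr_le: "\<bar>corr n\<bar> \<le> 1"
proof (rule tendsto_upperbound[OF tendsto_rabs[OF corr_tendsto]])
  have "\<bar>corr_at L n\<bar> \<le> 1" for L
    unfolding corr_at_def by (rule EE_abs_le[OF safe_t0]) simp
  then show "\<forall>\<^sub>F L in sequentially. \<bar>corr_at L n\<bar> \<le> 1" by simp
qed simp

lemma corr_zero: "corr 0 = 1"
  using LIMSEQ_unique[OF corr_tendsto[of 0], of 1] by (simp add: corr_at_def EE_const)

lemma corr_minus: "corr (- n) = corr n"
  unfolding corr_def corr_at_def by simp

text \<open>Before the limit, the quadratic form is the expectation of the squared modulus of the
  trigonometric sum of u_i exp (2 pi i x), written as the sum of a cosine square and a sine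
  square.\<close>

lemma corr_psd:
  assumes "finite S"
  shows "(\<Sum>i\<in>S. \<Sum>j\<in>S. u i * u j * corr (i - j)) \<ge> 0"
proof -
  have "(\<Sum>i\<in>S. \<Sum>j\<in>S. u i * u j * corr_at L (i - j)) \<ge> 0" for L
  proof -
    have "(\<Sum>i\<in>S. \<Sum>j\<in>S. u i * u j * corr_at L (i - j))
      = EE L 0 t0 (\<lambda>x. \<Sum>i\<in>S. \<Sum>j\<in>S. u i * u j * cos (2 * pi * (of_int (i - j) * x)))"
      by (simp only: EE_sum EE_mult corr_at_def)
    also have "\<dots> = EE L 0 t0 (\<lambda>x. (\<Sum>i\<in>S. u i * cos (2 * pi * (of_int i * x)))\<^sup>2
        + (\<Sum>i\<in>S. u i * sin (2 * pi * (of_int i * x)))\<^sup>2)"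
    proof -
      have "u i * u j * cos (2 * pi * (of_int (i - j) * x)) =
          (u i * cos (2 * pi * (of_int i * x))) * (u j * cos (2 * pi * (of_int j * x))) +
          (u i * sin (2 * pi * (of_int i * x))) * (u j * sin (2 * pi * (of_int j * x)))" for i j x
        using cos_diff[of "2 * pi * (of_int i * x)" "2 * pi * (of_int j * x)"]
        by (simp add: algebra_simps)
      then show ?thesis
        by (simp only: power2_eq_square sum_product sum.distrib)
    qed
    also have "\<dots> \<ge> EE L 0 t0 (\<lambda>_. 0)" by (intro EE_mono safe_t0) simp
    finally show ?thesis by (simp add: EE_const)
  qed
  then show ?thesis
    by (intro tendsto_lowerbound[of "\<lambda>L. \<Sum>i\<in>S. \<Sum>j\<in>S. u i * u j * corr_at L (i - j)" _ sequentially])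
       (auto intro!: tendsto_intros corr_tendsto)
qed

lemma corr_rigid:
  assumes s: "summable (\<lambda>j. (real (c j) / real (c (Suc j)))\<^sup>2)" and "\<epsilon> > 0"
  shows "\<exists>l. \<forall>F. finite F \<and> (\<forall>j\<in>F. l \<le> j) \<longrightarrow> 1 - corr (int (\<Sum>j\<in>F. c j)) < \<epsilon>"
proof -
  \<comment> \<open>With this choice the bound 2 pi^2 times the tail is at most half of the target,
    so the inequality stays strict after the limit in \<open>L\<close>.\<close>
  define \<delta> where "\<delta> = \<epsilon> / (4 * pi\<^sup>2)"
  have d: "\<delta> > 0" using \<open>\<epsilon> > 0\<close> by (simp add: \<delta>_def)
  obtain l where l: "\<And>m n. m \<ge> l \<Longrightarrow> norm (\<Sum>j\<in>{m..<n}. (real (c j) / real (c (Suc j)))\<^sup>2) < \<delta>"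
    using s d unfolding summable_Cauchy by blast
  show ?thesis
  proof (intro exI[of _ l] allI impI)
    fix F assume F: "finite F \<and> (\<forall>j\<in>F. l \<le> j)"
    \<comment> \<open>The finite-step bound requires more steps than every index in F;
      \<open>insert 0\<close> covers an empty F.\<close>
    define N where "N = Suc (Max (insert 0 F))"
    have "1 - \<epsilon> / 2 \<le> corr (int (\<Sum>j\<in>F. c j))"
    proof (rule tendsto_lowerbound[OF corr_tendsto], rule eventually_sequentiallyI)
      fix L assume "L \<ge> N"
      then have FL: "j < L" if "j \<in> F" for j
      proof -
        have "j \<le> Max (insert 0 F)" using F that by (intro Max_ge) auto
        then show ?thesis using \<open>L \<ge> N\<close> by (simp only: N_def)
      qed
      have "1 - corr_at L (int (\<Sum>j\<in>F. c j)) \<le> 2 * pi\<^sup>2 * (\<Sum>j\<in>{l..<L}. (real (c j) / real (c (Suc j)))\<^sup>2)"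
        using F FL by (intro corr_at_rigid) auto
      also have "\<dots> \<le> 2 * pi\<^sup>2 * \<delta>" using l[of l L] by (intro mult_left_mono) auto
      also have "\<dots> = \<epsilon> / 2" by (simp add: \<delta>_def)
      finally show "1 - \<epsilon> / 2 \<le> corr_at L (int (\<Sum>j\<in>F. c j))" by linarith
    qed simp
    then show "1 - corr (int (\<Sum>j\<in>F. c j)) < \<epsilon>" using \<open>\<epsilon> > 0\<close> by linarith
  qed
qed

section \<open>Wiener's criterion: squares of the coefficients have Cesaro limit 0\<close>

definition cos_kernel :: "nat \<Rightarrow> int \<Rightarrow> real \<Rightarrow> real \<Rightarrow> real" where
  "cos_kernel N m x y = (\<Sum>n<N. cos (2 * pi * (of_int (int n + m) * x)) * cos (2 * pi * (of_int (int n + m) * y)))"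

lemma cos_kernel_le: "\<bar>cos_kernel N m x y\<bar> \<le> real N"
proof -
  have "\<bar>cos_kernel N m x y\<bar> \<le> (\<Sum>n<N. 1)"
    unfolding cos_kernel_def by (rule order_trans[OF sum_abs], rule sum_mono) (auto simp: abs_mult intro!: mult_le_one)
  then show ?thesis by simp
qed

lemma cos_kernel_sym: "cos_kernel N m x y = cos_kernel N m y x"
  by (simp add: cos_kernel_def mult.commute)

text \<open>The product of cosines splits into Dirichlet sums at x - y and x + y. The first lies
  between d and 3/10, the second between 1/5 and 4/5, so both keep a definite distance from the
  integers.\<close>

lemma cos_kernel_separated:
  assumes x: "1 / 10 \<le> x" "x \<le> 2 / 5" and y: "1 / 10 \<le> y" "y \<le> 2 / 5"
    and d: "0 < d" "d \<le> x - y"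
  shows "\<bar>cos_kernel N m x y\<bar> \<le> 1 / sin (pi * d) + 1 / sin (pi / 5)"
proof -
  have mono: "sin (pi * a) \<le> sin (pi * b)" if "0 \<le> a" "a \<le> b" "b \<le> 1 / 2" for a b
    using that mult_left_mono[of b "1/2" pi] by (intro sin_monotone_2pi_le) (auto intro: order_trans[of _ 0])
  have pos: "sin (pi * z) > 0" if "0 < z" "z < 1" for z
    using that by (intro sin_gt_zero) auto
  define S where "S = (\<lambda>z. \<Sum>n<N. cos (2 * pi * (of_int (int n + m) * z)))"
  have S: "\<bar>S z\<bar> \<le> 1 / sin (pi * a)" if "0 < a" "a \<le> z" "a \<le> 1 - z" for a z
  proof -
    have "sin (pi * a) \<le> sin (pi * z)"
    proof (cases "z \<le> 1 / 2")
      case True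
      then show ?thesis using that by (intro mono) auto
    next
      case False
      have "sin (pi * a) \<le> sin (pi * (1 - z))" using that False by (intro mono) auto
      also have "pi * (1 - z) = pi - pi * z" by (simp add: algebra_simps)
      finally show ?thesis by simp
    qed
    moreover have "sin (pi * a) > 0" using that by (intro pos) auto
    moreover have "\<bar>S z\<bar> \<le> 1 / sin (pi * z)" unfolding S_def using that by (intro abs_sum_cos_le pos) auto
    moreover from calculation have "1 / sin (pi * z) \<le> 1 / sin (pi * a)" by (intro divide_left_mono) auto
    ultimately show ?thesis by linarith
  qed
  have "cos (2 * pi * (w * x)) * cos (2 * pi * (w * y))
      = (cos (2 * pi * (w * (x - y))) + cos (2 * pi * (w * (x + y)))) / 2" for w
  proof -
    define p q where "p = 2 * pi * (w * x)" and "q = 2 * pi * (w * y)"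
    have "2 * pi * (w * (x - y)) = p - q" "2 * pi * (w * (x + y)) = p + q"
      by (simp_all add: p_def q_def algebra_simps)
    then show ?thesis unfolding p_def[symmetric] q_def[symmetric] by (simp add: cos_diff cos_add)
  qed
  then have "cos_kernel N m x y = (S (x - y) + S (x + y)) / 2"
    unfolding cos_kernel_def S_def sum.distrib[symmetric] sum_divide_distrib
    by (simp only:)
  moreover have "\<bar>S (x - y)\<bar> \<le> 1 / sin (pi * d)" using x y d by (intro S) auto
  moreover have "\<bar>S (x + y)\<bar> \<le> 1 / sin (pi * (1 / 5))" using x y by (intro S) auto
  moreover have "1 / sin (pi * d) \<ge> 0" using x y d by (auto intro!: order_less_imp_le pos)
  moreover have "1 / sin (pi * (1 / 5)) \<ge> 0" using pos[of "1 / 5"] by simp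
  ultimately show ?thesis by (simp add: abs_le_iff)
qed

definition pair_EE :: "nat \<Rightarrow> nat \<Rightarrow> nat \<Rightarrow> int \<Rightarrow> real \<Rightarrow> real \<Rightarrow> real" where
  "pair_EE L k N m s t = EE L k s (\<lambda>x. EE L k t (\<lambda>y. cos_kernel N m x y))"

lemma pair_EE_Suc:
  "pair_EE (Suc L) k N m t t = t * t * pair_EE L (Suc k) N m (up k t) (up k t)
    + (1 - t) * (1 - t) * pair_EE L (Suc k) N m (dn k t) (dn k t)
    + t * (1 - t) * (pair_EE L (Suc k) N m (up k t) (dn k t) + pair_EE L (Suc k) N m (dn k t) (up k t))"
  unfolding pair_EE_def by (simp only: EE.simps EE_add EE_mult) (simp add: algebra_simps)

text \<open>Two independent walks at the same t take the same step with probability t^2 + (1 - t)^2,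
  at most 9/10 on [1/10, 2/5]. Once they part, the kernel is bounded independently of
  \<open>N\<close>. Hence only pairs together for J steps can cost the trivial bound
  \<open>N\<close>; the constant C depends on J and k alone.\<close>

lemma pair_EE_le:
  "\<exists>C\<ge>0. \<forall>L t N m. J \<le> L \<longrightarrow> safe k t \<longrightarrow> \<bar>pair_EE L k N m t t\<bar> \<le> (9 / 10) ^ J * real N + C"
proof (induction J arbitrary: k)
  case 0
  have "\<bar>pair_EE L k N m t t\<bar> \<le> real N" if "safe k t" for L t N m
    unfolding pair_EE_def using that by (intro EE_abs_le cos_kernel_le) auto
  then show ?case by (intro exI[of _ 0]) auto
next
  case (Suc J)
  obtain C where C: "C \<ge> 0" 
    "\<And>L t N m. J \<le> L \<Longrightarrow> safe (Suc k) t \<Longrightarrow> \<bar>pair_EE L (Suc k) N m t t\<bar> \<le> (9 / 10) ^ J * real N + C"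
    using Suc.IH[of "Suc k"] by blast
  \<comment> \<open>The two branches start 1 / c_(k+1) apart, and each may drift by a seventh of
    this towards the other.\<close>
  define d where "d = 5 / 7 * (1 / real (c (Suc k)))"
  define K where "K = 1 / sin (pi * d) + 1 / sin (pi / 5)"
  have d: "d > 0" using c_pos by (simp add: d_def)
  have K: "K \<ge> 0"
  proof -
    have "1 / real (c (Suc k)) \<le> 1" using c_pos[of "Suc k"] by simp
    then have "d < 1" by (simp add: d_def)
    then have "sin (pi * d) > 0" "sin (pi / 5) > 0" using d by (auto intro!: sin_gt_zero)
    then show ?thesis by (simp add: K_def)
  qed
  have "\<bar>pair_EE (Suc L) k N m t t\<bar> \<le> (9 / 10) ^ Suc J * real N + (C + K)"
    if "J \<le> L" "safe k t" for L t N m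
  proof -
    have t: "1 / 10 \<le> t" "t \<le> 2 / 5" using safe_bounds_self[OF that(2)] by auto
    have sep: "\<bar>cos_kernel N m x y\<bar> \<le> K"
      if "\<bar>x - up k t\<bar> \<le> 1 / (7 * real (c (Suc k)))" "\<bar>y - dn k t\<bar> \<le> 1 / (7 * real (c (Suc k)))" for x y
    proof -
      have "1 / (7 * real (c (Suc k))) = 1 / 7 * (1 / real (c (Suc k)))" by simp
      then have "d \<le> x - y" using that up_minus_dn[of k t] unfolding d_def by linarith
      then show ?thesis unfolding K_def
        using d safe_bounds[OF safe_step(1)[OF \<open>safe k t\<close>] that(1)] safe_bounds[OF safe_step(2)[OF \<open>safe k t\<close>] that(2)]
        by (intro cos_kernel_separated)
    qed
    define P where "P = (9 / 10) ^ J * real N + C"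
    define A B D E where "A = pair_EE L (Suc k) N m (up k t) (up k t)"
      and "B = pair_EE L (Suc k) N m (dn k t) (dn k t)"
      and "D = pair_EE L (Suc k) N m (up k t) (dn k t)"
      and "E = pair_EE L (Suc k) N m (dn k t) (up k t)"
    have P0: "P \<ge> 0" using C(1) by (simp add: P_def)
    have AB: "\<bar>A\<bar> \<le> P" "\<bar>B\<bar> \<le> P" unfolding A_def B_def P_def
      using that safe_step by (auto intro!: C(2))
    have "\<bar>D\<bar> \<le> K" unfolding D_def pair_EE_def
      using safe_step[OF \<open>safe k t\<close>] by (intro EE_abs_le sep) auto
    have sep': "\<bar>cos_kernel N m y x\<bar> \<le> K"
      if "\<bar>x - up k t\<bar> \<le> 1 / (7 * real (c (Suc k)))" "\<bar>y - dn k t\<bar> \<le> 1 / (7 * real (c (Suc k)))" for x y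
      using sep[OF that] by (simp add: cos_kernel_sym[of N m y x])
    have "\<bar>E\<bar> \<le> K" unfolding E_def pair_EE_def
      using safe_step[OF \<open>safe k t\<close>] by (intro EE_abs_le sep') auto
    have "\<bar>pair_EE (Suc L) k N m t t\<bar> = \<bar>t * t * A + (1 - t) * (1 - t) * B + t * (1 - t) * (D + E)\<bar>"
      unfolding pair_EE_Suc A_def B_def D_def E_def ..
    also have "\<dots> \<le> \<bar>t * t * A\<bar> + \<bar>(1 - t) * (1 - t) * B\<bar> + \<bar>t * (1 - t) * (D + E)\<bar>" by linarith
    also have "\<dots> = t * t * \<bar>A\<bar> + (1 - t) * (1 - t) * \<bar>B\<bar> + t * (1 - t) * \<bar>D + E\<bar>"
      using t by (simp add: abs_mult)
    also have "\<dots> \<le> t * t * P + (1 - t) * (1 - t) * P + t * (1 - t) * (2 * K)"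
      using t AB \<open>\<bar>D\<bar> \<le> K\<close> \<open>\<bar>E\<bar> \<le> K\<close> by (intro add_mono mult_left_mono) auto
    also have "\<dots> = (t * t + (1 - t) * (1 - t)) * P + (2 * (t * (1 - t))) * K" by (simp add: algebra_simps)
    also have "\<dots> \<le> (9 / 10) * P + 1 * K"
    proof (intro add_mono mult_right_mono P0 K)
      have "(t - 1 / 10) * (9 / 10 - t) \<ge> 0" using t by (intro mult_nonneg_nonneg) auto
      moreover have "(t - 1 / 10) * (9 / 10 - t) = t - t * t - 9 / 100" by (simp add: field_simps)
      moreover have "t * t + (1 - t) * (1 - t) = 1 - 2 * t + 2 * (t * t)" by (simp add: algebra_simps)
      moreover have "s \<le> 9 / 10" if "0 \<le> p" "p = t - w - 9 / 100" "s = 1 - 2 * t + 2 * w" for p s w :: real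
        using that by simp
      ultimately show "t * t + (1 - t) * (1 - t) \<le> 9 / 10" by blast
      show "2 * (t * (1 - t)) \<le> 1" using zero_le_power2[of "t - 1/2"] by (simp add: power2_eq_square algebra_simps)
    qed
    also have "\<dots> \<le> (9 / 10) ^ Suc J * real N + (C + K)" using C(1) by (simp add: P_def algebra_simps)
    finally show ?thesis .
  qed
  then have "\<bar>pair_EE L k N m t t\<bar> \<le> (9 / 10) ^ Suc J * real N + (C + K)"
    if "Suc J \<le> L" "safe k t" for L t N m
    using that by (cases L) auto
  then show ?case using C(1) K by (intro exI[of _ "C + K"]) auto
qed

text \<open>A square of an expectation is a double expectation over independent copies, as in the
  proof of Wiener's lemma.\<close>

lemma sum_corr_at_sq: "(\<Sum>n<N. (corr_at L (int n + m))\<^sup>2) = pair_EE L 0 N m t0 t0"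
  unfolding pair_EE_def cos_kernel_def corr_at_def power2_eq_square EE_sum EE_mult EE_mult_right ..

text \<open>The shift \<open>m\<close> is carried along because the covariance of two linear forms
  involves the coefficients at n plus a difference of their indices.\<close>

lemma corr_cesaro: "(\<lambda>N. (\<Sum>n<N. (corr (int n + m))\<^sup>2) / real N) \<longlonglongrightarrow> 0"
proof (rule LIMSEQ_I)
  fix e :: real assume e: "e > 0"
  obtain J where J: "(9 / 10 :: real) ^ J < e / 2" using real_arch_pow_inv[of "e / 2" "9 / 10"] e by auto
  obtain C where C: "C \<ge> 0" "\<And>L N m. J \<le> L \<Longrightarrow> \<bar>pair_EE L 0 N m t0 t0\<bar> \<le> (9 / 10) ^ J * real N + C"
  proof -
    obtain C where C: "C \<ge> 0" "\<forall>L t N m. J \<le> L \<longrightarrow> safe 0 t \<longrightarrow> \<bar>pair_EE L 0 N m t t\<bar> \<le> (9 / 10) ^ J * real N + C"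
      using pair_EE_le[of J 0] by (elim exE conjE)
    show ?thesis by (rule that[OF C(1)]) (use C(2) safe_t0 in simp)
  qed
  have le: "(\<Sum>n<N. (corr (int n + m))\<^sup>2) \<le> (9 / 10) ^ J * real N + C" for N
  proof (rule tendsto_upperbound)
    show "(\<lambda>L. \<Sum>n<N. (corr_at L (int n + m))\<^sup>2) \<longlonglongrightarrow> (\<Sum>n<N. (corr (int n + m))\<^sup>2)"
      by (intro tendsto_intros corr_tendsto)
    show "\<forall>\<^sub>F L in sequentially. (\<Sum>n<N. (corr_at L (int n + m))\<^sup>2) \<le> (9 / 10) ^ J * real N + C"
      unfolding sum_corr_at_sq using C(2)[of _ N m] by (intro eventually_sequentiallyI[of J]) (auto simp: abs_le_iff)
  qed simp
  obtain N0 :: nat where N0: "real N0 > 2 * C / e" using reals_Archimedean2 by blast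
  show "\<exists>no. \<forall>N\<ge>no. norm ((\<Sum>n<N. (corr (int n + m))\<^sup>2) / real N - 0) < e"
  proof (intro exI[of _ "Suc N0"] allI impI)
    fix N assume "N \<ge> Suc N0"
    then have N: "real N > 0" "real N > 2 * C / e" using N0 by auto
    then have "C < e / 2 * real N" using e by (simp add: field_simps)
    moreover have "(9 / 10) ^ J * real N < e / 2 * real N" using J N by simp
    ultimately have "(\<Sum>n<N. (corr (int n + m))\<^sup>2) < e * real N" using le[of N] by linarith
    then have "(\<Sum>n<N. (corr (int n + m))\<^sup>2) / real N < e" using N by (simp add: divide_less_eq)
    moreover have "(\<Sum>n<N. (corr (int n + m))\<^sup>2) / real N \<ge> 0" by (simp add: sum_nonneg)
    ultimately show "norm ((\<Sum>n<N. (corr (int n + m))\<^sup>2) / real N - 0) < e" by simp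
  qed
qed

end

section \<open>Gaussian processes with prescribed covariance\<close>

definition psd_kernel :: "('i \<Rightarrow> 'i \<Rightarrow> real) \<Rightarrow> bool" where
  "psd_kernel K \<longleftrightarrow> (\<forall>i j. K i j = K j i) \<and>
    (\<forall>S u. finite S \<longrightarrow> 0 \<le> (\<Sum>i\<in>S. \<Sum>j\<in>S. u i * u j * K i j))"

lemma psd_kernelD:
  "psd_kernel K \<Longrightarrow> finite S \<Longrightarrow> 0 \<le> (\<Sum>i\<in>S. \<Sum>j\<in>S. u i * u j * K i j)"
  by (simp add: psd_kernel_def)

lemma psd_kernel_diag: "psd_kernel K \<Longrightarrow> K v v \<ge> 0"
  using psd_kernelD[of K "{v}" "\<lambda>_. 1"] by simp

text \<open>On the coefficients 1 at i and s at v the form is affine in s when K v v = 0. A nonzero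
  slope would make it negative; the chosen s gives the value -1.\<close>

lemma psd_kernel_zero:
  assumes K: "psd_kernel K" and v: "K v v = 0" shows "K i v = 0"
proof (cases "i = v")
  case False
  have ge: "K i i + 2 * s * K i v \<ge> 0" for s
  proof -
    have "0 \<le> (\<Sum>a\<in>{i,v}. \<Sum>b\<in>{i,v}. (if a = v then s else 1) * (if b = v then s else 1) * K a b)"
      by (rule psd_kernelD[OF K]) simp
    also have "\<dots> = K i i + 2 * s * K i v"
      using False v K by (simp add: psd_kernel_def)
    finally show ?thesis .
  qed
  show ?thesis
  proof (rule ccontr)
    assume "K i v \<noteq> 0"
    then show False using ge[of "- (K i i + 1) / (2 * K i v)"] by (simp add: field_simps)
  qed
qed (use v in simp)

text \<open>The Schur complement, with the subtracted rank-one kernel written as a product of two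
  equal factors so that these become the entries of the triangular matrix. If K v v = 0, division by
  zero yields 0 and nothing is subtracted; the column of v then vanishes already.\<close>

lemma psd_kernel_schur:
  assumes K: "psd_kernel K"
  shows "psd_kernel (\<lambda>i j. K i j - (K i v / sqrt (K v v)) * (K j v / sqrt (K v v)))" (is "psd_kernel ?K")
    and "K i v - (K i v / sqrt (K v v)) * (K v v / sqrt (K v v)) = 0"
proof -
  have sym: "K i j = K j i" for i j using K by (simp add: psd_kernel_def)
  show "K i v - (K i v / sqrt (K v v)) * (K v v / sqrt (K v v)) = 0"
    using psd_kernel_diag[OF K, of v] psd_kernel_zero[OF K, of v i]
    by (cases "K v v = 0") (auto simp: real_div_sqrt)
  show "psd_kernel ?K"
  proof (cases "K v v = 0")
    case True
    then show ?thesis using K by simp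
  next
    case False
    define d where "d = K v v"
    have d: "d > 0" using psd_kernel_diag[OF K, of v] False by (simp add: d_def)
    have K': "?K i j = K i j - K i v * K j v / d" for i j
      using d by (simp add: d_def)
    have "0 \<le> (\<Sum>i\<in>S. \<Sum>j\<in>S. u i * u j * (K i j - K i v * K j v / d))" if S: "finite S" for S u
    proof -
      define B where "B = (\<Sum>i\<in>S. u i * K i v)"
      \<comment> \<open>The form at u, lowered by s in coordinate v, is Q(u) - 2 s B + s^2 d. This s
        minimises it, with the value Q(u) - B^2 / d. As v may or may not belong to S,
        \<open>u'\<close> is built from two case distinctions.\<close>
      define s where "s = B / d"
      define u' where "u' = (\<lambda>i. (if i \<in> S then u i else 0) - (if i = v then s else 0))"
      have lin: "(\<Sum>i\<in>insert v S. u' i * f i) = (\<Sum>i\<in>S. u i * f i) - s * f v" for f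
      proof -
        have "(\<Sum>i\<in>insert v S. u' i * f i) = (\<Sum>i\<in>insert v S. if i \<in> S then u i * f i else 0)
            - (\<Sum>i\<in>insert v S. if i = v then s * f i else 0)"
          unfolding u'_def sum_subtractf[symmetric] by (intro sum.cong) (auto simp: algebra_simps)
        also have "(\<Sum>i\<in>insert v S. if i \<in> S then u i * f i else 0) = (\<Sum>i\<in>S. u i * f i)"
          using S by (intro sum.mono_neutral_cong_right) auto
        also have "(\<Sum>i\<in>insert v S. if i = v then s * f i else 0) = s * f v" using S by simp
        finally show ?thesis .
      qed
      have "0 \<le> (\<Sum>i\<in>insert v S. \<Sum>j\<in>insert v S. u' i * u' j * K i j)"
        by (rule psd_kernelD[OF K]) (use S in simp)
      also have "\<dots> = (\<Sum>i\<in>insert v S. u' i * (\<Sum>j\<in>insert v S. u' j * K i j))"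
        unfolding sum_distrib_left by (simp only: mult.assoc)
      also have "\<dots> = (\<Sum>i\<in>S. u i * ((\<Sum>j\<in>S. u j * K i j) - s * K i v)) - s * ((\<Sum>j\<in>S. u j * K v j) - s * d)"
        unfolding lin d_def by simp
      also have "\<dots> = (\<Sum>i\<in>S. u i * (\<Sum>j\<in>S. u j * K i j)) - s * B - s * (B - s * d)"
        unfolding right_diff_distrib[of "u _"] sum_subtractf
        by (simp add: B_def sum_distrib_left sym[of v] algebra_simps)
      also have "\<dots> = (\<Sum>i\<in>S. u i * (\<Sum>j\<in>S. u j * K i j)) - B * B / d"
        using d by (simp add: s_def)
      also have "(\<Sum>i\<in>S. u i * (\<Sum>j\<in>S. u j * K i j)) = (\<Sum>i\<in>S. \<Sum>j\<in>S. u i * u j * K i j)"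
        unfolding sum_distrib_left by (simp only: mult.assoc)
      also have "B * B / d = (\<Sum>i\<in>S. \<Sum>j\<in>S. u i * u j * (K i v * K j v / d))"
        unfolding B_def sum_product sum_divide_distrib by (intro sum.cong refl) (simp add: algebra_simps)
      finally show ?thesis by (simp add: sum_subtractf right_diff_distrib)
    qed
    then show ?thesis unfolding psd_kernel_def K' using sym by (auto simp: mult.commute)
  qed
qed

text \<open>Schur complements are taken at 0, 1, 2, ... in turn. After n of them all rows below n
  vanish, so the factor is triangular: every entry of K is a finite sum, and no convergence question
  arises.\<close>

lemma psd_kernel_cholesky:
  fixes K :: "nat \<Rightarrow> nat \<Rightarrow> real"
  assumes K: "psd_kernel K"
  obtains c :: "nat \<Rightarrow> nat \<Rightarrow> real" where
    "\<And>i n. i < n \<Longrightarrow> c n i = 0" "\<And>i j N. i < N \<Longrightarrow> K i j = (\<Sum>n<N. c n i * c n j)"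
proof -
  define KK where "KK = rec_nat K (\<lambda>n L i j. L i j - (L i n / sqrt (L n n)) * (L j n / sqrt (L n n)))"
  define c where "c = (\<lambda>n i. KK n i n / sqrt (KK n n n))"
  have KK0: "KK 0 = K" by (simp add: KK_def)
  have KKS: "KK (Suc n) i j = KK n i j - c n i * c n j" for n i j by (simp add: KK_def c_def)
  have KKS': "KK (Suc n) = (\<lambda>i j. KK n i j - (KK n i n / sqrt (KK n n n)) * (KK n j n / sqrt (KK n n n)))" for n
    by (simp add: KK_def)
  have psd: "psd_kernel (KK n)" for n
    by (induction n) (simp_all only: KK0 K KKS' psd_kernel_schur(1))
  have sym: "KK n i j = KK n j i" for n i j using psd[of n] by (simp add: psd_kernel_def)
  have van: "i < n \<Longrightarrow> KK n i j = 0" for n i j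
  proof (induction n arbitrary: j)
    case (Suc n)
    show ?case
    proof (cases "i = n")
      case True
      have "KK (Suc n) j n = 0" unfolding KKS' by (rule psd_kernel_schur(2)[OF psd])
      then show ?thesis using True sym[of "Suc n" n j] by simp
    next
      case False
      then have "i < n" using Suc.prems by simp
      then show ?thesis unfolding KKS c_def by (simp add: Suc.IH)
    qed
  qed simp
  have expand: "K i j = (\<Sum>n<N. c n i * c n j) + KK N i j" for N i j
    by (induction N) (auto simp: KK0 KKS)
  show ?thesis
  proof (rule that[of c])
    show "c n i = 0" if "i < n" for i n using van[OF that] by (simp add: c_def)
    show "K i j = (\<Sum>n<N. c n i * c n j)" if "i < N" for i j N using expand[of i j N] van[OF that] by simp
  qed
qed

section \<open>The Gaussian measure as a linear image of independent normal variables\<close>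

abbreviation gauss_seq :: "(nat \<Rightarrow> real) measure" where
  "gauss_seq \<equiv> PiM UNIV (\<lambda>_. std_normal_distribution)"

lemma prob_space_std_normal: "prob_space std_normal_distribution"
  by (rule prob_space_normal_density) simp

lemma prob_space_gauss_seq: "prob_space gauss_seq"
  by (intro prob_space_PiM prob_space_std_normal)

lemma gauss_seq_coordinate_measurable [measurable]: "(\<lambda>x. x k) \<in> borel_measurable gauss_seq"
proof -
  have "(\<lambda>x. x k) \<in> measurable gauss_seq std_normal_distribution" by (rule measurable_component_singleton) simp
  then show ?thesis by simp
qed

lemma gauss_seq_char:
  "(CLINT x|gauss_seq. iexp (\<Sum>k<N. d k * x k)) = complex_of_real (exp (- (\<Sum>k<N. (d k)\<^sup>2) / 2))"
proof -
  interpret prob_space gauss_seq by (rule prob_space_gauss_seq)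
  have comp: "distr gauss_seq borel (\<lambda>x. x k) = std_normal_distribution" for k
  proof -
    have "distr gauss_seq borel (\<lambda>x. x k) = distr gauss_seq std_normal_distribution (\<lambda>x. x k)"
      by (rule distr_cong) auto
    also have "\<dots> = std_normal_distribution"
      by (rule distr_PiM_component) (auto intro: prob_space_std_normal)
    finally show ?thesis .
  qed
  have ind: "indep_vars (\<lambda>_. borel) (\<lambda>k x. x k) (UNIV :: nat set)"
  proof (subst indep_vars_iff_distr_eq_PiM)
    have "distr gauss_seq (PiM UNIV (\<lambda>_. borel)) (\<lambda>x. \<lambda>i\<in>UNIV. x i) = distr gauss_seq gauss_seq (\<lambda>x. x)"
      by (rule distr_cong) (auto intro!: sets_PiM_cong)
    also have "\<dots> = gauss_seq" by (simp add: distr_id2)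
    also have "\<dots> = PiM UNIV (\<lambda>i. distr gauss_seq borel (\<lambda>x. x i))" by (simp add: comp)
    finally show "distr gauss_seq (PiM UNIV (\<lambda>_. borel)) (\<lambda>x. \<lambda>i\<in>UNIV. x i) = PiM UNIV (\<lambda>i. distr gauss_seq borel (\<lambda>x. x i))" .
  qed auto
  have ind': "indep_vars (\<lambda>_. borel) (\<lambda>k x. d k * x k) {..<N}"
    by (rule indep_vars_compose2[where Y = "\<lambda>k y. d k * y", OF indep_vars_subset[OF ind]]) auto
  have one: "char (distr gauss_seq borel (\<lambda>x. d k * x k)) 1 = complex_of_real (exp (- (d k)\<^sup>2 / 2))" for k
  proof -
    have "char (distr gauss_seq borel (\<lambda>x. d k * x k)) 1 = (CLINT x|gauss_seq. iexp (d k * x k))"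
      unfolding char_def by (subst integral_distr) auto
    also have "\<dots> = (CLINT y|distr gauss_seq borel (\<lambda>x. x k). iexp (d k * y))"
      by (subst integral_distr) auto
    also have "\<dots> = char std_normal_distribution (d k)" unfolding comp char_def ..
    finally show ?thesis by (simp add: char_std_normal_distribution)
  qed
  have "(CLINT x|gauss_seq. iexp (\<Sum>k<N. d k * x k)) = char (distr gauss_seq borel (\<lambda>x. \<Sum>k<N. d k * x k)) 1"
    unfolding char_def by (subst integral_distr) auto
  also have "\<dots> = (\<Prod>k<N. complex_of_real (exp (- (d k)\<^sup>2 / 2)))"
    unfolding char_distr_sum[OF ind'] one ..
  also have "\<dots> = complex_of_real (exp (\<Sum>k<N. - (d k)\<^sup>2 / 2))"
    unfolding exp_sum[OF finite_lessThan] of_real_prod ..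
  also have "(\<Sum>k<N. - (d k)\<^sup>2 / 2) = - (\<Sum>k<N. (d k)\<^sup>2) / 2"
    by (simp add: sum_negf sum_divide_distrib)
  finally show ?thesis .
qed

text \<open>A list of pairs \<open>(u, n)\<close> stands for the linear form \<open>\<Sum> u x\<^sub>n\<close>; repeated indices are
  allowed, so that appending lists adds forms.\<close>

definition lform :: "(real \<times> int) list \<Rightarrow> (int \<Rightarrow> real) \<Rightarrow> real" where
  "lform l x = (\<Sum>p\<leftarrow>l. fst p * x (snd p))"

definition cov_form :: "(int \<Rightarrow> real) \<Rightarrow> (real \<times> int) list \<Rightarrow> (real \<times> int) list \<Rightarrow> real" where
  "cov_form r l l' = (\<Sum>p\<leftarrow>l. \<Sum>q\<leftarrow>l'. fst p * fst q * r (snd p - snd q))"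

lemma lform_simps [simp]:
  "lform [] x = 0" "lform (p # l) x = fst p * x (snd p) + lform l x" "lform (l @ l') x = lform l x + lform l' x"
  by (auto simp: lform_def)

lemma lform_measurable [measurable]: "lform l \<in> borel_measurable (borel :: (int \<Rightarrow> real) measure)"
  unfolding lform_def by (induction l) auto

text \<open>The triangular factor is applied to an i.i.d. normal sequence, with the integers
  enumerated by \<open>int_encode\<close>. Each coordinate uses finitely many variables, so every
  linear form reduces to \<open>gauss_seq_char\<close>.\<close>

lemma gaussian_process_exists:
  fixes r :: "int \<Rightarrow> real"
  assumes r: "psd_kernel (\<lambda>i j. r (i - j))"
  shows "\<exists>\<mu>. prob_space \<mu> \<and> sets \<mu> = sets borel \<and>
    (\<forall>l. (CLINT x|\<mu>. iexp (lform l x)) = complex_of_real (exp (- cov_form r l l / 2)))"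
proof -
  define K where "K = (\<lambda>i j. r (int_decode i - int_decode j))"
  have "psd_kernel K"
    unfolding psd_kernel_def
  proof (intro conjI allI impI)
    show "K i j = K j i" for i j using r by (simp add: psd_kernel_def K_def)
    fix S :: "nat set" and u :: "nat \<Rightarrow> real" assume S: "finite S"
    have "0 \<le> (\<Sum>i\<in>int_decode ` S. \<Sum>j\<in>int_decode ` S. u (int_encode i) * u (int_encode j) * r (i - j))"
      by (rule psd_kernelD[OF r]) (use S in simp)
    also have "\<dots> = (\<Sum>i\<in>S. \<Sum>j\<in>S. u i * u j * K i j)"
      by (simp add: sum.reindex inj_int_decode K_def)
    finally show "0 \<le> (\<Sum>i\<in>S. \<Sum>j\<in>S. u i * u j * K i j)" .
  qed
  then obtain c where c0: "\<And>i n. i < n \<Longrightarrow> c n i = 0"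
    and c: "\<And>i j N. i < N \<Longrightarrow> K i j = (\<Sum>n<N. c n i * c n j)"
    by (rule psd_kernel_cholesky) blast
  define X where "X = (\<lambda>x (n::int). \<Sum>k<Suc (int_encode n). c k (int_encode n) * (x k :: real))"
  have X_meas [measurable]: "X \<in> borel_measurable gauss_seq"
    unfolding X_def by (rule measurable_coordinatewise_then_product) measurable
  have X_eq: "X x n = (\<Sum>k<N. c k (int_encode n) * x k)" if "int_encode n < N" for x n N
    unfolding X_def using that by (intro sum.mono_neutral_left) (auto simp: c0)
  interpret g: prob_space gauss_seq by (rule prob_space_gauss_seq)
  show ?thesis
  proof (intro exI[of _ "distr gauss_seq borel X"] conjI allI)
    show "prob_space (distr gauss_seq borel X)" by (rule g.prob_space_distr) simp
    show "sets (distr gauss_seq borel X) = sets borel" by simp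
    fix l :: "(real \<times> int) list"
    \<comment> \<open>The sum of all codes that occur in \<open>l\<close> is a crude bound for each
      of them.\<close>
    define N where "N = Suc (\<Sum>p\<leftarrow>l. int_encode (snd p))"
    define d where "d = (\<lambda>k. \<Sum>p\<leftarrow>l. fst p * c k (int_encode (snd p)))"
    have N: "int_encode (snd p) < N" if "p \<in> set l" for p
      using member_le_sum_list[of "int_encode (snd p)" "map (\<lambda>p. int_encode (snd p)) l"] that
      by (auto simp: N_def)
    have lin: "lform l (X x) = (\<Sum>k<N. d k * x k)" for x
    proof -
      have "lform l (X x) = (\<Sum>p\<leftarrow>l. \<Sum>k<N. fst p * c k (int_encode (snd p)) * x k)"
        unfolding lform_def by (intro arg_cong[where f = sum_list] map_cong refl)
          (simp add: X_eq[OF N] sum_distrib_left mult.assoc)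
      also have "\<dots> = (\<Sum>k<N. \<Sum>p\<leftarrow>l. fst p * c k (int_encode (snd p)) * x k)"
        by (induction l) (auto simp: sum.distrib)
      finally show ?thesis by (simp add: d_def sum_list_mult_const)
    qed
    have cov: "cov_form r l l = (\<Sum>k<N. (d k)\<^sup>2)"
    proof -
      have "cov_form r l l = (\<Sum>p\<leftarrow>l. \<Sum>q\<leftarrow>l. \<Sum>k<N. (fst p * c k (int_encode (snd p))) * (fst q * c k (int_encode (snd q))))"
        unfolding cov_form_def
      proof (intro arg_cong[where f = sum_list] map_cong refl)
        fix p q :: "real \<times> int" assume "p \<in> set l"
        have "r (snd p - snd q) = K (int_encode (snd p)) (int_encode (snd q))" by (simp add: K_def)
        also have "\<dots> = (\<Sum>k<N. c k (int_encode (snd p)) * c k (int_encode (snd q)))"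
          by (rule c[OF N[OF \<open>p \<in> set l\<close>]])
        finally show "fst p * fst q * r (snd p - snd q)
          = (\<Sum>k<N. (fst p * c k (int_encode (snd p))) * (fst q * c k (int_encode (snd q))))"
          by (simp add: sum_distrib_left algebra_simps)
      qed
      also have "\<dots> = (\<Sum>k<N. \<Sum>p\<leftarrow>l. \<Sum>q\<leftarrow>l. (fst p * c k (int_encode (snd p))) * (fst q * c k (int_encode (snd q))))"
      proof -
        have swap: "(\<Sum>p\<leftarrow>xs. \<Sum>k<N. h p k) = (\<Sum>k<N. \<Sum>p\<leftarrow>xs. h p k)" for xs :: "(real \<times> int) list" and h :: "_ \<Rightarrow> nat \<Rightarrow> real"
          by (induction xs) (auto simp: sum.distrib)
        show ?thesis unfolding swap ..
      qed
      also have "\<dots> = (\<Sum>k<N. (d k)\<^sup>2)"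
        by (simp only: sum_list_const_mult sum_list_mult_const d_def power2_eq_square)
      finally show ?thesis .
    qed
    have "(CLINT x|distr gauss_seq borel X. iexp (lform l x)) = (CLINT x|gauss_seq. iexp (lform l (X x)))"
      by (rule integral_distr) auto
    then show "(CLINT x|distr gauss_seq borel X. iexp (lform l x)) = complex_of_real (exp (- cov_form r l l / 2))"
      unfolding lin gauss_seq_char cov .
  qed
qed

section \<open>Approximation by trigonometric polynomials\<close>

text \<open>Real coefficients are allowed in the exponents, so the class is closed under products,
  and the integral of each of its members is read off from the characteristic function of the linear
  forms.\<close>

inductive trig :: "((int \<Rightarrow> real) \<Rightarrow> complex) \<Rightarrow> bool" where
  trig_iexp: "trig (\<lambda>x. a * iexp (lform l x))"
| trig_add: "trig p \<Longrightarrow> trig q \<Longrightarrow> trig (\<lambda>x. p x + q x)"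

definition bdd_meas :: "((int \<Rightarrow> real) \<Rightarrow> 'b::real_normed_vector) \<Rightarrow> bool" where
  "bdd_meas f \<longleftrightarrow> f \<in> borel_measurable borel \<and> (\<exists>B. \<forall>x. norm (f x) \<le> B)"

lemma bdd_measI: "f \<in> borel_measurable borel \<Longrightarrow> (\<And>x. norm (f x) \<le> B) \<Longrightarrow> bdd_meas f"
  by (auto simp: bdd_meas_def)

lemma bdd_meas_bound:
  assumes "bdd_meas f" obtains B where "B > 0" "\<And>x. norm (f x) \<le> B"
proof -
  obtain B where B: "\<And>x. norm (f x) \<le> B" using assms by (auto simp: bdd_meas_def)
  show ?thesis
  proof (rule that[of "\<bar>B\<bar> + 1"])
    show "norm (f x) \<le> \<bar>B\<bar> + 1" for x using B[of x] by linarith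
  qed simp
qed

lemma bdd_meas_measurable: "bdd_meas f \<Longrightarrow> f \<in> borel_measurable borel"
  by (simp add: bdd_meas_def)

lemma bdd_meas_integrable:
  fixes f :: "(int \<Rightarrow> real) \<Rightarrow> 'b::{banach, second_countable_topology}"
  assumes "prob_space N" "sets N = sets borel" "bdd_meas f" shows "integrable N f"
proof -
  interpret prob_space N by (rule assms(1))
  obtain B where "\<And>x. norm (f x) \<le> B" using bdd_meas_bound[OF assms(3)] by blast
  then show ?thesis
    using bdd_meas_measurable[OF assms(3)]
    by (intro integrable_const_bound[where B = B]) (simp_all add: measurable_cong_sets[OF assms(2) refl])
qed

lemma bdd_meas_norm: "bdd_meas f \<Longrightarrow> bdd_meas (\<lambda>x. norm (f x))"
  unfolding bdd_meas_def by (auto intro: borel_measurable_norm)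

lemma bdd_meas_const: "bdd_meas (\<lambda>_. a)"
  by (rule bdd_measI[of _ "norm a"]) simp_all

lemma bdd_meas_add:
  fixes f g :: "(int \<Rightarrow> real) \<Rightarrow> 'b::{real_normed_vector, second_countable_topology}"
  assumes "bdd_meas f" "bdd_meas g" shows "bdd_meas (\<lambda>x. f x + g x)"
proof -
  obtain B C where "\<And>x. norm (f x) \<le> B" "\<And>x. norm (g x) \<le> C"
    using bdd_meas_bound[OF assms(1)] bdd_meas_bound[OF assms(2)] by metis
  then show ?thesis using assms[THEN bdd_meas_measurable]
    by (intro bdd_measI[of _ "B + C"]) (simp_all add: norm_triangle_mono)
qed

lemma bdd_meas_mult:
  fixes f g :: "(int \<Rightarrow> real) \<Rightarrow> 'b::{real_normed_field, second_countable_topology}"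
  assumes "bdd_meas f" "bdd_meas g" shows "bdd_meas (\<lambda>x. f x * g x)"
proof -
  obtain B C where "B > 0" "\<And>x. norm (f x) \<le> B" "\<And>x. norm (g x) \<le> C"
    using bdd_meas_bound[OF assms(1)] bdd_meas_bound[OF assms(2)] by metis
  then show ?thesis using assms[THEN bdd_meas_measurable]
    by (intro bdd_measI[of _ "B * C"]) (simp_all add: norm_mult mult_mono less_imp_le)
qed

lemma bdd_meas_diff:
  fixes f g :: "(int \<Rightarrow> real) \<Rightarrow> 'b::{real_normed_field, second_countable_topology}"
  assumes "bdd_meas f" "bdd_meas g" shows "bdd_meas (\<lambda>x. f x - g x)"
  using bdd_meas_add[OF assms(1) bdd_meas_mult[OF bdd_meas_const[of "-1"] assms(2)]] by simp

lemma bdd_meas_indicator: "A \<in> sets borel \<Longrightarrow> bdd_meas (indicator A :: _ \<Rightarrow> 'b::real_normed_field)"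
  by (rule bdd_measI[of _ 1]) (auto simp: indicator_def)

lemmas bdd_intros = bdd_meas_norm bdd_meas_const bdd_meas_add bdd_meas_mult bdd_meas_diff bdd_meas_indicator

lemma trig_bdd_meas: "trig p \<Longrightarrow> bdd_meas p"
proof (induction rule: trig.induct)
  case (trig_iexp a l)
  show ?case by (rule bdd_measI[of _ "norm a"]) (simp_all add: norm_mult)
qed (rule bdd_meas_add)

lemma trig_const: "trig (\<lambda>_. a)"
  using trig_iexp[of a "[]"] by simp

lemma trig_mult: "trig p \<Longrightarrow> trig q \<Longrightarrow> trig (\<lambda>x. p x * q x)"
proof (induction arbitrary: q rule: trig.induct)
  case (trig_iexp a l)
  from trig_iexp show ?case
  proof (induction rule: trig.induct)
    case (trig_iexp b l')
    then show ?case using trig.trig_iexp[of "a * b" "l @ l'"] by (simp add: exp_add distrib_left mult_ac)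
  next
    case (trig_add p q)
    then show ?case using trig.trig_add[of "\<lambda>x. a * iexp (lform l x) * p x"] by (simp add: distrib_left)
  qed
next
  case (trig_add p p')
  then show ?case using trig.trig_add[of "\<lambda>x. p x * q x" "\<lambda>x. p' x * q x"] by (simp add: distrib_right)
qed

text \<open>Stationarity compares a measure with its translate, and one polynomial has to be good
  for both; hence approximation is simultaneous for a finite set of measures.\<close>

locale prob_family =
  fixes \<N> :: "(int \<Rightarrow> real) measure set"
  assumes fin: "finite \<N>"
    and prob: "\<And>N. N \<in> \<N> \<Longrightarrow> prob_space N" and sets_eq: "\<And>N. N \<in> \<N> \<Longrightarrow> sets N = sets borel"
begin

definition trig_approx :: "((int \<Rightarrow> real) \<Rightarrow> complex) \<Rightarrow> bool" where
  "trig_approx f \<longleftrightarrow> bdd_meas f \<and>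
    (\<forall>e>0. \<exists>p. trig p \<and> (\<forall>N\<in>\<N>. (\<integral>x. norm (f x - p x) \<partial>N) < e))"

lemma trig_approx_bdd: "trig_approx f \<Longrightarrow> bdd_meas f"
  by (simp add: trig_approx_def)

lemma trig_approxE:
  assumes "trig_approx f" "e > 0"
  obtains p where "trig p" "\<And>N. N \<in> \<N> \<Longrightarrow> (\<integral>x. norm (f x - p x) \<partial>N) < e"
  using assms unfolding trig_approx_def by blast

lemma trig_approx_trig: "trig p \<Longrightarrow> trig_approx p"
  unfolding trig_approx_def by (auto simp: trig_bdd_meas intro!: exI[of _ p])

lemma integral_norm_scale_le:
  fixes f g :: "(int \<Rightarrow> real) \<Rightarrow> complex"
  assumes N: "N \<in> \<N>" and fg: "bdd_meas f" "bdd_meas g" and le: "\<And>x. norm (f x) \<le> C * norm (g x)"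
  shows "(\<integral>x. norm (f x) \<partial>N) \<le> C * (\<integral>x. norm (g x) \<partial>N)"
proof -
  note int = bdd_meas_integrable[OF prob[OF N] sets_eq[OF N]]
  have "(\<integral>x. norm (f x) \<partial>N) \<le> (\<integral>x. C * norm (g x) \<partial>N)"
    by (intro integral_mono int bdd_intros fg le)
  then show ?thesis by simp
qed

lemma trig_approxI:
  assumes f: "bdd_meas f"
    and app: "\<And>e. e > 0 \<Longrightarrow> \<exists>g. trig_approx g \<and> (\<forall>N\<in>\<N>. (\<integral>x. norm (f x - g x) \<partial>N) < e)"
  shows "trig_approx f"
  unfolding trig_approx_def
proof (intro conjI allI impI f)
  fix e :: real assume "e > 0"
  then obtain g where g: "trig_approx g" "\<forall>N\<in>\<N>. (\<integral>x. norm (f x - g x) \<partial>N) < e / 2"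
    using app[of "e / 2"] by auto
  obtain p where p: "trig p" "\<And>N. N \<in> \<N> \<Longrightarrow> (\<integral>x. norm (g x - p x) \<partial>N) < e / 2"
    using trig_approxE[OF g(1) half_gt_zero[OF \<open>e > 0\<close>]] by blast
  note bd = f trig_approx_bdd[OF g(1)] trig_bdd_meas[OF p(1)]
  have "(\<integral>x. norm (f x - p x) \<partial>N) < e" if N: "N \<in> \<N>" for N
  proof -
    note int = bdd_meas_integrable[OF prob[OF N] sets_eq[OF N]]
    have "(\<integral>x. norm (f x - p x) \<partial>N) \<le> (\<integral>x. norm (f x - g x) + norm (g x - p x) \<partial>N)"
    proof (intro integral_mono int bdd_intros bd)
      show "norm (f x - p x) \<le> norm (f x - g x) + norm (g x - p x)" for x
        using norm_triangle_ineq[of "f x - g x" "g x - p x"] by simp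
    qed
    also have "\<dots> = (\<integral>x. norm (f x - g x) \<partial>N) + (\<integral>x. norm (g x - p x) \<partial>N)"
      by (intro Bochner_Integration.integral_add int bdd_intros bd)
    also have "\<dots> < e / 2 + e / 2" using g(2) p(2) N by (intro add_strict_mono) auto
    finally show ?thesis by simp
  qed
  then show "\<exists>p. trig p \<and> (\<forall>N\<in>\<N>. (\<integral>x. norm (f x - p x) \<partial>N) < e)" using p(1) by blast
qed

text \<open>Dominated convergence for each measure, and finiteness of the family gives one n for all
  of them.\<close>

lemma trig_approx_limit:
  assumes g: "\<And>n. trig_approx (g n)" and B: "\<And>n x. norm (g n x) \<le> B"
    and lim: "\<And>x. (\<lambda>n. g n x) \<longlonglongrightarrow> f x"
  shows "trig_approx f"
proof -
  have gm [measurable]: "g n \<in> borel_measurable borel" for n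
    by (rule bdd_meas_measurable[OF trig_approx_bdd[OF g]])
  have fm [measurable]: "f \<in> borel_measurable borel"
    by (rule borel_measurable_LIMSEQ_metric[OF _ lim]) (rule gm)
  have fB: "norm (f x) \<le> B" for x
    by (rule tendsto_upperbound[OF tendsto_norm[OF lim]]) (auto simp: B)
  have bd: "norm (norm (f x - g n x)) \<le> 2 * B" for n x
    using norm_triangle_ineq4[of "f x" "g n x"] B[of n x] fB[of x] by simp
  have lim0: "(\<lambda>n. norm (f x - g n x)) \<longlonglongrightarrow> 0" for x
    using tendsto_norm[OF tendsto_diff[OF tendsto_const lim, of "f x" x]] by simp
  have lims: "(\<lambda>n. \<integral>x. norm (f x - g n x) \<partial>N) \<longlonglongrightarrow> 0" if N: "N \<in> \<N>" for N
  proof -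
    interpret prob_space N by (rule prob[OF N])
    have [measurable_cong]: "sets N = sets borel" by (rule sets_eq[OF N])
    have "(\<lambda>n. \<integral>x. norm (f x - g n x) \<partial>N) \<longlonglongrightarrow> (\<integral>x. 0 \<partial>N)"
      by (rule integral_dominated_convergence[where w = "\<lambda>_. 2 * B"]) (use bd lim0 in auto)
    then show ?thesis by simp
  qed
  show ?thesis
  proof (rule trig_approxI)
    show "bdd_meas f" by (rule bdd_measI[OF fm fB])
    fix e :: real assume "e > 0"
    then have "eventually (\<lambda>n. \<forall>N\<in>\<N>. (\<integral>x. norm (f x - g n x) \<partial>N) < e) sequentially"
      using lims by (intro eventually_ball_finite fin ballI order_tendstoD(2))
    then obtain n where "\<forall>N\<in>\<N>. (\<integral>x. norm (f x - g n x) \<partial>N) < e"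
      by (auto simp: eventually_sequentially)
    then show "\<exists>g. trig_approx g \<and> (\<forall>N\<in>\<N>. (\<integral>x. norm (f x - g x) \<partial>N) < e)" using g by blast
  qed
qed

text \<open>The bound on an approximating polynomial may grow with its precision, so the factors are
  replaced one after the other: f by p first, then g with a precision adapted to the bound of this
  p.\<close>

lemma trig_approx_mult:
  assumes f: "trig_approx f" and g: "trig_approx g"
  shows "trig_approx (\<lambda>x. f x * g x)"
proof -
  note bf = trig_approx_bdd[OF f] and bg = trig_approx_bdd[OF g]
  have small: "(\<integral>x. norm (u x) \<partial>N) < e"
    if N: "N \<in> \<N>" and uv: "bdd_meas u" "bdd_meas v" and "C > 0"
      and le: "\<And>x. norm (u x) \<le> C * norm (v x)" and v: "(\<integral>x. norm (v x) \<partial>N) < e / C"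
    for N and u v :: "(int \<Rightarrow> real) \<Rightarrow> complex" and C e
    using integral_norm_scale_le[OF N uv le] v \<open>C > 0\<close> by (simp add: field_simps)
  have trig: "trig_approx (\<lambda>x. p x * g x)" if p: "trig p" for p
  proof (rule trig_approxI)
    note bp = trig_bdd_meas[OF p]
    show "bdd_meas (\<lambda>x. p x * g x)" by (rule bdd_meas_mult[OF bp bg])
    fix e :: real assume "e > 0"
    obtain D where D: "D > 0" "\<And>x. norm (p x) \<le> D" by (rule bdd_meas_bound[OF bp]) blast
    then have "e / D > 0" using \<open>e > 0\<close> by simp
    then obtain q where q: "trig q" "\<And>N. N \<in> \<N> \<Longrightarrow> (\<integral>x. norm (g x - q x) \<partial>N) < e / D"
      using trig_approxE[OF g] by blast
    have "(\<integral>x. norm (p x * g x - p x * q x) \<partial>N) < e" if "N \<in> \<N>" for N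
    proof (rule small[OF that _ _ D(1) _ q(2)[OF that]])
      show "norm (p x * g x - p x * q x) \<le> D * norm (g x - q x)" for x
        unfolding right_diff_distrib[symmetric] norm_mult by (intro mult_right_mono D(2)) simp
    qed (intro bdd_intros bp bg trig_bdd_meas[OF q(1)])+
    then show "\<exists>h. trig_approx h \<and> (\<forall>N\<in>\<N>. (\<integral>x. norm (p x * g x - h x) \<partial>N) < e)"
      using trig_approx_trig[OF trig_mult[OF p q(1)]] by blast
  qed
  show ?thesis
  proof (rule trig_approxI)
    show "bdd_meas (\<lambda>x. f x * g x)" by (rule bdd_meas_mult[OF bf bg])
    fix e :: real assume "e > 0"
    obtain C where C: "C > 0" "\<And>x. norm (g x) \<le> C" by (rule bdd_meas_bound[OF bg]) blast
    then have "e / C > 0" using \<open>e > 0\<close> by simp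
    then obtain p where p: "trig p" "\<And>N. N \<in> \<N> \<Longrightarrow> (\<integral>x. norm (f x - p x) \<partial>N) < e / C"
      using trig_approxE[OF f] by blast
    have "(\<integral>x. norm (f x * g x - p x * g x) \<partial>N) < e" if "N \<in> \<N>" for N
    proof (rule small[OF that _ _ C(1) _ p(2)[OF that]])
      show "norm (f x * g x - p x * g x) \<le> C * norm (f x - p x)" for x
        unfolding left_diff_distrib[symmetric] norm_mult mult.commute[of _ "norm (g x)"]
        by (intro mult_right_mono C(2)) simp
    qed (intro bdd_intros bf bg trig_bdd_meas[OF p(1)])+
    then show "\<exists>h. trig_approx h \<and> (\<forall>N\<in>\<N>. (\<integral>x. norm (f x * g x - h x) \<partial>N) < e)"
      using trig[OF p(1)] by blast
  qed
qed

lemma trig_approx_add: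
  assumes f: "trig_approx f" and g: "trig_approx g"
  shows "trig_approx (\<lambda>x. f x + g x)"
proof -
  note bf = trig_approx_bdd[OF f] and bg = trig_approx_bdd[OF g]
  have trig: "trig_approx (\<lambda>x. p x + g x)" if p: "trig p" for p
    unfolding trig_approx_def
  proof (intro conjI allI impI bdd_meas_add[OF trig_bdd_meas[OF p] bg])
    fix e :: real assume "e > 0"
    then obtain q where q: "trig q" "\<And>N. N \<in> \<N> \<Longrightarrow> (\<integral>x. norm (g x - q x) \<partial>N) < e"
      using trig_approxE[OF g] by blast
    then show "\<exists>h. trig h \<and> (\<forall>N\<in>\<N>. (\<integral>x. norm (p x + g x - h x) \<partial>N) < e)"
      by (intro exI[of _ "\<lambda>x. p x + q x"] conjI trig_add[OF p q(1)]) simp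
  qed
  show ?thesis
  proof (rule trig_approxI[OF bdd_meas_add[OF bf bg]])
    fix e :: real assume "e > 0"
    then obtain p where p: "trig p" "\<And>N. N \<in> \<N> \<Longrightarrow> (\<integral>x. norm (f x - p x) \<partial>N) < e"
      using trig_approxE[OF f] by blast
    then show "\<exists>h. trig_approx h \<and> (\<forall>N\<in>\<N>. (\<integral>x. norm (f x + g x - h x) \<partial>N) < e)"
      by (intro exI[of _ "\<lambda>x. p x + g x"] conjI trig[OF p(1)]) simp
  qed
qed

lemma trig_approx_const: "trig_approx (\<lambda>_. a)"
  by (rule trig_approx_trig[OF trig_const])

lemma trig_approx_polynomial:
  fixes g :: "real \<Rightarrow> real"
  assumes g: "real_polynomial_function g" and f: "trig_approx (\<lambda>x. complex_of_real (f x))"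
  shows "trig_approx (\<lambda>x. complex_of_real (g (f x)))"
  using g
proof (induction rule: real_polynomial_function.induct)
  case (linear h)
  then obtain c where "h = (\<lambda>x. x * c)" unfolding real_bounded_linear by blast
  then show ?case using trig_approx_mult[OF f trig_approx_const[of "of_real c"]] by simp
next
  case (const c)
  then show ?case by (rule trig_approx_const)
next
  case (add f g)
  then show ?case using trig_approx_add by simp
next
  case (mult f g)
  then show ?case using trig_approx_mult by simp
qed

text \<open>Weierstrass approximation by polynomials on [-1, 1], the range of the sine to which this
  is applied.\<close>

lemma trig_approx_continuous:
  assumes g: "continuous_on {-1..1} g" and f: "trig_approx (\<lambda>x. complex_of_real (f x))"
    and f1: "\<And>x. f x \<in> {-1..1::real}"
  shows "trig_approx (\<lambda>x. complex_of_real (g (f x)))"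
proof -
  have "\<exists>p. real_polynomial_function p \<and> (\<forall>y\<in>{-1..1}. \<bar>g y - p y\<bar> < 1 / real (Suc n))" for n
  proof -
    have "1 / real (Suc n) > 0" by simp
    from Stone_Weierstrass_real_polynomial_function[OF compact_Icc g this]
    obtain p where "real_polynomial_function p" "\<And>y. y \<in> {-1..1} \<Longrightarrow> \<bar>g y - p y\<bar> < 1 / real (Suc n)"
      by blast
    then show ?thesis by (intro exI[of _ p]) simp
  qed
  then have "\<exists>p. \<forall>n. real_polynomial_function (p n) \<and> (\<forall>y\<in>{-1..1}. \<bar>g y - p n y\<bar> < 1 / real (Suc n))"
    by (intro choice allI)
  then obtain p where p: "\<And>n. real_polynomial_function (p n)" "\<And>n y. y \<in> {-1..1} \<Longrightarrow> \<bar>g y - p n y\<bar> < 1 / real (Suc n)"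
    by blast
  have "bounded (g ` {-1..1})"
    using g by (intro compact_imp_bounded compact_continuous_image) auto
  then obtain B where "\<forall>z\<in>g ` {-1..1}. norm z \<le> B" unfolding bounded_iff ..
  then have B: "\<And>y. y \<in> {-1..1} \<Longrightarrow> \<bar>g y\<bar> \<le> B" by auto
  show ?thesis
  proof (rule trig_approx_limit[where B = "B + 1"])
    show "trig_approx (\<lambda>x. complex_of_real (p n (f x)))" for n
      by (rule trig_approx_polynomial[OF p(1) f])
    fix x
    have less: "\<bar>g (f x) - p n (f x)\<bar> < 1 / real (Suc n)" for n using p(2)[OF f1] .
    have "1 / real (Suc n) \<le> 1" for n by simp
    then show "norm (complex_of_real (p n (f x))) \<le> B + 1" for n
    proof -
      have "\<bar>p n (f x)\<bar> \<le> B + 1"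
        using less[of n] B[OF f1[of x]] \<open>\<And>n. 1 / real (Suc n) \<le> 1\<close>[of n] by linarith
      then show ?thesis by simp
    qed
    have "(\<lambda>n. p n (f x)) \<longlonglongrightarrow> g (f x)"
    proof (rule LIM_zero_cancel, rule Lim_null_comparison)
      show "\<forall>\<^sub>F n in sequentially. norm (p n (f x) - g (f x)) \<le> 1 / real (Suc n)"
        using less by (auto simp: abs_minus_commute intro!: always_eventually less_imp_le)
      show "(\<lambda>n. 1 / real (Suc n)) \<longlonglongrightarrow> 0" 
        using LIMSEQ_inverse_real_of_nat by (simp add: inverse_eq_divide)
    qed
    then show "(\<lambda>n. complex_of_real (p n (f x))) \<longlonglongrightarrow> complex_of_real (g (f x))"
      by (rule tendsto_of_real)
  qed
qed

lemma trig_approx_sin: "trig_approx (\<lambda>x. complex_of_real (sin (d * (x n - s))))"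
proof -
  have "complex_of_real (sin (d * (x n - s))) =
      (iexp (- (d * s)) / (2 * \<i>)) * iexp (lform [(d, n)] x) + (- iexp (d * s) / (2 * \<i>)) * iexp (lform [(- d, n)] x)" for x
  proof -
    define z where "z = complex_of_real (d * (x n - s))"
    have "iexp (- (d * s)) * iexp (lform [(d, n)] x) = exp (\<i> * z)"
      "iexp (d * s) * iexp (lform [(- d, n)] x) = exp (- (\<i> * z))"
      unfolding mult_exp_exp z_def by (intro arg_cong[where f = exp]; simp add: algebra_simps)+
    moreover have "complex_of_real (sin (d * (x n - s))) = (exp (\<i> * z) - exp (- (\<i> * z))) / (2 * \<i>)"
      unfolding z_def by (simp only: sin_of_real[symmetric] sin_exp_eq)
    moreover have "(p - q) / (2 * \<i>) = (u / (2 * \<i>)) * v + (- u' / (2 * \<i>)) * v'"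
      if "u * v = p" "u' * v' = q" for p q u v u' v' :: complex
      unfolding that[symmetric] by (simp add: field_simps)
    ultimately show ?thesis by (simp only:)
  qed
  moreover have "trig (\<lambda>x. (iexp (- (d * s)) / (2 * \<i>)) * iexp (lform [(d, n)] x)
      + (- iexp (d * s) / (2 * \<i>)) * iexp (lform [(- d, n)] x))"
    by (intro trig_add trig_iexp)
  ultimately show ?thesis by (simp only: trig_approx_trig)
qed

text \<open>The sign of \<open>sin ((x\<^sub>n - s) / (m + 1))\<close> is that of \<open>x\<^sub>n - s\<close> for large \<open>m\<close>.\<close>

lemma trig_approx_coordinate_greater: "trig_approx (\<lambda>x. indicator {x. s < x n} x)"
proof (rule trig_approx_limit[where B = 1 and g = "\<lambda>m x. if sin ((1 / real (Suc m)) * (x n - s)) > 0 then 1 else 0"])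
  show "trig_approx (\<lambda>x. if sin ((1 / real (Suc m)) * (x n - s)) > 0 then 1 else 0)" for m
  \<comment> \<open>For fixed m the clamps min 1 (max 0 (j y)) are continuous in y and tend to the
    indicator of y > 0 as j grows.\<close>
  proof (rule trig_approx_limit[where B = 1 and 
      g = "\<lambda>j x. complex_of_real (min 1 (max 0 (real j * sin ((1 / real (Suc m)) * (x n - s)))))"])
    show "trig_approx (\<lambda>x. complex_of_real (min 1 (max 0 (real j * sin ((1 / real (Suc m)) * (x n - s))))))" for j
      by (rule trig_approx_continuous[where g = "\<lambda>y. min 1 (max 0 (real j * y))", OF _ trig_approx_sin])
         (auto intro!: continuous_intros)
    fix x :: "int \<Rightarrow> real"
    define y where "y = sin ((1 / real (Suc m)) * (x n - s))"
    have "(\<lambda>j. min 1 (max 0 (real j * y))) \<longlonglongrightarrow> (if y > 0 then 1 else 0)"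
    proof (cases "y > 0")
      case True
      obtain j0 :: nat where "real j0 > 1 / y" using reals_Archimedean2 by blast
      then have "1 / y < real j" if "j \<ge> j0" for j using that by linarith
      then have "1 < real j * y" if "j \<ge> j0" for j
        using that True by (simp add: divide_less_eq)
      then have "min 1 (max 0 (real j * y)) = 1" if "j \<ge> j0" for j
      proof -
        have "1 < real j * y" by (rule \<open>\<And>j. j0 \<le> j \<Longrightarrow> 1 < real j * y\<close>[OF that])
        then show ?thesis by (simp add: min_def max_def)
      qed
      then have "\<forall>\<^sub>F j in sequentially. min 1 (max 0 (real j * y)) = 1"
        by (rule eventually_sequentiallyI)
      then show ?thesis using True by (simp add: tendsto_eventually)
    next
      case False
      then have "real j * y \<le> 0" for j by (intro mult_nonneg_nonpos) auto
      then have "max 0 (real j * y) = 0" for j by (simp only: max_absorb1)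
      then show ?thesis using False by simp
    qed
    then have "(\<lambda>j. complex_of_real (min 1 (max 0 (real j * y)))) \<longlonglongrightarrow> complex_of_real (if y > 0 then 1 else 0)"
      by (rule tendsto_of_real)
    then show "(\<lambda>j. complex_of_real (min 1 (max 0 (real j * sin ((1 / real (Suc m)) * (x n - s))))))
        \<longlonglongrightarrow> (if sin ((1 / real (Suc m)) * (x n - s)) > 0 then 1 else 0)"
      unfolding y_def by (simp split: if_splits)
  qed (auto simp: min_def max_def)
  fix x :: "int \<Rightarrow> real"
  obtain m0 :: nat where m0: "real m0 > \<bar>x n - s\<bar> / pi" using reals_Archimedean2 by blast
  have "(sin ((1 / real (Suc m)) * (x n - s)) > 0) = (s < x n)" if "m \<ge> m0" for m
  proof -
    define y where "y = (1 / real (Suc m)) * (x n - s)"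
    have "\<bar>x n - s\<bar> < pi * real (Suc m)"
    proof -
      have "\<bar>x n - s\<bar> < pi * real m0" using m0 by (simp add: divide_less_eq mult.commute)
      also have "\<dots> \<le> pi * real (Suc m)" using that by (intro mult_left_mono) auto
      finally show ?thesis .
    qed
    then have y: "\<bar>y\<bar> < pi" by (simp add: y_def abs_mult divide_less_eq)
    have sgn: "s < x n \<longleftrightarrow> y > 0" by (simp add: y_def zero_less_divide_iff)
    have "sin y > 0 \<longleftrightarrow> y > 0"
    proof (cases "y > 0")
      case True
      then show ?thesis using y by (simp add: sin_gt_zero)
    next
      case False
      then have "sin (- y) \<ge> 0" using y by (intro sin_ge_zero) auto
      then show ?thesis using False by simp
    qed
    then show ?thesis unfolding sgn y_def .
  qed
  then have "\<forall>\<^sub>F m in sequentially. (if sin ((1 / real (Suc m)) * (x n - s)) > 0 then 1 else 0 :: complex)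
      = indicator {x. s < x n} x"
    by (auto simp: eventually_sequentially intro!: exI[of _ m0])
  then show "(\<lambda>m. if sin ((1 / real (Suc m)) * (x n - s)) > 0 then 1 else 0 :: complex) \<longlonglongrightarrow> indicator {x. s < x n} x"
    by (rule tendsto_eventually)
qed auto

lemma trig_approx_indicator:
  assumes "A \<in> sets borel" shows "trig_approx (indicator A)"
proof -
  define \<S> where "\<S> = {A. trig_approx (indicator A)}"
  have compl: "UNIV - A \<in> \<S>" if "A \<in> \<S>" for A
  proof -
    have "indicator (UNIV - A) = (\<lambda>x. 1 + (-1) * indicator A x :: complex)" by (auto simp: indicator_def)
    moreover have "trig_approx (\<lambda>x. 1 + (-1) * indicator A x)"
      using that by (intro trig_approx_add trig_approx_const trig_approx_mult) (simp add: \<S>_def)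
    ultimately show ?thesis by (simp only: \<S>_def mem_Collect_eq)
  qed
  have inter: "A \<inter> B \<in> \<S>" if "A \<in> \<S>" "B \<in> \<S>" for A B
  proof -
    have "indicator (A \<inter> B) = (\<lambda>x. indicator A x * indicator B x :: complex)"
      by (auto simp: indicator_def fun_eq_iff)
    moreover have "trig_approx (\<lambda>x. indicator A x * indicator B x)"
      using that by (intro trig_approx_mult) (simp_all add: \<S>_def)
    ultimately show ?thesis by (simp only: \<S>_def mem_Collect_eq)
  qed
  have un: "A \<union> B \<in> \<S>" if "A \<in> \<S>" "B \<in> \<S>" for A B
    using compl[OF inter[OF compl[OF that(1)] compl[OF that(2)]]] by (simp add: Compl_eq_Diff_UNIV[symmetric])
  have "indicator {} = (\<lambda>_ :: int \<Rightarrow> real. 0 :: complex)" by (auto simp: fun_eq_iff)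
  then have empty: "{} \<in> \<S>" using trig_approx_const[of 0] by (simp add: \<S>_def)
  have UN: "(\<Union>n. F n) \<in> \<S>" if "range F \<subseteq> \<S>" for F :: "nat \<Rightarrow> _"
  proof -
    have Fn: "F n \<in> \<S>" for n using that by blast
    have fin: "(\<Union>i<n. F i) \<in> \<S>" for n
      by (induction n) (simp_all add: lessThan_Suc empty un Fn)
    have "trig_approx (indicator (\<Union>n. F n))"
    proof (rule trig_approx_limit[where B = 1])
      show "trig_approx (indicator (\<Union>i<n. F i))" for n using fin by (simp add: \<S>_def)
      show "(\<lambda>n. indicator (\<Union>i<n. F i) x :: complex) \<longlonglongrightarrow> indicator (\<Union>n. F n) x" for x
        by (rule LIMSEQ_indicator_UN)
    qed (auto simp: indicator_def)
    then show ?thesis by (simp add: \<S>_def)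
  qed
  have sa: "sigma_algebra UNIV \<S>"
    unfolding sigma_algebra_iff2 using empty compl UN by auto
  \<comment> \<open>The approximable sets are a sigma-algebra. Taking it as that of a measure space,
    the identity map into the Borel product space is measurable as soon as all coordinates are, so
    every Borel set is approximable.\<close>
  define N where "N = sigma UNIV \<S>"
  have setsN: "sets N = \<S>" unfolding N_def using sigma_algebra.sigma_sets_eq[OF sa] by simp
  have spN: "space N = UNIV" by (simp add: N_def)
  have "(\<lambda>x. x n) \<in> borel_measurable N" for n
    unfolding borel_measurable_iff_greater using trig_approx_coordinate_greater
    by (simp add: setsN spN \<S>_def)
  then have "(\<lambda>x. x) \<in> borel_measurable N"
    by (rule measurable_coordinatewise_then_product)
  then have "(\<lambda>x. x) -` A \<inter> space N \<in> sets N" using assms by (rule measurable_sets)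
  then show ?thesis by (simp add: spN setsN \<S>_def)
qed

end

section \<open>The Gaussian shift\<close>

definition cesaro_null :: "(nat \<Rightarrow> real) \<Rightarrow> bool" where
  "cesaro_null a \<longleftrightarrow> (\<lambda>N. (\<Sum>n<N. a n) / real N) \<longlonglongrightarrow> 0"

lemma cesaro_null_add: 
  assumes "cesaro_null a" "cesaro_null b" shows "cesaro_null (\<lambda>n. a n + b n)"
  using tendsto_add[OF assms[unfolded cesaro_null_def]]
  by (simp add: cesaro_null_def sum.distrib add_divide_distrib)

lemma cesaro_null_scale: 
  assumes "cesaro_null a" shows "cesaro_null (\<lambda>n. c * a n)"
  using tendsto_mult_right_zero[OF assms[unfolded cesaro_null_def], of c]
  by (simp add: cesaro_null_def sum_distrib_left)

lemma cesaro_null_mono: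
  assumes b: "cesaro_null b" and ab: "\<And>n. 0 \<le> a n" "\<And>n. a n \<le> b n" shows "cesaro_null a"
  unfolding cesaro_null_def
proof (rule tendsto_sandwich[OF _ _ tendsto_const b[unfolded cesaro_null_def]])
  show "\<forall>\<^sub>F N in sequentially. 0 \<le> (\<Sum>n<N. a n) / real N"
    by (intro always_eventually allI divide_nonneg_nonneg sum_nonneg ab) simp
  show "\<forall>\<^sub>F N in sequentially. (\<Sum>n<N. a n) / real N \<le> (\<Sum>n<N. b n) / real N"
    by (intro always_eventually allI divide_right_mono sum_mono ab) simp
qed

lemma cesaro_null_zero: "cesaro_null (\<lambda>_. 0)"
  by (simp add: cesaro_null_def)

lemma cesaro_null_sum_list:
  assumes "\<And>p. p \<in> set l \<Longrightarrow> cesaro_null (f p)" shows "cesaro_null (\<lambda>n. \<Sum>p\<leftarrow>l. f p n)"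
  using assms by (induction l) (simp_all add: cesaro_null_zero cesaro_null_add)

lemma cesaro_null_abs:
  assumes "cesaro_null (\<lambda>n. (a n)\<^sup>2)" shows "cesaro_null (\<lambda>n. \<bar>a n\<bar>)"
  unfolding cesaro_null_def
proof (rule tendsto_sandwich[OF _ _ tendsto_const])
  show "\<forall>\<^sub>F N in sequentially. 0 \<le> (\<Sum>n<N. \<bar>a n\<bar>) / real N"
    by (intro always_eventually allI divide_nonneg_nonneg sum_nonneg) auto
  have "(\<Sum>n<N. \<bar>a n\<bar>) / real N \<le> sqrt ((\<Sum>n<N. (a n)\<^sup>2) / real N)" for N
  proof (rule real_le_rsqrt)
    have "(\<Sum>n<N. \<bar>a n\<bar>)\<^sup>2 \<le> real N * (\<Sum>n<N. (a n)\<^sup>2)"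
      using Cauchy_Schwarz_ineq_sum[of "\<lambda>_. 1" "\<lambda>n. \<bar>a n\<bar>" "{..<N}"] by simp
    then have "(\<Sum>n<N. \<bar>a n\<bar>)\<^sup>2 / (real N)\<^sup>2 \<le> real N * (\<Sum>n<N. (a n)\<^sup>2) / (real N)\<^sup>2"
      by (rule divide_right_mono) simp
    then show "((\<Sum>n<N. \<bar>a n\<bar>) / real N)\<^sup>2 \<le> (\<Sum>n<N. (a n)\<^sup>2) / real N"
      by (cases "N = 0") (simp_all add: power_divide power2_eq_square)
  qed
  then show "\<forall>\<^sub>F N in sequentially. (\<Sum>n<N. \<bar>a n\<bar>) / real N \<le> sqrt ((\<Sum>n<N. (a n)\<^sup>2) / real N)"
    by simp
  show "(\<lambda>N. sqrt ((\<Sum>n<N. (a n)\<^sup>2) / real N)) \<longlonglongrightarrow> 0"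
    using tendsto_real_sqrt[OF assms[unfolded cesaro_null_def]] by simp
qed

lemma cesaro_null_approx:
  assumes "\<And>e. e > 0 \<Longrightarrow> \<exists>b. cesaro_null b \<and> (\<forall>n. a n \<le> b n + e)" and pos: "\<And>n. 0 \<le> a n"
  shows "cesaro_null a"
  unfolding cesaro_null_def
proof (rule LIMSEQ_I)
  fix e :: real assume "e > 0"
  then obtain b where b: "cesaro_null b" "\<And>n. a n \<le> b n + e / 2" using assms(1)[of "e / 2"] by auto
  have "eventually (\<lambda>N. (\<Sum>n<N. b n) / real N < e / 2) sequentially"
    using b(1) \<open>e > 0\<close> unfolding cesaro_null_def by (intro order_tendstoD(2)) auto
  then obtain N0 where N0: "\<And>N. N \<ge> N0 \<Longrightarrow> (\<Sum>n<N. b n) / real N < e / 2"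
    unfolding eventually_sequentially by blast
  show "\<exists>no. \<forall>N\<ge>no. norm ((\<Sum>n<N. a n) / real N - 0) < e"
  proof (intro exI[of _ "Suc N0"] allI impI)
    fix N assume N: "N \<ge> Suc N0"
    have "(\<Sum>n<N. a n) \<le> (\<Sum>n<N. b n + e / 2)" by (intro sum_mono b)
    then have "(\<Sum>n<N. a n) / real N \<le> (\<Sum>n<N. b n + e / 2) / real N" by (rule divide_right_mono) simp
    also have "\<dots> = (\<Sum>n<N. b n) / real N + e / 2" using N by (simp add: sum.distrib add_divide_distrib)
    also have "\<dots> < e" using N0[of N] N by linarith
    finally have "(\<Sum>n<N. a n) / real N < e" .
    moreover have "0 \<le> (\<Sum>n<N. a n) / real N" by (intro divide_nonneg_nonneg sum_nonneg pos) simp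
    ultimately show "norm ((\<Sum>n<N. a n) / real N - 0) < e" by simp
  qed
qed

lemma abs_exp_minus_one_le: "\<bar>exp y - 1\<bar> \<le> \<bar>y\<bar> * exp \<bar>y :: real\<bar>"
proof (cases "y \<ge> 0")
  case True
  have "(1 - y) * exp y \<le> exp (- y) * exp y" using exp_ge_add_one_self[of "- y"] by (intro mult_right_mono) auto
  then have "exp y - 1 \<le> y * exp y" by (simp add: exp_minus algebra_simps)
  then show ?thesis using True by simp
next
  case False
  have "1 - exp y \<le> - y" using exp_ge_add_one_self[of y] by linarith
  also have "\<dots> \<le> \<bar>y\<bar> * exp \<bar>y\<bar>" using False mult_left_mono[of 1 "exp \<bar>y\<bar>" "\<bar>y\<bar>"] by simp
  finally show ?thesis using False by simp
qed

lemma integral_complex_indicator: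
  "(CLINT x|N. indicator A x) = complex_of_real (measure N (A \<inter> space N))"
proof -
  have "(CLINT x|N. indicator A x) = (CLINT x|N. complex_of_real (indicator A x))"
    by (intro Bochner_Integration.integral_cong) (auto simp: indicator_def)
  then show ?thesis by (simp only: integral_complex_of_real Bochner_Integration.integral_indicator)
qed

definition translate :: "int \<Rightarrow> (int \<Rightarrow> real) \<Rightarrow> (int \<Rightarrow> real)" where
  "translate k x = (\<lambda>n. x (n + k))"

lemma translate_translate: "translate j (translate k x) = translate (j + k) x"
  by (simp add: translate_def add.assoc)

lemma translate_0: "translate 0 x = x"
  by (simp add: translate_def)

lemma translate_measurable [measurable]: "translate k \<in> borel_measurable borel"
  unfolding translate_def by (rule measurable_coordinatewise_then_product) measurable

definition lshift :: "int \<Rightarrow> (real \<times> int) list \<Rightarrow> (real \<times> int) list" where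
  "lshift k l = map (\<lambda>p. (fst p, snd p + k)) l"

lemma lform_translate: "lform l (translate k x) = lform (lshift k l) x"
  by (simp add: lform_def lshift_def translate_def comp_def)

lemma cov_form_lshift: "cov_form r (lshift k l) (lshift k l') = cov_form r l l'"
  by (simp add: cov_form_def lshift_def comp_def)

lemma cov_form_append:
  "cov_form r (l1 @ l2) l = cov_form r l1 l + cov_form r l2 l"
  "cov_form r l (l1 @ l2) = cov_form r l l1 + cov_form r l l2"
  by (simp_all add: cov_form_def sum_list_addf)

lemma cov_form_commute:
  assumes "\<And>n. r (- n) = r n" shows "cov_form r l l' = cov_form r l' l"
proof -
  have "(\<Sum>p\<leftarrow>l. \<Sum>q\<leftarrow>l'. h p q) = (\<Sum>q\<leftarrow>l'. \<Sum>p\<leftarrow>l. h p q)" for h :: "real \<times> int \<Rightarrow> real \<times> int \<Rightarrow> real"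
    by (induction l) (simp_all add: sum_list_addf)
  moreover have "r (snd p - snd q) = r (snd q - snd p)" for p q :: "real \<times> int"
    using assms[of "snd p - snd q"] by simp
  ultimately show ?thesis unfolding cov_form_def by (simp add: mult.commute)
qed

text \<open>\<open>char\<close> fixes the law as centred Gaussian with covariance r (i - j),
  \<open>r_0\<close> normalises the variance, and \<open>r_cesaro\<close> is the form in which
  absence of atoms of the spectral measure is used.\<close>

locale gauss_shift =
  fixes \<mu> :: "(int \<Rightarrow> real) measure" and r :: "int \<Rightarrow> real"
  assumes prob: "prob_space \<mu>" and sets_eq [measurable_cong, simp]: "sets \<mu> = sets borel"
    and char: "\<And>l. (CLINT x|\<mu>. iexp (lform l x)) = complex_of_real (exp (- cov_form r l l / 2))"
    and r_minus: "\<And>n. r (- n) = r n" and r_0: "r 0 = 1" and r_le: "\<And>n. \<bar>r n\<bar> \<le> 1"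
    and r_cesaro: "\<And>m. cesaro_null (\<lambda>n. (r (int n + m))\<^sup>2)"
begin

sublocale prob_space \<mu> by (rule prob)

lemma space_eq [simp]: "space \<mu> = UNIV"
  using sets_eq_imp_space_eq[OF sets_eq] by simp

lemma prob_UNIV [simp]: "prob UNIV = 1"
  using prob_space by simp

lemma cov_commute: "cov_form r l l' = cov_form r l' l"
  by (rule cov_form_commute) (rule r_minus)

lemma coordinate_measurable: "(\<lambda>y. y n) \<in> borel_measurable \<mu>"
  unfolding measurable_cong_sets[OF sets_eq refl] by (rule measurable_product_coordinates)

lemma integrable_bdd:
  fixes f :: "(int \<Rightarrow> real) \<Rightarrow> 'b::{banach, second_countable_topology}"
  shows "bdd_meas f \<Longrightarrow> integrable \<mu> f"
  by (rule bdd_meas_integrable[OF prob sets_eq])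

lemma bdd_meas_translate: "bdd_meas f \<Longrightarrow> bdd_meas (\<lambda>x. f (translate k x))"
  unfolding bdd_meas_def by (auto intro: measurable_compose[OF translate_measurable])

lemma trig_translate: "trig p \<Longrightarrow> trig (\<lambda>x. p (translate k x))"
proof (induction rule: trig.induct)
  case (trig_iexp a l)
  show ?case unfolding lform_translate by (rule trig.trig_iexp)
next
  case (trig_add p q)
  then show ?case using trig.trig_add[of "\<lambda>x. p (translate k x)" "\<lambda>x. q (translate k x)"] by simp
qed

lemma trig_integrable: "trig p \<Longrightarrow> integrable \<mu> p"
  by (intro integrable_bdd trig_bdd_meas)

lemma integral_trig_translate: "trig p \<Longrightarrow> (CLINT x|\<mu>. p (translate k x)) = (CLINT x|\<mu>. p x)"
proof (induction rule: trig.induct)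
  case (trig_iexp a l)
  show ?case unfolding lform_translate by (simp add: char cov_form_lshift)
next
  case (trig_add p q)
  then show ?case by (simp add: trig_integrable trig_translate)
qed

lemma norm_integral_indicator_diff:
  assumes A: "A \<in> sets borel" and p: "trig p" and N: "prob_space N" "sets N = sets borel"
    and e: "(\<integral>x. norm (indicator A x - p x) \<partial>N) < e"
  shows "norm (complex_of_real (measure N A) - (CLINT x|N. p x)) < e"
proof -
  interpret N: prob_space N by (rule N)
  have [measurable_cong]: "sets N = sets borel" by (rule N)
  note int = bdd_meas_integrable[OF N]
  have i: "integrable N p" by (intro int trig_bdd_meas p)
  have "A \<inter> space N = A" using sets_eq_imp_space_eq[OF N(2)] by simp
  then have "(CLINT x|N. indicator A x) = complex_of_real (measure N A)"
    by (simp only: integral_complex_indicator)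
  moreover have i': "integrable N (\<lambda>x. indicator A x :: complex)" by (intro int bdd_intros A)
  ultimately have "complex_of_real (measure N A) - (CLINT x|N. p x) = (CLINT x|N. indicator A x - p x)"
    using i by simp
  also have "norm \<dots> \<le> (\<integral>x. norm (indicator A x - p x) \<partial>N)" by (rule integral_norm_bound)
  finally show ?thesis using e by simp
qed

text \<open>The covariance depends on index differences only, so trigonometric polynomials have
  translation-invariant integrals. A polynomial close to an indicator under both measures carries
  this over to sets.\<close>

lemma distr_translate: "distr \<mu> borel (translate k) = \<mu>"
proof -
  define \<nu> where "\<nu> = distr \<mu> borel (translate k)"
  interpret nu: prob_space \<nu> unfolding \<nu>_def by (rule prob_space_distr) simp
  have sets_mu: "sets \<mu> = sets borel" by (rule sets_eq)
  have sets_nu: "sets \<nu> = sets borel" by (simp add: \<nu>_def)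
  interpret prob_family "{\<mu>, \<nu>}"
  proof (rule prob_family.intro)
    show "prob_space N" if "N \<in> {\<mu>, \<nu>}" for N using that prob_space_axioms nu.prob_space_axioms by blast
    show "sets N = sets borel" if "N \<in> {\<mu>, \<nu>}" for N using that sets_eq sets_nu by blast
  qed simp
  have "measure \<nu> A = measure \<mu> A" if A: "A \<in> sets borel" for A
  proof -
    have "norm (complex_of_real (measure \<mu> A - measure \<nu> A)) \<le> 0 + e" if "e > 0" for e
    proof -
      obtain p where p: "trig p" "\<And>N. N \<in> {\<mu>, \<nu>} \<Longrightarrow> (\<integral>x. norm (indicator A x - p x) \<partial>N) < e / 2"
        using trig_approxE[OF trig_approx_indicator[OF A] half_gt_zero[OF \<open>e > 0\<close>]] by blast
      have "(CLINT x|\<nu>. p x) = (CLINT x|\<mu>. p (translate k x))"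
        unfolding \<nu>_def using bdd_meas_measurable[OF trig_bdd_meas[OF p(1)]] by (intro integral_distr) auto
      then have eq: "(CLINT x|\<nu>. p x) = (CLINT x|\<mu>. p x)" using integral_trig_translate[OF p(1)] by simp
      show ?thesis
        using norm_integral_indicator_diff[OF A p(1) prob_space_axioms sets_mu p(2)]
          norm_integral_indicator_diff[OF A p(1) nu.prob_space_axioms sets_nu p(2)] 
          norm_triangle_ineq4[of "complex_of_real (measure \<mu> A) - (CLINT x|\<mu>. p x)" "complex_of_real (measure \<nu> A) - (CLINT x|\<nu>. p x)"]
        unfolding eq by simp
    qed
    then have "norm (complex_of_real (measure \<mu> A - measure \<nu> A)) \<le> 0" by (rule field_le_epsilon)
    then show ?thesis by simp
  qed
  then have "\<nu> = \<mu>"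
    by (intro measure_eqI) (auto simp: \<nu>_def emeasure_eq_measure nu.emeasure_eq_measure[unfolded \<nu>_def])
  then show ?thesis by (simp add: \<nu>_def)
qed

lemma integral_translate:
  fixes f :: "(int \<Rightarrow> real) \<Rightarrow> 'b::{banach, second_countable_topology}"
  assumes "f \<in> borel_measurable borel" shows "(\<integral>x. f (translate k x) \<partial>\<mu>) = (\<integral>x. f x \<partial>\<mu>)"
  by (subst (2) distr_translate[of k, symmetric]) (simp add: integral_distr assms)

lemma indicator_approx:
  assumes "A \<in> sets borel" "e > 0"
  obtains p where "trig p" "(\<integral>x. norm (indicator A x - p x) \<partial>\<mu>) < e"
proof -
  interpret prob_family "{\<mu>}" by (rule prob_family.intro) (simp_all add: prob_space_axioms)
  show ?thesis using trig_approxE[OF trig_approx_indicator[OF assms(1)] assms(2)] that by blast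
qed

section \<open>Weak mixing of the shift\<close>

definition dev :: "((int \<Rightarrow> real) \<Rightarrow> complex) \<Rightarrow> ((int \<Rightarrow> real) \<Rightarrow> complex) \<Rightarrow> nat \<Rightarrow> real" where
  "dev p q n = norm ((CLINT x|\<mu>. p (translate (int n) x) * q x) - (CLINT x|\<mu>. p x) * (CLINT x|\<mu>. q x))"

text \<open>The joint integral is the product of the two integrals times exp (- rho n), with rho n
  the cross covariance of the shifted form and the other one. So the deviation is controlled by |rho
  n|, a finite combination of values |r (n + const)|, each Cesaro null.\<close>

lemma dev_iexp: "cesaro_null (dev (\<lambda>x. a * iexp (lform l x)) (\<lambda>x. b * iexp (lform l' x)))"
proof -
  define \<rho> where "\<rho> = (\<lambda>n. cov_form r (lshift (int n) l) l')"
  define w where "w = (\<lambda>n. \<Sum>p\<leftarrow>l. \<Sum>q\<leftarrow>l'. \<bar>fst p\<bar> * \<bar>fst q\<bar> * \<bar>r (int n + (snd p - snd q))\<bar>)"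
  define R where "R = (\<Sum>p\<leftarrow>l. \<Sum>q\<leftarrow>l'. \<bar>fst p\<bar> * \<bar>fst q\<bar>)"
  define K where "K = norm (a * b) * exp (- (cov_form r l l + cov_form r l' l') / 2)"
  have abs_sum: "\<bar>\<Sum>p\<leftarrow>xs. h p\<bar> \<le> (\<Sum>p\<leftarrow>xs. \<bar>h p\<bar>)" for xs :: "(real \<times> int) list" and h :: "_ \<Rightarrow> real"
    by (induction xs) (auto intro: order_trans[OF abs_triangle_ineq])
  have "\<bar>\<rho> n\<bar> \<le> (\<Sum>p\<leftarrow>l. \<bar>\<Sum>q\<leftarrow>l'. fst p * fst q * r (snd p + int n - snd q)\<bar>)" for n
    unfolding \<rho>_def cov_form_def lshift_def by (simp add: comp_def abs_sum)
  also have "\<dots> n \<le> w n" for n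
    unfolding w_def
    by (intro sum_list_mono order_trans[OF abs_sum]) (simp add: abs_mult algebra_simps)
  finally have rho_w: "\<bar>\<rho> n\<bar> \<le> w n" for n .
  have wR: "w n \<le> R" for n
    unfolding w_def R_def using r_le by (intro sum_list_mono) (simp add: mult_left_le)
  have dev_le: "dev (\<lambda>x. a * iexp (lform l x)) (\<lambda>x. b * iexp (lform l' x)) n \<le> (K * exp R) * w n" for n
  proof -
    have "(CLINT x|\<mu>. a * iexp (lform l (translate (int n) x)) * (b * iexp (lform l' x)))
        = (CLINT x|\<mu>. (a * b) * iexp (lform (lshift (int n) l @ l') x))"
      by (intro Bochner_Integration.integral_cong refl) (simp add: lform_translate exp_add distrib_left)
    also have "\<dots> = a * b * complex_of_real (exp (- (cov_form r l l + cov_form r l' l' + 2 * \<rho> n) / 2))"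
    proof -
      have "cov_form r (lshift (int n) l @ l') (lshift (int n) l @ l')
          = cov_form r l l + cov_form r l' l' + 2 * \<rho> n"
        by (simp add: cov_form_append cov_form_lshift \<rho>_def cov_commute[of l' "lshift (int n) l"])
      then show ?thesis by (simp only: integral_mult_right_zero char)
    qed
    also have "exp (- (cov_form r l l + cov_form r l' l' + 2 * \<rho> n) / 2)
        = exp (- (cov_form r l l + cov_form r l' l') / 2) * exp (- \<rho> n)"
      by (simp add: exp_add[symmetric] field_simps)
    finally have 1: "(CLINT x|\<mu>. a * iexp (lform l (translate (int n) x)) * (b * iexp (lform l' x)))
        = a * b * complex_of_real (exp (- (cov_form r l l + cov_form r l' l') / 2) * exp (- \<rho> n))" .
    have 2: "(CLINT x|\<mu>. a * iexp (lform l x)) * (CLINT x|\<mu>. b * iexp (lform l' x))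
        = a * b * complex_of_real (exp (- (cov_form r l l + cov_form r l' l') / 2))"
    proof -
      have "exp (- (cov_form r l l + cov_form r l' l') / 2) = exp (- cov_form r l l / 2) * exp (- cov_form r l' l' / 2)"
        by (simp add: exp_add[symmetric] field_simps)
      then show ?thesis by (simp add: char)
    qed
    have "dev (\<lambda>x. a * iexp (lform l x)) (\<lambda>x. b * iexp (lform l' x)) n
        = norm (a * b * complex_of_real (exp (- (cov_form r l l + cov_form r l' l') / 2) * (exp (- \<rho> n) - 1)))"
      unfolding dev_def 1 2 by (simp only: right_diff_distrib of_real_diff mult_1_right)
    also have "\<dots> = K * \<bar>exp (- \<rho> n) - 1\<bar>" unfolding K_def norm_mult norm_of_real abs_mult by simp
    also have "\<dots> \<le> K * (\<bar>\<rho> n\<bar> * exp \<bar>\<rho> n\<bar>)"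
      using abs_exp_minus_one_le[of "- \<rho> n"] by (intro mult_left_mono) (auto simp: K_def)
    also have "\<dots> \<le> K * (w n * exp R)"
    proof -
      have "\<bar>\<rho> n\<bar> * exp \<bar>\<rho> n\<bar> \<le> w n * exp R"
        using rho_w[of n] wR[of n] by (intro mult_mono) auto
      then show ?thesis by (intro mult_left_mono) (auto simp: K_def)
    qed
    finally show ?thesis by (simp add: mult_ac)
  qed
  have "cesaro_null w"
    unfolding w_def by (intro cesaro_null_sum_list cesaro_null_scale cesaro_null_abs r_cesaro)
  then show ?thesis
    by (intro cesaro_null_mono[OF _ _ dev_le] cesaro_null_scale) (auto simp: dev_def)
qed

lemma dev_add_left:
  assumes "trig p" "trig p'" "trig q"
  shows "dev (\<lambda>x. p x + p' x) q n \<le> dev p q n + dev p' q n"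
proof -
  have i: "integrable \<mu> (\<lambda>x. p (translate (int n) x) * q x)" "integrable \<mu> (\<lambda>x. p' (translate (int n) x) * q x)"
    using assms by (auto intro!: trig_integrable trig_mult trig_translate)
  have "(CLINT x|\<mu>. (p (translate (int n) x) + p' (translate (int n) x)) * q x) - (CLINT x|\<mu>. p x + p' x) * (CLINT x|\<mu>. q x)
    = ((CLINT x|\<mu>. p (translate (int n) x) * q x) - (CLINT x|\<mu>. p x) * (CLINT x|\<mu>. q x))
    + ((CLINT x|\<mu>. p' (translate (int n) x) * q x) - (CLINT x|\<mu>. p' x) * (CLINT x|\<mu>. q x))"
    using i assms by (simp add: trig_integrable distrib_right)
  then show ?thesis unfolding dev_def by (simp only: norm_triangle_ineq)
qed

lemma dev_add_right:
  assumes "trig p" "trig q" "trig q'"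
  shows "dev p (\<lambda>x. q x + q' x) n \<le> dev p q n + dev p q' n"
proof -
  have i: "integrable \<mu> (\<lambda>x. p (translate (int n) x) * q x)" "integrable \<mu> (\<lambda>x. p (translate (int n) x) * q' x)"
    using assms by (auto intro!: trig_integrable trig_mult trig_translate)
  have "(CLINT x|\<mu>. p (translate (int n) x) * (q x + q' x)) - (CLINT x|\<mu>. p x) * (CLINT x|\<mu>. q x + q' x)
    = ((CLINT x|\<mu>. p (translate (int n) x) * q x) - (CLINT x|\<mu>. p x) * (CLINT x|\<mu>. q x))
    + ((CLINT x|\<mu>. p (translate (int n) x) * q' x) - (CLINT x|\<mu>. p x) * (CLINT x|\<mu>. q' x))"
    using i assms by (simp add: trig_integrable distrib_left)
  then show ?thesis unfolding dev_def by (simp only: norm_triangle_ineq)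
qed

lemma dev_trig:
  assumes "trig p" "trig q" shows "cesaro_null (dev p q)"
  using assms
proof (induction arbitrary: q rule: trig.induct)
  case (trig_iexp a l)
  from trig_iexp show ?case
  proof (induction rule: trig.induct)
    case (trig_iexp b l')
    show ?case by (rule dev_iexp)
  next
    case (trig_add q q')
    show ?case
      by (rule cesaro_null_mono[OF cesaro_null_add[OF trig_add.IH]])
         (use dev_add_right[OF trig.trig_iexp trig_add.hyps] in \<open>auto simp: dev_def[of _ "\<lambda>x. q x + q' x"]\<close>)
  qed
next
  case (trig_add p p')
  show ?case
    by (rule cesaro_null_mono[OF cesaro_null_add[OF trig_add.IH[OF trig_add.prems]]])
       (use dev_add_left[OF trig_add.hyps trig_add.prems] in \<open>auto simp: dev_def[of "\<lambda>x. p x + p' x"]\<close>)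
qed

lemma cesaro_mixing:
  assumes A: "A \<in> sets borel" and B: "B \<in> sets borel"
  shows "cesaro_null (\<lambda>n. \<bar>measure \<mu> (translate (int n) -` A \<inter> B) - measure \<mu> A * measure \<mu> B\<bar>)"
proof (rule cesaro_null_approx)
  fix e :: real assume e: "e > 0"
  obtain p where p: "trig p" "(\<integral>x. norm (indicator A x - p x) \<partial>\<mu>) < e / 4"
    using indicator_approx[OF A, of "e / 4"] e by auto
  note bp = trig_bdd_meas[OF p(1)]
  obtain D where D: "D > 0" "\<And>x. norm (p x) \<le> D" by (rule bdd_meas_bound[OF bp]) blast
  \<comment> \<open>The precision for B is fixed after the bound D of the polynomial for A, since
    the error of \<open>q\<close> is multiplied by \<open>p\<close>.\<close>
  define d where "d = e / (4 * D)"
  have d: "d > 0" "D * d \<le> e / 4"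
    using e D(1) by (simp_all add: d_def field_simps)
  obtain q where q: "trig q" "(\<integral>x. norm (indicator B x - q x) \<partial>\<mu>) < d"
    using indicator_approx[OF B d(1)] by blast
  note bq = trig_bdd_meas[OF q(1)]
  have iA: "norm (indicator A x :: complex) \<le> 1" for A and x :: "int \<Rightarrow> real"
    by (auto simp: indicator_def)
  have "\<bar>measure \<mu> (translate (int n) -` A \<inter> B) - measure \<mu> A * measure \<mu> B\<bar> \<le> dev p q n + e" for n
  proof -
    define f where "f = (\<lambda>x. norm (indicator A (translate (int n) x) - p (translate (int n) x)))"
    define g where "g = (\<lambda>x. norm (indicator B x - q x))"
    have if_: "integrable \<mu> f" and ig: "integrable \<mu> g"
      unfolding f_def g_def
      by (intro integrable_bdd bdd_intros bdd_meas_translate[of "indicator A"] bdd_meas_translate[of p] A B bp bq)+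
    have int_f: "(\<integral>x. f x \<partial>\<mu>) < e / 4"
      unfolding f_def using p(2)
      by (subst integral_translate[of "\<lambda>x. norm (indicator A x - p x)"])
         (auto intro!: bdd_meas_measurable bdd_intros A bp)
    have int_g: "(\<integral>x. g x \<partial>\<mu>) < d" unfolding g_def by (rule q(2))
    define F where "F = (\<lambda>x. indicator A (translate (int n) x) * indicator B x :: complex)"
    define G where "G = (\<lambda>x. p (translate (int n) x) * q x)"
    have iF: "integrable \<mu> F" and iG: "integrable \<mu> G"
      unfolding F_def G_def
      by (intro integrable_bdd bdd_intros bdd_meas_translate[of "indicator A"] bdd_meas_translate[of p] A B bp bq)+
    have FG: "norm (F x - G x) \<le> f x + D * g x" for x
    proof -
      have "F x - G x = (indicator A (translate (int n) x) - p (translate (int n) x)) * indicator B x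
          + p (translate (int n) x) * (indicator B x - q x)" by (simp add: F_def G_def algebra_simps)
      also have "norm \<dots> \<le> f x * norm (indicator B x :: complex) + norm (p (translate (int n) x)) * g x"
        unfolding f_def g_def norm_mult[symmetric] by (rule norm_triangle_ineq)
      also have "\<dots> \<le> f x * 1 + D * g x"
        using D iA[of B x] by (intro add_mono mult_mono) (auto simp: f_def g_def)
      finally show ?thesis by simp
    qed
    have "norm ((CLINT x|\<mu>. F x) - (CLINT x|\<mu>. G x)) = norm (CLINT x|\<mu>. F x - G x)" using iF iG by simp
    also have "\<dots> \<le> (\<integral>x. norm (F x - G x) \<partial>\<mu>)" by (rule integral_norm_bound)
    also have "\<dots> \<le> (\<integral>x. f x + D * g x \<partial>\<mu>)"
      using iF iG if_ ig FG by (intro integral_mono) auto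
    also have "\<dots> = (\<integral>x. f x \<partial>\<mu>) + D * (\<integral>x. g x \<partial>\<mu>)" using if_ ig by simp
    also have "\<dots> \<le> e / 4 + D * d" using int_f int_g D(1) by (intro add_mono mult_left_mono) auto
    finally have FG_int: "norm ((CLINT x|\<mu>. F x) - (CLINT x|\<mu>. G x)) \<le> e / 2" using d(2) by linarith
    have Fm: "(CLINT x|\<mu>. F x) = complex_of_real (measure \<mu> (translate (int n) -` A \<inter> B))"
    proof -
      have "F = indicator (translate (int n) -` A \<inter> B)" by (auto simp: F_def indicator_def fun_eq_iff)
      then show ?thesis using integral_complex_indicator[of \<mu> "translate (int n) -` A \<inter> B"] by simp
    qed
    define u v where "u = complex_of_real (measure \<mu> A)" and "v = complex_of_real (measure \<mu> B)"
    define u' v' where "u' = (CLINT x|\<mu>. p x)" and "v' = (CLINT x|\<mu>. q x)"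
    have uu: "norm (u - u') < e / 4" unfolding u_def u'_def
      by (rule norm_integral_indicator_diff[OF A p(1) prob sets_eq p(2)])
    have vv: "norm (v - v') < d" unfolding v_def v'_def
      by (rule norm_integral_indicator_diff[OF B q(1) prob sets_eq q(2)])
    have u'D: "norm u' \<le> D"
    proof -
      have "norm u' \<le> (\<integral>x. norm (p x) \<partial>\<mu>)" unfolding u'_def by (rule integral_norm_bound)
      also have "\<dots> \<le> (\<integral>x. D \<partial>\<mu>)" using D trig_integrable[OF p(1)] by (intro integral_mono) auto
      finally show ?thesis by (simp add: prob_space)
    qed
    have "norm (u * v - u' * v') \<le> e / 2"
    proof -
      have "u * v - u' * v' = (u - u') * v + u' * (v - v')" by (simp add: algebra_simps)
      also have "norm \<dots> \<le> norm (u - u') * norm v + norm u' * norm (v - v')"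
        unfolding norm_mult[symmetric] by (rule norm_triangle_ineq)
      also have "\<dots> \<le> e / 4 * 1 + D * d"
        using uu vv u'D D(1) e by (intro add_mono mult_mono) (auto simp: v_def)
      finally show ?thesis using d(2) by linarith
    qed
    moreover have "dev p q n = norm ((CLINT x|\<mu>. G x) - u' * v')" by (simp add: dev_def G_def u'_def v'_def)
    moreover have "norm (complex_of_real (measure \<mu> (translate (int n) -` A \<inter> B)) - u * v)
        = \<bar>measure \<mu> (translate (int n) -` A \<inter> B) - measure \<mu> A * measure \<mu> B\<bar>"
      unfolding u_def v_def of_real_mult[symmetric] of_real_diff[symmetric] norm_of_real ..
    moreover have "norm (x - w) \<le> norm (y - z) + (norm (x - y) + norm (w - z))" for x y z w :: complex
      using norm_triangle_ineq4[of "(x - y) + (y - z)" "w - z"] norm_triangle_ineq[of "x - y" "y - z"] by simp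
    note this[of "CLINT x|\<mu>. F x" "u * v" "CLINT x|\<mu>. G x" "u' * v'"]
    ultimately show ?thesis using FG_int unfolding Fm by linarith
  qed
  then show "\<exists>b. cesaro_null b \<and> (\<forall>n. \<bar>measure \<mu> (translate (int n) -` A \<inter> B) - measure \<mu> A * measure \<mu> B\<bar> \<le> b n + e)"
    using dev_trig[OF p(1) q(1)] by blast
qed simp

section \<open>Rigidity of the shift where the covariance is close to 1\<close>

lemma trig_translate_close:
  assumes "trig p" "e > 0"
  shows "\<exists>d>0. \<forall>k. 1 - r k < d \<longrightarrow> (\<integral>x. norm (p (translate k x) - p x) \<partial>\<mu>) < e"
  using assms
proof (induction arbitrary: e rule: trig.induct)
  case (trig_iexp a l)
  \<comment> \<open>A single coordinate moves by 2 - 2 exp (- u^2 (1 - r k)) in mean square, at most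
    2 u^2 (1 - r k). A list multiplies unimodular factors, whose errors add up.\<close>
  have single: "\<exists>d>0. \<forall>k. 1 - r k < d \<longrightarrow> (\<integral>x. norm (iexp (lform l (translate k x)) - iexp (lform l x)) \<partial>\<mu>) < e"
    if "e > 0" for e
    using that
  proof (induction l arbitrary: e)
    case Nil
    then show ?case by (auto intro!: exI[of _ 1])
  next
    case (Cons p l)
    define u n where "u = fst p" and "n = snd p"
    define s where "s = e / 4"
    \<comment> \<open>The summand 1 keeps the denominator positive when u = 0.\<close>
    define d1 where "d1 = s\<^sup>2 / (2 * u\<^sup>2 + 1)"
    have s: "s > 0" using Cons.prems by (simp add: s_def)
    have u1: "2 * u\<^sup>2 + 1 > 0" using zero_le_power2[of u] by linarith
    have d1: "d1 > 0" using s u1 by (simp add: d1_def)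
    obtain d2 where d2: "d2 > 0" 
      "\<And>k. 1 - r k < d2 \<Longrightarrow> (\<integral>x. norm (iexp (lform l (translate k x)) - iexp (lform l x)) \<partial>\<mu>) < e / 2"
      using Cons.IH[of "e / 2"] Cons.prems by auto
    have "(\<integral>x. norm (iexp (lform (p # l) (translate k x)) - iexp (lform (p # l) x)) \<partial>\<mu>) < e"
      if k: "1 - r k < d1" "1 - r k < d2" for k
    proof -
      define f where "f = (\<lambda>x::int\<Rightarrow>real. norm (iexp (u * x (n + k)) - iexp (u * x n)))"
      define g where "g = (\<lambda>x. norm (iexp (lform l (translate k x)) - iexp (lform l x)))"
      have bl: "bdd_meas (\<lambda>x. iexp (lform l x))" for l by (rule bdd_measI[of _ 1]) simp_all
      have bs: "bdd_meas (\<lambda>x. iexp (lform l (translate k x)))" for l by (rule bdd_meas_translate[OF bl])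
      have bf: "bdd_meas f" unfolding f_def
        using bdd_meas_norm[OF bdd_meas_diff[OF bl[of "[(u, n + k)]"] bl[of "[(u, n)]"]]] by simp
      have bg: "bdd_meas g" unfolding g_def by (intro bdd_intros bl bs)
      have if_: "integrable \<mu> f" and ig: "integrable \<mu> g" by (intro integrable_bdd bf bg)+
      have if2: "integrable \<mu> (\<lambda>x. (f x)\<^sup>2)"
        unfolding power2_eq_square by (intro integrable_bdd bdd_intros bf)
      have f2: "(f x)\<^sup>2 = 2 - 2 * Re (iexp (lform [(u, n + k), (- u, n)] x))" for x
      proof -
        define y z where "y = u * x (n + k)" and "z = u * x n"
        have "(norm (iexp y - iexp z))\<^sup>2 = (cos y - cos z)\<^sup>2 + (sin y - sin z)\<^sup>2"
          by (simp add: cmod_power2 Re_exp Im_exp)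
        also have "\<dots> = (sin y)\<^sup>2 + (cos y)\<^sup>2 + ((sin z)\<^sup>2 + (cos z)\<^sup>2) - 2 * (cos y * cos z + sin y * sin z)"
          by (simp add: power2_eq_square algebra_simps)
        also have "\<dots> = 2 - 2 * cos (y - z)" by (simp add: cos_diff)
        also have "cos (y - z) = Re (iexp (lform [(u, n + k), (- u, n)] x))" by (simp add: Re_exp y_def z_def)
        finally show ?thesis by (simp add: f_def y_def z_def)
      qed
      have ii: "integrable \<mu> (\<lambda>x. iexp (lform [(u, n + k), (- u, n)] x))"
        using trig_integrable[OF trig.trig_iexp[of 1 "[(u, n + k), (- u, n)]"]] by (simp only: mult_1_left)
      have "(\<integral>x. (f x)\<^sup>2 \<partial>\<mu>) = 2 - 2 * Re (CLINT x|\<mu>. iexp (lform [(u, n + k), (- u, n)] x))"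
        unfolding f2 using ii by (simp del: lform_simps)
      also have "\<dots> = 2 - 2 * exp (- (2 * u\<^sup>2 * (1 - r k)) / 2)"
      proof -
        have "cov_form r [(u, n + k), (- u, n)] [(u, n + k), (- u, n)] = 2 * u\<^sup>2 * (1 - r k)"
          using r_minus[of k] by (simp add: cov_form_def r_0 power2_eq_square algebra_simps)
        then show ?thesis unfolding char by simp
      qed
      also have "\<dots> \<le> 2 * u\<^sup>2 * (1 - r k)"
        using exp_ge_add_one_self[of "- (2 * u\<^sup>2 * (1 - r k)) / 2"] by simp
      also have "\<dots> \<le> 2 * u\<^sup>2 * d1" using k(1) by (intro mult_left_mono) auto
      also have "\<dots> \<le> s\<^sup>2"
      proof -
        have "2 * u\<^sup>2 * d1 \<le> (2 * u\<^sup>2 + 1) * d1" using d1 by simp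
        also have "\<dots> = s\<^sup>2" using u1 by (simp add: d1_def)
        finally show ?thesis .
      qed
      finally have f2_int: "(\<integral>x. (f x)\<^sup>2 \<partial>\<mu>) \<le> s\<^sup>2" .
      \<comment> \<open>The arithmetic-geometric mean inequality turns the mean-square bound into a
        bound on the mean.\<close>
      have "f x \<le> s / 2 + (f x)\<^sup>2 / (2 * s)" for x
        using zero_le_power2[of "f x - s"] s by (simp add: field_simps power2_eq_square)
      then have "(\<integral>x. f x \<partial>\<mu>) \<le> (\<integral>x. s / 2 + (f x)\<^sup>2 / (2 * s) \<partial>\<mu>)"
        using if_ if2 by (intro integral_mono) auto
      also have "\<dots> = s / 2 + (\<integral>x. (f x)\<^sup>2 \<partial>\<mu>) / (2 * s)" using if2 by simp
      also have "\<dots> \<le> s / 2 + s\<^sup>2 / (2 * s)" using f2_int s by (intro add_left_mono divide_right_mono) auto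
      also have "\<dots> = s" using s by (simp add: power2_eq_square)
      finally have f_int: "(\<integral>x. f x \<partial>\<mu>) \<le> e / 4" by (simp add: s_def)
      have le: "norm (iexp (lform (p # l) (translate k x)) - iexp (lform (p # l) x)) \<le> f x + g x" for x
      proof -
        define A B A' B' where "A = iexp (u * x (n + k))" and "B = iexp (lform l (translate k x))"
          and "A' = iexp (u * x n)" and "B' = iexp (lform l x)"
        have nB: "norm B = 1" "norm A' = 1" by (simp_all add: B_def A'_def)
        have "iexp (lform (p # l) (translate k x)) - iexp (lform (p # l) x) = A * B - A' * B'"
          by (simp add: A_def B_def A'_def B'_def u_def n_def translate_def distrib_left exp_add)
        also have "\<dots> = (A - A') * B + A' * (B - B')" by (simp add: algebra_simps)
        also have "norm \<dots> \<le> norm (A - A') * norm B + norm A' * norm (B - B')"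
          unfolding norm_mult[symmetric] by (rule norm_triangle_ineq)
        finally show ?thesis unfolding nB by (simp add: f_def g_def A_def B_def A'_def B'_def)
      qed
      have ih: "integrable \<mu> (\<lambda>x. norm (iexp (lform (p # l) (translate k x)) - iexp (lform (p # l) x)))"
        by (intro integrable_bdd bdd_intros bl bs)
      have "(\<integral>x. norm (iexp (lform (p # l) (translate k x)) - iexp (lform (p # l) x)) \<partial>\<mu>) \<le> (\<integral>x. f x + g x \<partial>\<mu>)"
        using ih if_ ig le by (intro integral_mono) auto
      also have "\<dots> = (\<integral>x. f x \<partial>\<mu>) + (\<integral>x. g x \<partial>\<mu>)" using if_ ig by simp
      also have "\<dots> < e" using f_int d2(2)[OF k(2)] Cons.prems by (simp add: g_def)
      finally show ?thesis .
    qed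
    then show ?case using d1 d2(1) by (intro exI[of _ "min d1 d2"]) auto
  qed
  have "e / (norm a + 1) > 0" using trig_iexp.prems by (simp add: add_nonneg_pos)
  from single[OF this] obtain d where d: "d > 0" 
    "\<And>k. 1 - r k < d \<Longrightarrow> (\<integral>x. norm (iexp (lform l (translate k x)) - iexp (lform l x)) \<partial>\<mu>) < e / (norm a + 1)"
    by blast
  have "(\<integral>x. norm (a * iexp (lform l (translate k x)) - a * iexp (lform l x)) \<partial>\<mu>) < e" if "1 - r k < d" for k
  proof -
    define t where "t = (\<integral>x. norm (iexp (lform l (translate k x)) - iexp (lform l x)) \<partial>\<mu>)"
    have t: "t \<ge> 0" "t < e / (norm a + 1)" using d(2)[OF that] by (simp_all add: t_def)
    have "(\<integral>x. norm (a * iexp (lform l (translate k x)) - a * iexp (lform l x)) \<partial>\<mu>) = norm a * t"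
      unfolding t_def right_diff_distrib[symmetric] norm_mult by simp
    also have "\<dots> \<le> (norm a + 1) * t" using t(1) by (intro mult_right_mono) auto
    also have "\<dots> < e" using t(2) by (simp add: less_divide_eq mult.commute add_nonneg_pos)
    finally show ?thesis .
  qed
  then show ?case using d(1) by blast
next
  case (trig_add p q)
  obtain d1 where d1: "d1 > 0" "\<And>k. 1 - r k < d1 \<Longrightarrow> (\<integral>x. norm (p (translate k x) - p x) \<partial>\<mu>) < e / 2"
    using trig_add.IH(1)[of "e / 2"] trig_add.prems by auto
  obtain d2 where d2: "d2 > 0" "\<And>k. 1 - r k < d2 \<Longrightarrow> (\<integral>x. norm (q (translate k x) - q x) \<partial>\<mu>) < e / 2"
    using trig_add.IH(2)[of "e / 2"] trig_add.prems by auto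
  have "(\<integral>x. norm (p (translate k x) + q (translate k x) - (p x + q x)) \<partial>\<mu>) < e" if k: "1 - r k < d1" "1 - r k < d2" for k
  proof -
    note ints = trig_integrable[OF trig_add.hyps(1)] trig_integrable[OF trig_add.hyps(2)]
      trig_integrable[OF trig_translate[OF trig_add.hyps(1)]] trig_integrable[OF trig_translate[OF trig_add.hyps(2)]]
    have i: "integrable \<mu> (\<lambda>x. norm (p (translate k x) - p x))" "integrable \<mu> (\<lambda>x. norm (q (translate k x) - q x))"
      "integrable \<mu> (\<lambda>x. norm (p (translate k x) + q (translate k x) - (p x + q x)))"
      by (intro integrable_norm Bochner_Integration.integrable_diff Bochner_Integration.integrable_add ints)+
    have "(\<integral>x. norm (p (translate k x) + q (translate k x) - (p x + q x)) \<partial>\<mu>)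
        \<le> (\<integral>x. norm (p (translate k x) - p x) + norm (q (translate k x) - q x) \<partial>\<mu>)"
      using i norm_triangle_ineq[of "p (translate k x) - p x" "q (translate k x) - q x" for x]
      by (intro integral_mono) (auto simp: algebra_simps)
    then show ?thesis using i d1(2)[OF k(1)] d2(2)[OF k(2)] by simp
  qed
  then show ?case using d1(1) d2(1) by (intro exI[of _ "min d1 d2"]) auto
qed

lemma translate_rigid:
  assumes A: "A \<in> sets borel" and e: "e > 0"
  shows "\<exists>d>0. \<forall>k. 1 - r k < d \<longrightarrow> measure \<mu> (sym_diff A (translate k -` A)) < e"
proof -
  obtain p where p: "trig p" "(\<integral>x. norm (indicator A x - p x) \<partial>\<mu>) < e / 3"
    using indicator_approx[OF A, of "e / 3"] e by auto
  obtain d where d: "d > 0" "\<And>k. 1 - r k < d \<Longrightarrow> (\<integral>x. norm (p (translate k x) - p x) \<partial>\<mu>) < e / 3"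
    using trig_translate_close[OF p(1), of "e / 3"] e by auto
  have "measure \<mu> (sym_diff A (translate k -` A)) < e" if k: "1 - r k < d" for k
  proof -
    define f where "f = (\<lambda>x. norm (indicator A x - p x))"
    define g where "g = (\<lambda>x. norm (p (translate k x) - p x))"
    have bf: "bdd_meas f" unfolding f_def by (intro bdd_intros A trig_bdd_meas p(1))
    have i: "integrable \<mu> f" "integrable \<mu> (\<lambda>x. f (translate k x))" "integrable \<mu> g"
      unfolding g_def by (intro integrable_bdd bdd_meas_translate[of f] bdd_meas_norm bdd_meas_diff bf
        trig_bdd_meas trig_translate p(1))+
    have S: "sym_diff A (translate k -` A) \<in> sets borel"
      using measurable_sets[OF translate_measurable A, of k] A by simp
    have "measure \<mu> (sym_diff A (translate k -` A)) = (\<integral>x. indicator (sym_diff A (translate k -` A)) x \<partial>\<mu>)"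
      using S by simp
    also have "\<dots> \<le> (\<integral>x. f x + f (translate k x) + g x \<partial>\<mu>)"
    proof (rule integral_mono)
      show "integrable \<mu> (\<lambda>x. indicator (sym_diff A (translate k -` A)) x :: real)"
        by (intro integrable_bdd bdd_intros S)
      show "integrable \<mu> (\<lambda>x. f x + f (translate k x) + g x)" using i by simp
      fix x
      have "indicator (sym_diff A (translate k -` A)) x = norm (indicator A (translate k x) - indicator A x :: complex)"
        by (auto simp: indicator_def)
      also have "indicator A (translate k x) - indicator A x
          = ((indicator A (translate k x) - p (translate k x)) - (indicator A x - p x)) + (p (translate k x) - p x)" by simp
      also have "norm \<dots> \<le> (f (translate k x) + f x) + g x"
        unfolding f_def g_def by (intro norm_triangle_mono norm_triangle_ineq4 order_refl)
      finally show "indicator (sym_diff A (translate k -` A)) x \<le> f x + f (translate k x) + g x" by simp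
    qed
    also have "\<dots> = (\<integral>x. f x \<partial>\<mu>) + (\<integral>x. f (translate k x) \<partial>\<mu>) + (\<integral>x. g x \<partial>\<mu>)" using i by simp
    also have "(\<integral>x. f (translate k x) \<partial>\<mu>) = (\<integral>x. f x \<partial>\<mu>)" by (rule integral_translate[OF bdd_meas_measurable[OF bf]])
    finally show ?thesis using p(2) d(2)[OF k] by (simp add: f_def g_def)
  qed
  then show ?thesis using d(1) by blast
qed

text \<open>Coordinate 0 has variance r 0 = 1 and is standard normal, so even the set of all points
  sharing one value there is null. The isomorphism with \<open>M\<close> requires this.\<close>

lemma singleton_null: "measure \<mu> {x} = 0"
proof -
  define N where "N = distr \<mu> borel (\<lambda>y. y 0)"
  interpret N: prob_space N unfolding N_def by (rule prob_space_distr) (rule coordinate_measurable)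
  have "N = std_normal_distribution"
  proof (rule Levy_uniqueness)
    show "real_distribution N" by unfold_locales (auto simp: N_def)
    show "real_distribution std_normal_distribution" by (rule real_dist_normal_dist)
    show "char N = char std_normal_distribution"
    proof
      fix t
      have "char N t = (CLINT y|\<mu>. iexp (t * y 0))"
        unfolding char_def N_def by (rule integral_distr[OF coordinate_measurable]) simp
      also have "\<dots> = (CLINT y|\<mu>. iexp (lform [(t, 0)] y))" by simp
      also have "\<dots> = complex_of_real (exp (- (t\<^sup>2) / 2))"
        unfolding char by (simp add: cov_form_def r_0 power2_eq_square)
      finally show "char N t = char std_normal_distribution t" by (simp add: char_std_normal_distribution)
    qed
  qed
  moreover have "emeasure std_normal_distribution {x 0} = 0"
    by (simp add: emeasure_density)
  ultimately have "measure N {x 0} = 0" by (simp add: measure_def)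
  moreover have "measure N {x 0} = measure \<mu> ((\<lambda>y. y 0) -` {x 0} \<inter> space \<mu>)"
    unfolding N_def by (rule measure_distr[OF coordinate_measurable]) simp
  moreover have "measure \<mu> {x} \<le> measure \<mu> ((\<lambda>y. y 0) -` {x 0} \<inter> space \<mu>)"
  proof (rule finite_measure_mono)
    show "(\<lambda>y. y 0) -` {x 0} \<inter> space \<mu> \<in> events"
      by (rule measurable_sets[OF coordinate_measurable]) simp
  qed auto
  ultimately show ?thesis by (simp add: measure_le_0_iff)
qed

end

section \<open>Borel coding of Polish spaces\<close>

text \<open>Digits 0 and 2 as in the Cantor set: the first digit decides whether the value is at
  most 1/3 or at least 2/3, so it can be read off by the threshold 1/2, with no ambiguous
  expansions.\<close>

definition ternary :: "(nat \<Rightarrow> bool) \<Rightarrow> real" where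
  "ternary \<beta> = (\<Sum>n. if \<beta> n then 2 / 3 ^ Suc n else 0)"

text \<open>The shift of digits, extended to all reals, so that decoding is a Borel function on the
  whole line.\<close>

primrec ternary_rem :: "nat \<Rightarrow> real \<Rightarrow> real" where
  "ternary_rem 0 y = y"
| "ternary_rem (Suc n) y = 3 * ternary_rem n y - (if ternary_rem n y > 1 / 2 then 2 else 0)"

definition ternary_bit :: "real \<Rightarrow> nat \<Rightarrow> bool" where
  "ternary_bit y n \<longleftrightarrow> ternary_rem n y > 1 / 2"

lemma ternary_geometric: "(\<lambda>n. 2 / 3 ^ Suc n :: real) sums 1"
proof -
  have "(\<lambda>n. 2 / 3 * (1 / 3) ^ n :: real) sums (2 / 3 * (1 / (1 - 1 / 3)))"
    by (intro sums_mult geometric_sums) simp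
  then show ?thesis by (simp add: power_one_over field_simps)
qed

lemma ternary_summable: "summable (\<lambda>n. if \<beta> n then 2 / 3 ^ Suc n else 0 :: real)"
  by (rule summable_comparison_test'[OF sums_summable[OF ternary_geometric], of 0]) auto

lemma ternary_bounds: "0 \<le> ternary \<beta>" "ternary \<beta> \<le> 1"
proof -
  show "0 \<le> ternary \<beta>" unfolding ternary_def by (intro suminf_nonneg ternary_summable) auto
  have "ternary \<beta> \<le> (\<Sum>n. 2 / 3 ^ Suc n)"
    unfolding ternary_def by (intro suminf_le ternary_summable sums_summable[OF ternary_geometric]) auto
  then show "ternary \<beta> \<le> 1" using sums_unique[OF ternary_geometric] by simp
qed

lemma ternary_head: "ternary \<beta> = (if \<beta> 0 then 2 / 3 else 0) + ternary (\<lambda>n. \<beta> (Suc n)) / 3"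
proof -
  have "ternary \<beta> = (if \<beta> 0 then 2 / 3 ^ Suc 0 else 0) + (\<Sum>n. if \<beta> (Suc n) then 2 / 3 ^ Suc (Suc n) else 0)"
    unfolding ternary_def using suminf_split_head[OF ternary_summable[of \<beta>]] by simp
  also have "(\<lambda>n. if \<beta> (Suc n) then 2 / 3 ^ Suc (Suc n) else 0 :: real) 
      = (\<lambda>n. (if \<beta> (Suc n) then 2 / 3 ^ Suc n else 0) / 3)" by auto
  also have "(\<Sum>n. (if \<beta> (Suc n) then 2 / 3 ^ Suc n else 0 :: real) / 3) = ternary (\<lambda>n. \<beta> (Suc n)) / 3"
    unfolding ternary_def by (rule suminf_divide[OF ternary_summable])
  finally show ?thesis by simp
qed

lemma ternary_gt_half_iff: "ternary \<beta> > 1 / 2 \<longleftrightarrow> \<beta> 0"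
  using ternary_head[of \<beta>] ternary_bounds[of "\<lambda>n. \<beta> (Suc n)"] by (cases "\<beta> 0") auto

lemma ternary_rem_ternary: "ternary_rem n (ternary \<beta>) = ternary (\<lambda>k. \<beta> (n + k))"
proof (induction n)
  case (Suc n)
  then show ?case using ternary_gt_half_iff[of "\<lambda>k. \<beta> (n + k)"] ternary_head[of "\<lambda>k. \<beta> (n + k)"] by simp
qed simp

lemma ternary_bit_ternary: "ternary_bit (ternary \<beta>) n = \<beta> n"
  unfolding ternary_bit_def ternary_rem_ternary ternary_gt_half_iff by simp

lemma ternary_rem_measurable [measurable]: "ternary_rem n \<in> borel_measurable borel"
  by (induction n) (simp_all add: fun_eq_iff)

lemma ternary_bit_measurable [measurable]: "Measurable.pred borel (\<lambda>y. ternary_bit y n)"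
  unfolding ternary_bit_def by measurable

section \<open>Points of a Polish space as filters of basic open sets\<close>

locale based_metric_space = Metric_space S d for S :: "'a set" and d +
  fixes U :: "nat \<Rightarrow> 'a set"
  assumes complete: mcomplete
    and U_open: "\<And>n. openin mtopology (U n)"
    and U_base: "\<And>V x. openin mtopology V \<Longrightarrow> x \<in> V \<Longrightarrow> \<exists>n. x \<in> U n \<and> U n \<subseteq> V"
begin

lemma U_subset: "U n \<subseteq> S"
  using openin_subset[OF U_open] by simp

text \<open>A filter base of small basic open sets that is closed upwards and whose members contain
  uniform neighbourhoods of smaller members converges to a unique point by completeness; this
  describes the image of the coding by countably many conditions.\<close>

definition small :: "nat \<Rightarrow> nat \<Rightarrow> bool" where
  "small k n \<longleftrightarrow> (\<forall>x\<in>U n. \<forall>y\<in>U n. d x y < 1 / real (Suc k))"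

definition well_inside :: "nat \<Rightarrow> nat \<Rightarrow> bool" where
  "well_inside m n \<longleftrightarrow> (\<exists>e>0. \<forall>z\<in>U m. mball z e \<subseteq> U n)"

definition is_code :: "(nat \<Rightarrow> bool) \<Rightarrow> bool" where
  "is_code \<beta> \<longleftrightarrow> (\<forall>k. \<exists>n. \<beta> n \<and> small k n) \<and>
    (\<forall>n m. \<beta> n \<and> \<beta> m \<longrightarrow> (\<exists>l. \<beta> l \<and> (U l \<subseteq> U n \<inter> U m \<and> U l \<noteq> {}))) \<and>
    (\<forall>n. \<beta> n \<longrightarrow> (\<exists>m. \<beta> m \<and> well_inside m n)) \<and>
    (\<forall>m n. \<beta> m \<and> U m \<subseteq> U n \<longrightarrow> \<beta> n)"

lemma is_code_mem:
  assumes x: "x \<in> S" shows "is_code (\<lambda>n. x \<in> U n)"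
  unfolding is_code_def
proof (intro conjI allI impI)
  fix k
  define e where "e = 1 / real (Suc k)"
  have e: "e > 0" by (simp add: e_def)
  obtain n where n: "x \<in> U n" "U n \<subseteq> mball x (e / 2)"
    using U_base[OF openin_mball, of x x "e / 2"] x e by auto
  have "d y z < e" if "y \<in> U n" "z \<in> U n" for y z
  proof -
    have "y \<in> mball x (e / 2)" "z \<in> mball x (e / 2)" using that n(2) by auto
    then show ?thesis using triangle[of y x z] by (auto simp: commute)
  qed
  then show "\<exists>n. x \<in> U n \<and> small k n" using n(1) by (auto simp: small_def e_def)
next
  fix n m assume "x \<in> U n \<and> x \<in> U m"
  then obtain l where "x \<in> U l" "U l \<subseteq> U n \<inter> U m"
    using U_base[OF openin_Int[OF U_open U_open], of x n m] by auto
  then show "\<exists>l. x \<in> U l \<and> U l \<subseteq> U n \<inter> U m \<and> U l \<noteq> {}" by auto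
next
  fix n assume "x \<in> U n"
  then obtain r where r: "r > 0" "mball x r \<subseteq> U n" using U_open[of n] unfolding openin_mtopology by blast
  obtain m where m: "x \<in> U m" "U m \<subseteq> mball x (r / 2)"
    using U_base[OF openin_mball, of x x "r / 2"] x r by auto
  have "mball z (r / 2) \<subseteq> U n" if "z \<in> U m" for z
  proof -
    have z: "z \<in> mball x (r / 2)" using that m(2) by auto
    have "mball z (r / 2) \<subseteq> mball x r"
    proof
      fix w assume "w \<in> mball z (r / 2)"
      then show "w \<in> mball x r" using z triangle[of x z w] by auto
    qed
    then show ?thesis using r(2) by blast
  qed
  then show "\<exists>m. x \<in> U m \<and> well_inside m n" using m(1) r(1) unfolding well_inside_def by (intro exI[of _ m]) (auto intro!: exI[of _ "r / 2"])
qed auto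

text \<open>Pick points x_k in ever smaller sets of the code. Any two sets of the code meet, so the
  sequence is Cauchy. Its limit lies in every set of the code because each contains a uniform
  neighbourhood of another one; conversely a basic set around the limit contains a small set of the
  code and belongs to it by upward closure.\<close>

lemma code_has_point:
  assumes code: "is_code \<beta>" shows "\<exists>x\<in>S. \<forall>n. \<beta> n \<longleftrightarrow> x \<in> U n"
proof -
  have c1: "\<forall>k. \<exists>n. \<beta> n \<and> small k n"
    and c2: "\<And>n m. \<beta> n \<Longrightarrow> \<beta> m \<Longrightarrow> \<exists>y. y \<in> U n \<and> y \<in> U m"
    and c3: "\<And>n. \<beta> n \<Longrightarrow> \<exists>m. \<beta> m \<and> well_inside m n"
    and c4: "\<And>m n. \<beta> m \<Longrightarrow> U m \<subseteq> U n \<Longrightarrow> \<beta> n"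
    using code unfolding is_code_def by blast+
  obtain N where N: "\<And>k. \<beta> (N k)" "\<And>k. small k (N k)" using choice[OF c1] by blast
  have "\<exists>y. y \<in> U (N k)" for k using c2[OF N(1) N(1)] by blast
  then obtain x where x: "\<And>k. x k \<in> U (N k)" using choice[of "\<lambda>k y. y \<in> U (N k)"] by blast
  have xS: "x k \<in> S" for k using x U_subset by blast
  have near: "\<exists>y. y \<in> U n \<and> d y (x k) < 1 / real (Suc k)" if bn: "\<beta> n" for n k
  proof -
    obtain y where "y \<in> U n" "y \<in> U (N k)" using c2[OF bn N(1)] by blast
    then show ?thesis using N(2)[of k] x[of k] unfolding small_def by blast
  qed
  have xx: "d (x j) (x k) < 1 / real (Suc j) + 1 / real (Suc k)" for j k
  proof -
    obtain y where y: "y \<in> U (N j)" "d y (x k) < 1 / real (Suc k)" using near[OF N(1)] by blast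
    have "d (x j) y < 1 / real (Suc j)" using N(2)[of j] x[of j] y(1) by (auto simp: small_def)
    moreover have "d (x j) (x k) \<le> d (x j) y + d y (x k)" using y(1) U_subset xS by (intro triangle) auto
    ultimately show ?thesis using y(2) by linarith
  qed
  have "MCauchy x"
    unfolding MCauchy_def
  proof (intro conjI allI impI)
    show "range x \<subseteq> S" using xS by auto
    fix e :: real assume "e > 0"
    then obtain K where K: "1 / real (Suc K) < e / 2"
      using reals_Archimedean[of "e / 2"] by (auto simp: inverse_eq_divide)
    have le: "1 / real (Suc n) < e / 2" if "n \<ge> K" for n
      using K that by (intro le_less_trans[OF _ K] divide_left_mono) auto
    show "\<exists>N. \<forall>n n'. N \<le> n \<longrightarrow> N \<le> n' \<longrightarrow> d (x n) (x n') < e"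
    proof (intro exI allI impI)
      fix n n' assume "K \<le> n" "K \<le> n'"
      then show "d (x n) (x n') < e" using xx[of n n'] le[of n] le[of n'] by linarith
    qed
  qed
  then obtain p where p: "limitin mtopology x p sequentially" using complete unfolding mcomplete_def by blast
  have pS: "p \<in> S" using p limitin_mspace by blast
  have close: "eventually (\<lambda>k. d (x k) p < e) sequentially" if "e > 0" for e
    using p that unfolding limitin_metric by (auto elim: eventually_mono)
  have inU: "p \<in> U n" if bn: "\<beta> n" for n
  proof -
    obtain m where m: "\<beta> m" "well_inside m n" using c3[OF bn] by blast
    obtain e where e: "e > 0" "\<And>z. z \<in> U m \<Longrightarrow> mball z e \<subseteq> U n" using m(2) unfolding well_inside_def by blast
    obtain K where K: "1 / real (Suc K) < e / 2"
      using reals_Archimedean[of "e / 2"] e(1) by (auto simp: inverse_eq_divide)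
    have "eventually (\<lambda>k. d (x k) p < e / 2 \<and> k \<ge> K) sequentially"
      using e(1) by (intro eventually_conj close eventually_ge_at_top) simp
    then obtain k where k: "d (x k) p < e / 2" "k \<ge> K" by (auto simp: eventually_sequentially)
    obtain z where z: "z \<in> U m" "d z (x k) < 1 / real (Suc k)" using near[OF m(1)] by blast
    have "1 / real (Suc k) \<le> 1 / real (Suc K)" using k(2) by (intro divide_left_mono) auto
    moreover have zS: "z \<in> S" using z(1) U_subset by blast
    moreover have "d z p \<le> d z (x k) + d (x k) p" using zS xS pS by (intro triangle) auto
    ultimately have "d z p < e" using z(2) k(1) K by linarith
    then have "p \<in> mball z e" using zS pS by simp
    then show ?thesis using e(2)[OF z(1)] by blast
  qed
  moreover have "\<beta> n" if pn: "p \<in> U n" for n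
  proof -
    obtain e where e: "e > 0" "mball p e \<subseteq> U n" using pn U_open[of n] unfolding openin_mtopology by blast
    obtain K where K: "1 / real (Suc K) < e"
      using reals_Archimedean[of e] e(1) by (auto simp: inverse_eq_divide)
    have "U (N K) \<subseteq> mball p e"
    proof
      fix y assume y: "y \<in> U (N K)"
      then have "d p y < 1 / real (Suc K)" using inU[OF N(1)] N(2)[of K] by (auto simp: small_def)
      moreover have "y \<in> S" using y U_subset by blast
      ultimately show "y \<in> mball p e" using K pS by simp
    qed
    then show ?thesis using c4[OF N(1)] e(2) by blast
  qed
  ultimately show ?thesis using pS by blast
qed

definition code :: "'a \<Rightarrow> real" where "code x = ternary (\<lambda>n. x \<in> U n)"

lemma bit_code: "ternary_bit (code x) n \<longleftrightarrow> x \<in> U n"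
  by (simp add: code_def ternary_bit_ternary)

lemma inj_on_code: "inj_on code S"
proof (rule inj_onI, rule ccontr)
  fix x y assume xy: "x \<in> S" "y \<in> S" "code x = code y" "x \<noteq> y"
  then have "d x y > 0" by simp
  then obtain n where "x \<in> U n" "U n \<subseteq> mball x (d x y)"
    using U_base[OF openin_mball, of x x "d x y"] xy by auto
  moreover have "y \<in> U n" using bit_code[of x n] bit_code[of y n] xy(3) \<open>x \<in> U n\<close> by simp
  ultimately show False by auto
qed

lemma code_image: "code ` S = {y. y = ternary (ternary_bit y) \<and> is_code (ternary_bit y)}"
proof (intro equalityI subsetI)
  fix y assume "y \<in> code ` S"
  then obtain x where x: "x \<in> S" "y = code x" by blast
  have "ternary_bit y = (\<lambda>n. x \<in> U n)" using bit_code x(2) by auto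
  then show "y \<in> {y. y = ternary (ternary_bit y) \<and> is_code (ternary_bit y)}"
    using is_code_mem[OF x(1)] x(2) by (simp add: code_def)
next
  fix y assume y: "y \<in> {y. y = ternary (ternary_bit y) \<and> is_code (ternary_bit y)}"
  then obtain x where x: "x \<in> S" "\<And>n. ternary_bit y n \<longleftrightarrow> x \<in> U n" using code_has_point by blast
  then have "ternary_bit y = (\<lambda>n. x \<in> U n)" by auto
  then have "y = code x" using y by (simp add: code_def)
  then show "y \<in> code ` S" using x(1) by blast
qed

lemma code_image_borel: "code ` S \<in> sets borel"
proof -
  have "Measurable.pred borel (\<lambda>y. y = ternary (ternary_bit y) \<and> is_code (ternary_bit y))"
    unfolding ternary_def is_code_def by measurable
  then show ?thesis unfolding code_image by (simp add: pred_def)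
qed

lemma code_open_borel:
  assumes V: "openin mtopology V" shows "code ` V \<in> sets borel"
proof -
  have "V \<subseteq> S" using openin_subset[OF V] by simp
  have "code ` V = code ` S \<inter> {y. \<exists>n. U n \<subseteq> V \<and> ternary_bit y n}"
  proof (intro equalityI subsetI)
    fix y assume "y \<in> code ` V"
    then obtain x where x: "x \<in> V" "y = code x" by blast
    then obtain n where "x \<in> U n" "U n \<subseteq> V" using U_base[OF V] by blast
    then show "y \<in> code ` S \<inter> {y. \<exists>n. U n \<subseteq> V \<and> ternary_bit y n}"
      using x \<open>V \<subseteq> S\<close> bit_code by blast
  next
    fix y assume "y \<in> code ` S \<inter> {y. \<exists>n. U n \<subseteq> V \<and> ternary_bit y n}"
    then show "y \<in> code ` V" using bit_code by blast
  qed
  moreover have "{y. \<exists>n. U n \<subseteq> V \<and> ternary_bit y n} \<in> sets borel"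
  proof -
    have "Measurable.pred borel (\<lambda>y. \<exists>n. U n \<subseteq> V \<and> ternary_bit y n)" by measurable
    then show ?thesis by (simp add: pred_def)
  qed
  ultimately show ?thesis using code_image_borel by simp
qed

text \<open>Because \<open>code\<close> is injective with Borel image, images respect complements as
  well as countable unions, and Borel images of open sets suffice. This is the instance of the
  Lusin-Souslin theorem that is needed.\<close>

lemma code_sets_borel:
  assumes "A \<in> sigma_sets S {V. openin mtopology V}" shows "code ` A \<in> sets borel"
  using assms
proof (induction rule: sigma_sets.induct)
  case (Basic V)
  then show ?case using code_open_borel by simp
next
  case (Compl A)
  have "{V. openin mtopology V} \<subseteq> Pow S" using openin_subset[of mtopology] by auto
  then have "A \<subseteq> S" using Compl(1) by (rule sigma_sets_into_sp)
  then have "code ` (S - A) = code ` S - code ` A" using inj_on_code by (intro inj_on_image_set_diff) auto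
  then show ?case using Compl(2) code_image_borel by simp
next
  case (Union A)
  then show ?case by (simp add: image_UN)
qed simp

end

lemma standard_borel_embedding:
  assumes "standard_borel M"
  shows "\<exists>\<phi>. \<phi> \<in> borel_measurable M \<and> inj_on \<phi> (space M) \<and>
    (\<forall>A\<in>sets M. \<phi> ` A \<in> sets (borel :: real measure))"
proof -
  obtain X where X: "completely_metrizable_space X" "second_countable X" "topspace X = space M"
    "sets M = sigma_sets (topspace X) {U. openin X U}"
    using assms unfolding standard_borel_def by blast
  obtain S d where S: "Metric_space S d" "Metric_space.mcomplete S d" "X = Metric_space.mtopology S d"
    using X(1) unfolding completely_metrizable_space_def by blast
  obtain \<B> where B: "countable \<B>" "\<And>V. V \<in> \<B> \<Longrightarrow> openin X V"
    "\<And>U x. openin X U \<Longrightarrow> x \<in> U \<Longrightarrow> \<exists>V\<in>\<B>. x \<in> V \<and> V \<subseteq> U"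
  proof -
    obtain \<B> where "countable \<B>" "\<forall>V\<in>\<B>. openin X V"
      "\<forall>U x. openin X U \<and> x \<in> U \<longrightarrow> (\<exists>V\<in>\<B>. x \<in> V \<and> V \<subseteq> U)"
      using X(2) unfolding second_countable_def by (elim exE conjE)
    then show ?thesis by (intro that[of \<B>]) auto
  qed
  \<comment> \<open>Adding the empty set makes the family nonempty, so that it can be enumerated by
    all naturals; codes never use it, as their sets must meet.\<close>
  define U where "U = from_nat_into (insert {} \<B>)"
  have rU: "range U = insert {} \<B>" unfolding U_def using B(1) by (intro range_from_nat_into) auto
  have "based_metric_space S d U"
  proof (intro based_metric_space.intro S(1) based_metric_space_axioms.intro S(2))
    show "openin (Metric_space.mtopology S d) (U n)" for n
    proof -
      have "U n \<in> insert {} \<B>" using rU by blast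
      then show ?thesis using B(2) S(3) by auto
    qed
    show "\<exists>n. x \<in> U n \<and> U n \<subseteq> V" if V: "openin (Metric_space.mtopology S d) V" "x \<in> V" for V x
    proof -
      obtain W where "W \<in> \<B>" "x \<in> W" "W \<subseteq> V" using B(3)[of V x] V S(3) by blast
      moreover from this obtain n where "W = U n" using rU by blast
      ultimately show ?thesis by blast
    qed
  qed
  then interpret based_metric_space S d U .
  have sp: "space M = S" using X(3) S(3) by simp
  have setsM: "sets M = sigma_sets S {V. openin mtopology V}" using X(4) X(3) sp S(3) by simp
  show ?thesis
  proof (intro exI[of _ code] conjI ballI)
    show "inj_on code (space M)" unfolding sp by (rule inj_on_code)
    show "code ` A \<in> sets borel" if "A \<in> sets M" for A using that code_sets_borel unfolding setsM by simp
    have [measurable]: "U n \<in> sets M" for n unfolding setsM using U_open by auto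
    show "code \<in> borel_measurable M" unfolding code_def ternary_def by measurable
  qed
qed

section \<open>Isomorphism of standard probability spaces\<close>

locale atomless_distribution = real_distribution +
  assumes atomless: "\<And>x. measure M {x} = 0"
begin

lemma continuous_cdf: "continuous_on A (cdf M)"
  using isCont_cdf atomless by (intro continuous_at_imp_continuous_on ballI) auto

lemma cdf_surj:
  assumes u: "0 < u" "u < 1" shows "\<exists>x. cdf M x = u"
proof -
  have "eventually (\<lambda>x. cdf M x < u) at_bot" "eventually (\<lambda>x. u < cdf M x) at_top"
    using u by (auto intro!: order_tendstoD[OF cdf_lim_at_bot] order_tendstoD[OF cdf_lim_at_top_prob])
  then obtain a b where ab: "cdf M a < u" "u < cdf M b"
    unfolding eventually_at_bot_linorder eventually_at_top_linorder by blast
  have "a \<le> b" using ab cdf_nondecreasing[of b a] by (rule_tac ccontr) auto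
  then have "\<exists>x. a \<le> x \<and> x \<le> b \<and> cdf M x = u"
    using ab by (intro IVT' continuous_cdf) auto
  then show ?thesis by blast
qed

lemma cdf_measurable [measurable]: "cdf M \<in> borel_measurable borel"
  by (rule borel_measurable_continuous_onI[OF continuous_cdf])

text \<open>A half-line up to a point of level u gives the lower bound. The level set may extend
  further right, so the upper bound uses points of every level w > u.\<close>

lemma prob_cdf_le:
  assumes u: "0 < u" "u < 1" shows "measure M {x. cdf M x \<le> u} = u"
proof (rule antisym)
  obtain s where s: "cdf M s = u" using cdf_surj[OF u] by blast
  have m: "{x. cdf M x \<le> v} \<in> sets M" for v by measurable
  have "{..s} \<subseteq> {x. cdf M x \<le> u}" using s cdf_nondecreasing by auto
  then have "measure M {..s} \<le> measure M {x. cdf M x \<le> u}" using m by (intro finite_measure_mono)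
  then show "u \<le> measure M {x. cdf M x \<le> u}" using s by (simp add: cdf_def)
  show "measure M {x. cdf M x \<le> u} \<le> u"
  proof (rule dense_ge_bounded)
    show "u < 1" by fact
    fix w assume w: "u < w" "w < 1"
    obtain t where t: "cdf M t = w" using cdf_surj[of w] u w by auto
    have "{x. cdf M x \<le> u} \<subseteq> {..t}"
    proof
      fix x assume "x \<in> {x. cdf M x \<le> u}"
      then have "cdf M x < cdf M t" using t w by simp
      then show "x \<in> {..t}" using cdf_nondecreasing[of t x] by (rule_tac ccontr) auto
    qed
    then have "measure M {x. cdf M x \<le> u} \<le> measure M {..t}" by (intro finite_measure_mono) auto
    then show "measure M {x. cdf M x \<le> u} \<le> w" using t by (simp add: cdf_def)
  qed
qed

lemma distr_cdf: "distr M borel (cdf M) = uniform_measure lborel {0<..<1}"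
proof (rule cdf_unique)
  have m: "{x. cdf M x \<le> v} \<in> sets M" for v by measurable
  show D: "real_distribution (distr M borel (cdf M))"
    by (rule real_distribution_distr) simp
  have "prob_space (uniform_measure lborel {0<..<1::real})"
    by (rule prob_space_uniform_measure) auto
  then show "real_distribution (uniform_measure lborel {0<..<1::real})"
    by (auto simp: real_distribution_def real_distribution_axioms_def)
  show "cdf (distr M borel (cdf M)) = cdf (uniform_measure lborel {0<..<1})"
  proof
    fix u :: real
    have L: "cdf (distr M borel (cdf M)) u = measure M {x. cdf M x \<le> u}"
      unfolding cdf_def[of "distr M borel (cdf M)"] by (subst measure_distr) (auto intro: arg_cong[where f = "measure M"])
    have R: "cdf (uniform_measure lborel {0<..<1}) u = measure lborel ({0<..<1} \<inter> {..u})"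
      unfolding cdf_def by (subst measure_uniform_measure) auto
    consider "u \<le> 0" | "0 < u" "u < 1" | "1 \<le> u" by linarith
    then show "cdf (distr M borel (cdf M)) u = cdf (uniform_measure lborel {0<..<1}) u"
    proof cases
      case 1
      have "measure M {x. cdf M x \<le> u} \<le> 0"
      proof (rule dense_ge_bounded[of 0 1])
        fix w :: real assume w: "0 < w" "w < 1"
        have "measure M {x. cdf M x \<le> u} \<le> measure M {x. cdf M x \<le> w}"
          using 1 w m by (intro finite_measure_mono) auto
        then show "measure M {x. cdf M x \<le> u} \<le> w" using prob_cdf_le[OF w] by simp
      qed simp
      moreover have "{0<..<1} \<inter> {..u} = {}" using 1 by auto
      ultimately show ?thesis unfolding L R by (simp add: measure_le_0_iff)
    next
      case 2
      have "{0<..<1} \<inter> {..u} = {0<..u}" using 2 by auto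
      then show ?thesis unfolding L R prob_cdf_le[OF 2] using 2 by simp
    next
      case 3
      have "{x. cdf M x \<le> u} = UNIV" using 3 cdf_bounded_prob by (auto intro: order_trans)
      moreover have "{0<..<1} \<inter> {..u} = {0<..<1}" using 3 by auto
      ultimately show ?thesis unfolding L R using prob_space by simp
    qed
  qed
qed

text \<open>Every level set of the distribution function with more than one point contains a rational.\<close>

definition flat :: "real set" where
  "flat = {x. \<exists>q\<in>\<rat>. cdf M x = cdf M q}"

lemma flat_borel [measurable]: "flat \<in> sets borel"
proof -
  have "flat = (\<Union>q\<in>\<rat>. {x. cdf M x = cdf M q})" by (auto simp: flat_def)
  moreover have "{x. cdf M x = cdf M q} \<in> sets borel" for q by measurable
  ultimately show ?thesis using countable_rat by (auto intro!: sets.countable_UN')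
qed

lemma prob_cdf_vimage:
  assumes "C \<in> sets borel" shows "measure M (cdf M -` C) = measure lborel ({0<..<1} \<inter> C)"
proof -
  have "measure M (cdf M -` C) = measure (distr M borel (cdf M)) C"
    using assms by (subst measure_distr) auto
  also have "\<dots> = measure lborel ({0<..<1} \<inter> C)"
    unfolding distr_cdf using assms by (subst measure_uniform_measure) auto
  finally show ?thesis .
qed

text \<open>The transform has uniform law, so every level set is null, and \<open>flat\<close> is a
  union of countably many of them.\<close>

lemma flat_null: "measure M flat = 0"
proof -
  have "emeasure M {x. cdf M x = c} = 0" for c
  proof -
    have "measure M (cdf M -` {c}) = measure lborel ({0<..<1} \<inter> {c})" by (rule prob_cdf_vimage) simp
    also have "\<dots> = 0" by (cases "c \<in> {0<..<1}") auto
    also have "cdf M -` {c} = {x. cdf M x = c}" by auto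
    finally show ?thesis by (simp add: emeasure_eq_measure)
  qed
  moreover have m: "{x. cdf M x = c} \<in> sets M" for c by measurable
  ultimately have "(\<Union>q\<in>\<rat>. {x. cdf M x = cdf M q}) \<in> null_sets M"
    using countable_rat by (intro null_sets_UN') (auto simp: null_sets_def)
  moreover have "flat = (\<Union>q\<in>\<rat>. {x. cdf M x = cdf M q})" by (auto simp: flat_def)
  ultimately show ?thesis by (simp add: measure_eq_0_null_sets)
qed

lemma cdf_eq_imp_eq:
  assumes x: "x \<notin> flat" and eq: "cdf M y = cdf M x" shows "y = x"
proof (rule ccontr)
  assume "y \<noteq> x"
  then have "min x y < max x y" by linarith
  then obtain q where q: "q \<in> \<rat>" "min x y < q" "q < max x y"
    using Rats_dense_in_real by blast
  have "cdf M (min x y) \<le> cdf M q" "cdf M q \<le> cdf M (max x y)"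
    using q by (auto intro!: cdf_nondecreasing)
  then have "cdf M q = cdf M x" using eq by (auto simp: min_def max_def split: if_splits)
  then show False using x q(1) by (auto simp: flat_def intro!: bexI[of _ q])
qed

text \<open>The quantile function \<open>G\<close> is a monotone, hence Borel, right inverse of the
  distribution function. Off \<open>flat\<close> it is also a left inverse, so the image of A is the
  preimage of A under \<open>G\<close>.\<close>

lemma cdf_image_borel:
  assumes A: "A \<in> sets borel" "A \<inter> flat = {}"
  shows "cdf M ` A \<in> sets borel" "cdf M ` A \<subseteq> {0<..<1}" "measure lborel (cdf M ` A) = measure M A"
proof -
  define G where "G = (\<lambda>u. Inf {x. u \<le> cdf M x})"
  have bdd: "bdd_below {x. u \<le> cdf M x}" if "0 < u" for u
  proof -
    have "eventually (\<lambda>x. cdf M x < u) at_bot" using that by (intro order_tendstoD[OF cdf_lim_at_bot])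
    then obtain a where a: "\<And>x. x \<le> a \<Longrightarrow> cdf M x < u" unfolding eventually_at_bot_linorder by blast
    show ?thesis
    proof (rule bdd_belowI[of _ a])
      fix x assume "x \<in> {x. u \<le> cdf M x}"
      then show "a \<le> x" using a[of x] by (rule_tac ccontr) auto
    qed
  qed
  have ne: "\<exists>s. s \<in> {x. u \<le> cdf M x} \<and> cdf M s = u" if "0 < u" "u < 1" for u
    using cdf_surj[OF that] by auto
  have FG: "cdf M (G u) = u" if u: "0 < u" "u < 1" for u
  proof (rule antisym)
    obtain s where s: "s \<in> {x. u \<le> cdf M x}" "cdf M s = u" using ne[OF u] by blast
    have "G u \<le> s" unfolding G_def by (rule cInf_lower[OF s(1) bdd[OF u(1)]])
    then show "cdf M (G u) \<le> u" using cdf_nondecreasing[of "G u" s] s(2) by simp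
    have "closed {x. u \<le> cdf M x}" by (intro closed_Collect_le continuous_cdf continuous_on_const)
    then have "G u \<in> {x. u \<le> cdf M x}" unfolding G_def
      using s(1) by (intro closed_contains_Inf[OF _ bdd[OF u(1)]]) blast+
    then show "u \<le> cdf M (G u)" by simp
  qed
  have "mono_on {0<..<1} G"
  proof (rule mono_onI)
    fix u w :: real assume u: "u \<in> {0<..<1}" "w \<in> {0<..<1}" "u \<le> w"
    then show "G u \<le> G w" unfolding G_def
    proof (intro cInf_superset_mono)
      show "{x. w \<le> cdf M x} \<noteq> {}" using ne[of w] u by auto
      show "bdd_below {x. u \<le> cdf M x}" using bdd[of u] u by simp
      show "{x. w \<le> cdf M x} \<subseteq> {x. u \<le> cdf M x}" using u by auto
    qed
  qed
  then have G: "G \<in> borel_measurable (restrict_space borel {0<..<1})" by (rule borel_measurable_mono_on_fnc)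
  \<comment> \<open>A value 0 or 1 at x would make the distribution function constant on a half-line
    from x, which puts x into \<open>flat\<close>.\<close>
  have range: "0 < cdf M x \<and> cdf M x < 1" if x: "x \<notin> flat" for x
  proof -
    have "cdf M x \<noteq> 0"
    proof
      assume "cdf M x = 0"
      moreover have "cdf M (x - 1) \<le> cdf M x" by (rule cdf_nondecreasing) simp
      ultimately have "cdf M (x - 1) = cdf M x" using cdf_nonneg[of "x - 1"] by simp
      then show False using cdf_eq_imp_eq[OF x, of "x - 1"] by simp
    qed
    moreover have "cdf M x \<noteq> 1"
    proof
      assume "cdf M x = 1"
      moreover have "cdf M x \<le> cdf M (x + 1)" by (rule cdf_nondecreasing) simp
      ultimately have "cdf M (x + 1) = cdf M x" using cdf_bounded_prob[of "x + 1"] by simp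
      then show False using cdf_eq_imp_eq[OF x, of "x + 1"] by simp
    qed
    ultimately show ?thesis using cdf_nonneg[of x] cdf_bounded_prob[of x] by linarith
  qed
  have nf: "x \<notin> flat" if "x \<in> A" for x using that A(2) by blast
  show sub: "cdf M ` A \<subseteq> {0<..<1}" using range[OF nf] by auto
  have "cdf M ` A = G -` A \<inter> {0<..<1}"
  proof (intro equalityI subsetI)
    fix u assume "u \<in> cdf M ` A"
    then obtain x where x: "x \<in> A" "u = cdf M x" by blast
    then have u: "0 < u" "u < 1" using range[OF nf[OF x(1)]] by simp_all
    have "G u = x" using FG[OF u] cdf_eq_imp_eq[OF nf[OF x(1)]] x(2) by simp
    then show "u \<in> G -` A \<inter> {0<..<1}" using x u by simp
  next
    fix u assume "u \<in> G -` A \<inter> {0<..<1}"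
    then show "u \<in> cdf M ` A" using FG[of u] by (intro image_eqI[of _ _ "G u"]) auto
  qed
  moreover have "G -` A \<inter> space (restrict_space borel {0<..<1}) \<in> sets (restrict_space borel {0<..<1})"
    by (rule measurable_sets[OF G A(1)])
  ultimately show im: "cdf M ` A \<in> sets borel"
    by (simp add: space_restrict_space sets_restrict_space_iff)
  have "cdf M -` cdf M ` A = A"
  proof (intro equalityI subsetI)
    fix x assume "x \<in> cdf M -` cdf M ` A"
    then obtain y where y: "y \<in> A" "cdf M x = cdf M y" by auto
    have "x = y" by (rule cdf_eq_imp_eq[OF nf[OF y(1)] y(2)])
    then show "x \<in> A" using y by simp
  qed auto
  then show "measure lborel (cdf M ` A) = measure M A"
    using prob_cdf_vimage[OF im] sub by (simp add: Int_absorb1)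
qed

end

text \<open>Code the space into the reals, then apply the distribution function of the image law;
  the full set is the complement of the preimage of \<open>flat\<close>.\<close>

lemma standard_iso_lebesgue:
  assumes M: "prob_space M" "standard_borel M" and null: "\<forall>x\<in>space M. measure M {x} = 0"
  shows "\<exists>A f. A \<in> sets M \<and> measure M A = 1 \<and> f \<in> borel_measurable M \<and> inj_on f A \<and>
    (\<forall>B\<in>sets M. B \<subseteq> A \<longrightarrow> f ` B \<in> sets borel \<and> f ` B \<subseteq> {0<..<1::real} \<and> measure lborel (f ` B) = measure M B)"
proof -
  interpret prob_space M by (rule M)
  obtain \<phi> :: "'a \<Rightarrow> real" where \<phi>: "\<phi> \<in> borel_measurable M" "inj_on \<phi> (space M)"
    "\<forall>A\<in>sets M. \<phi> ` A \<in> sets borel"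
    using standard_borel_embedding[OF M(2)] by (elim exE conjE)
  define \<nu> where "\<nu> = distr M borel \<phi>"
  interpret \<nu>: atomless_distribution \<nu>
  proof (intro atomless_distribution.intro atomless_distribution_axioms.intro)
    show "real_distribution \<nu>" unfolding \<nu>_def by (rule real_distribution_distr[OF \<phi>(1)])
    fix y
    have "measure \<nu> {y} = measure M (\<phi> -` {y} \<inter> space M)"
      unfolding \<nu>_def by (rule measure_distr[OF \<phi>(1)]) simp
    also have "\<dots> = 0"
    proof (cases "\<exists>x\<in>space M. \<phi> x = y")
      case True
      then obtain x where x: "x \<in> space M" "\<phi> x = y" by blast
      have "\<phi> -` {y} \<inter> space M = {x}"
      proof (intro equalityI subsetI)
        fix z assume "z \<in> \<phi> -` {y} \<inter> space M"
        then show "z \<in> {x}" using inj_onD[OF \<phi>(2), of z x] x by simp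
      qed (use x in simp)
      then show ?thesis using null x(1) by simp
    next
      case False
      then have "\<phi> -` {y} \<inter> space M = {}" by auto
      then show ?thesis by (simp only: measure_empty)
    qed
    finally show "measure \<nu> {y} = 0" .
  qed
  have md: "measure \<nu> C = measure M (\<phi> -` C \<inter> space M)" if "C \<in> sets borel" for C
    unfolding \<nu>_def by (rule measure_distr[OF \<phi>(1) that])
  define A where "A = space M - \<phi> -` \<nu>.flat"
  have A: "A \<in> sets M"
  proof -
    have "\<phi> -` \<nu>.flat \<inter> space M \<in> sets M" by (rule measurable_sets[OF \<phi>(1) \<nu>.flat_borel])
    moreover have "A = space M - (\<phi> -` \<nu>.flat \<inter> space M)" by (auto simp: A_def)
    ultimately show ?thesis by auto
  qed
  have img: "\<phi> ` B \<inter> \<nu>.flat = {}" if "B \<subseteq> A" for B using that by (auto simp: A_def)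
  have vim: "measure \<nu> (\<phi> ` B) = measure M B" if B: "B \<in> sets M" for B
  proof -
    have "\<phi> -` \<phi> ` B \<inter> space M = B"
    proof (intro equalityI subsetI)
      fix x assume "x \<in> \<phi> -` \<phi> ` B \<inter> space M"
      then show "x \<in> B" using inj_on_image_mem_iff[OF \<phi>(2) _ sets.sets_into_space[OF B]] by blast
    qed (use sets.sets_into_space[OF B] in blast)
    then show ?thesis using md[OF \<phi>(3)[rule_format, OF B]] by simp
  qed
  show ?thesis
  proof (intro exI[of _ A] exI[of _ "\<lambda>x. cdf \<nu> (\<phi> x)"] conjI ballI impI)
    show "A \<in> sets M" by (rule A)
    have "measure M (\<phi> -` \<nu>.flat \<inter> space M) = 0"
      using \<nu>.flat_null md[OF \<nu>.flat_borel] by simp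
    moreover have "A = space M - (\<phi> -` \<nu>.flat \<inter> space M)" by (auto simp: A_def)
    ultimately show "measure M A = 1"
      using prob_compl[OF measurable_sets[OF \<phi>(1) \<nu>.flat_borel]] by simp
    show "(\<lambda>x. cdf \<nu> (\<phi> x)) \<in> borel_measurable M" by (rule measurable_compose[OF \<phi>(1) \<nu>.cdf_measurable])
    show "inj_on (\<lambda>x. cdf \<nu> (\<phi> x)) A"
    proof (rule inj_onI)
      fix x y assume xy: "x \<in> A" "y \<in> A" "cdf \<nu> (\<phi> x) = cdf \<nu> (\<phi> y)"
      then have "\<phi> x = \<phi> y" by (intro \<nu>.cdf_eq_imp_eq[of "\<phi> y" "\<phi> x", OF _ xy(3)]) (simp add: A_def)
      then show "x = y" using inj_onD[OF \<phi>(2), of x y] xy by (simp add: A_def)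
    qed
    fix B assume B: "B \<in> sets M" "B \<subseteq> A"
    show "(\<lambda>x. cdf \<nu> (\<phi> x)) ` B \<in> sets borel" "(\<lambda>x. cdf \<nu> (\<phi> x)) ` B \<subseteq> {0<..<1}"
      "measure lborel ((\<lambda>x. cdf \<nu> (\<phi> x)) ` B) = measure M B"
      using \<nu>.cdf_image_borel[OF \<phi>(3)[rule_format, OF B(1)] img[OF B(2)]] vim[OF B(1)] by (simp_all add: image_image)
  qed
qed

text \<open>Measurability in both directions is asked only for subsets of A and B, since g is
  arbitrary outside A.\<close>

definition mod0_iso :: "'a measure \<Rightarrow> 'b measure \<Rightarrow> ('a \<Rightarrow> 'b) \<Rightarrow> 'a set \<Rightarrow> 'b set \<Rightarrow> bool" where
  "mod0_iso M N g A B \<longleftrightarrow> A \<in> sets M \<and> B \<in> sets N \<and> measure M A = 1 \<and> measure N B = 1 \<and> bij_betw g A B \<and>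
    (\<forall>C\<in>sets M. C \<subseteq> A \<longrightarrow> g ` C \<in> sets N \<and> measure N (g ` C) = measure M C) \<and>
    (\<forall>D\<in>sets N. D \<subseteq> B \<longrightarrow> g -` D \<inter> A \<in> sets M)"

lemma standard_mod0_iso:
  assumes M: "prob_space M" "standard_borel M" "\<forall>x\<in>space M. measure M {x} = 0"
    and N: "prob_space N" "standard_borel N" "\<forall>x\<in>space N. measure N {x} = 0"
  obtains g A B where "mod0_iso M N g A B"
proof -
  interpret M: prob_space M by (rule M)
  interpret N: prob_space N by (rule N)
  obtain A f where f: "A \<in> sets M" "measure M A = 1" "f \<in> borel_measurable M" "inj_on f A"
    "\<forall>B\<in>sets M. B \<subseteq> A \<longrightarrow> f ` B \<in> sets borel \<and> f ` B \<subseteq> {0<..<1::real} \<and> measure lborel (f ` B) = measure M B"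
    using standard_iso_lebesgue[OF M] by (elim exE conjE)
  obtain B h where h: "B \<in> sets N" "measure N B = 1" "h \<in> borel_measurable N" "inj_on h B"
    "\<forall>C\<in>sets N. C \<subseteq> B \<longrightarrow> h ` C \<in> sets borel \<and> h ` C \<subseteq> {0<..<1::real} \<and> measure lborel (h ` C) = measure N C"
    using standard_iso_lebesgue[OF N] by (elim exE conjE)
  \<comment> \<open>The two images have full measure in (0, 1), hence so has their intersection.
    Over \<open>D\<close> one goes up from M by \<open>f\<close> and down to N by the inverse of
    \<open>h\<close>.\<close>
  define D where "D = f ` A \<inter> h ` B"
  have fA: "f ` A \<in> sets borel" "f ` A \<subseteq> {0<..<1}" "measure lborel (f ` A) = 1" using f(5)[rule_format, OF f(1)] f(2) by auto
  have hB: "h ` B \<in> sets borel" "h ` B \<subseteq> {0<..<1}" "measure lborel (h ` B) = 1" using h(5)[rule_format, OF h(1)] h(2) by auto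
  have D: "D \<in> sets borel" using fA hB by (simp add: D_def)
  have D1: "measure lborel D = 1"
  proof -
    have unit: "{0<..<1::real} \<in> fmeasurable lborel" by (intro fmeasurableI) auto
    have fin: "C \<in> fmeasurable lborel" if "C \<in> sets borel" "C \<subseteq> {0<..<1}" for C :: "real set"
      using that by (intro fmeasurableI2[OF unit]) auto
    have "measure lborel (f ` A \<union> h ` B) \<le> measure lborel {0<..<1::real}"
      using fA hB unit by (intro measure_mono_fmeasurable) auto
    moreover have "measure lborel (f ` A \<union> h ` B) + measure lborel D = 1 + 1"
      using measure_Un3[OF fin[OF fA(1,2)] fin[OF hB(1,2)]] fA(3) hB(3) by (simp add: D_def)
    moreover have "measure lborel D \<le> measure lborel (f ` A)"
      using fA hB fin by (intro measure_mono_fmeasurable) (auto simp: D_def)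
    ultimately show ?thesis using fA(3) by simp
  qed
  define A' where "A' = f -` D \<inter> A"
  define B' where "B' = h -` D \<inter> B"
  have A': "A' \<in> sets M" "A' \<subseteq> A" "f ` A' = D"
  proof -
    have "A' = (f -` D \<inter> space M) \<inter> A" using sets.sets_into_space[OF f(1)] by (auto simp: A'_def)
    then show "A' \<in> sets M" using measurable_sets[OF f(3) D] f(1) by auto
    show "A' \<subseteq> A" by (simp add: A'_def)
    show "f ` A' = D"
    proof (intro equalityI subsetI)
      fix y assume y: "y \<in> D"
      then obtain x where "x \<in> A" "y = f x" unfolding D_def by blast
      then show "y \<in> f ` A'" using y by (simp add: A'_def)
    qed (auto simp: A'_def)
  qed
  have B': "B' \<in> sets N" "B' \<subseteq> B" "h ` B' = D"
  proof -
    have "B' = (h -` D \<inter> space N) \<inter> B" using sets.sets_into_space[OF h(1)] by (auto simp: B'_def)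
    then show "B' \<in> sets N" using measurable_sets[OF h(3) D] h(1) by auto
    show "B' \<subseteq> B" by (simp add: B'_def)
    show "h ` B' = D"
    proof (intro equalityI subsetI)
      fix y assume y: "y \<in> D"
      then obtain x where "x \<in> B" "y = h x" unfolding D_def by blast
      then show "y \<in> h ` B'" using y by (simp add: B'_def)
    qed (auto simp: B'_def)
  qed
  define g where "g = (\<lambda>x. the_inv_into B' h (f x))"
  have hB': "inj_on h B'" using h(4) B'(2) by (rule inj_on_subset)
  have fA': "inj_on f A'" using f(4) A'(2) by (rule inj_on_subset)
  have bf: "bij_betw f A' D" using fA' A'(3) by (simp add: bij_betw_def)
  have bh: "bij_betw h B' D" using hB' B'(3) by (simp add: bij_betw_def)
  have bg: "bij_betw g A' B'"
    using bij_betw_trans[OF bf bij_betw_the_inv_into[OF bh]] by (simp add: g_def comp_def)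
  have hg: "h (g x) = f x" if "x \<in> A'" for x
    unfolding g_def using that A'(3) B'(3) by (intro f_the_inv_into_f[OF hB']) auto
  have gB': "g x \<in> B'" if "x \<in> A'" for x using bg that by (auto simp: bij_betw_def)
  have "mod0_iso M N g A' B'"
    unfolding mod0_iso_def
  proof (intro conjI ballI impI)
    show "A' \<in> sets M" "B' \<in> sets N" "bij_betw g A' B'" by fact+
    show "measure M A' = 1" using f(5)[rule_format, OF A'(1,2)] D1 A'(3) by simp
    show "measure N B' = 1" using h(5)[rule_format, OF B'(1,2)] D1 B'(3) by simp
    fix C assume C: "C \<in> sets M" "C \<subseteq> A'"
    have CA: "C \<subseteq> A" using C(2) A'(2) by blast
    have hgC: "h ` g ` C = f ` C" unfolding image_image using hg C(2) by (intro image_cong) auto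
    have gC: "g ` C = (h -` (f ` C) \<inter> space N) \<inter> B'"
    proof (intro equalityI subsetI)
      fix y assume "y \<in> g ` C"
      then obtain x where x: "x \<in> C" "y = g x" by blast
      then have "y \<in> B'" "h y = f x" using C(2) gB' hg by auto
      then show "y \<in> (h -` (f ` C) \<inter> space N) \<inter> B'" using x sets.sets_into_space[OF B'(1)] by auto
    next
      fix y assume y: "y \<in> (h -` (f ` C) \<inter> space N) \<inter> B'"
      then obtain x where x: "x \<in> C" "h y = f x" by blast
      then have "h y = h (g x)" using hg C(2) by auto
      then have "y = g x" using inj_onD[OF hB'] y gB' x C(2) by blast
      then show "y \<in> g ` C" using x by blast
    qed
    have "h -` (f ` C) \<inter> space N \<in> sets N" using f(5)[rule_format, OF C(1) CA] by (intro measurable_sets[OF h(3)]) auto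
    then show gCs: "g ` C \<in> sets N" unfolding gC using B'(1) by blast
    have "g ` C \<subseteq> B" using gC B'(2) by blast
    then show "measure N (g ` C) = measure M C" using h(5)[rule_format, OF gCs] f(5)[rule_format, OF C(1) CA] hgC by simp
  next
    fix E assume E: "E \<in> sets N" "E \<subseteq> B'"
    have EB: "E \<subseteq> B" using E(2) B'(2) by blast
    have "g -` E \<inter> A' = (f -` (h ` E) \<inter> space M) \<inter> A'"
    proof (intro equalityI subsetI)
      fix x assume x: "x \<in> g -` E \<inter> A'"
      then have "f x = h (g x)" using hg by simp
      then show "x \<in> (f -` (h ` E) \<inter> space M) \<inter> A'" using x sets.sets_into_space[OF A'(1)] by auto
    next
      fix x assume x: "x \<in> (f -` (h ` E) \<inter> space M) \<inter> A'"
      then obtain y where y: "y \<in> E" "f x = h y" by blast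
      then have "h (g x) = h y" using hg x by simp
      then have "g x = y" using inj_onD[OF hB'] gB' x y(1) E(2) by blast
      then show "x \<in> g -` E \<inter> A'" using x y(1) by blast
    qed
    moreover have "f -` (h ` E) \<inter> space M \<in> sets M" using h(5)[rule_format, OF E(1) EB] by (intro measurable_sets[OF f(3)]) auto
    ultimately show "g -` E \<inter> A' \<in> sets M" using A'(1) by simp
  qed
  then show ?thesis by (rule that)
qed

section \<open>Transfer and conclusion\<close>

lemma standard_borel_borel: 
  assumes "sets N = sets (borel :: 'b::polish_space measure)" shows "standard_borel N"
  unfolding standard_borel_def
proof (intro exI conjI)
  show "completely_metrizable_space (euclidean :: 'b topology)" by (rule completely_metrizable_space_euclidean)
  show "second_countable (euclidean :: 'b topology)"
  proof -
    obtain B :: "'b set set" where B: "countable B" "topological_basis B"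
      using ex_countable_basis by (elim exE conjE)
    have a: "\<exists>V\<in>B. x \<in> V \<and> V \<subseteq> U" if U: "open U" "x \<in> U" for U x
      by (rule topological_basisE[OF B(2) U]) blast
    have b: "\<forall>V\<in>B. open V" using topological_basis_open[OF B(2)] by blast
    show ?thesis unfolding second_countable_def
    proof (intro exI[of _ B] conjI)
      show "countable B" by fact
      show "\<forall>V\<in>B. openin euclidean V" using b by simp
      show "\<forall>U x. openin euclidean U \<and> x \<in> U \<longrightarrow> (\<exists>V\<in>B. x \<in> V \<and> V \<subseteq> U)"
        using a unfolding open_openin[symmetric] by blast
    qed
  qed
  show "topspace (euclidean :: 'b topology) = space N"
    unfolding sets_eq_imp_space_eq[OF assms] by simp
  show "sets N = sigma_sets (topspace euclidean) {U :: 'b set. openin euclidean U}"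
    unfolding assms by (simp add: borel_def)
qed

text \<open>The injective coding makes singletons measurable, and a singleton of positive measure
  would be an atom.\<close>

lemma nonatomic_singleton_null:
  assumes "standard_nonatomic_prob_space M" and x: "x \<in> space M"
  shows "measure M {x} = 0"
proof -
  have M: "standard_borel M" "\<nexists>A. atom M A" using assms(1) by (auto simp: standard_nonatomic_prob_space_def)
  obtain \<phi> :: "'a \<Rightarrow> real" where \<phi>: "\<phi> \<in> borel_measurable M" "inj_on \<phi> (space M)"
    using standard_borel_embedding[OF M(1)] by (elim exE conjE)
  have "\<phi> -` {\<phi> x} \<inter> space M = {x}"
  proof (intro equalityI subsetI)
    fix z assume "z \<in> \<phi> -` {\<phi> x} \<inter> space M"
    then show "z \<in> {x}" using inj_onD[OF \<phi>(2), of z x] x by simp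
  qed (use x in simp)
  moreover have "\<phi> -` {\<phi> x} \<inter> space M \<in> sets M" by (rule measurable_sets[OF \<phi>(1)]) simp
  ultimately have s: "{x} \<in> sets M" by simp
  show ?thesis
  proof (rule ccontr)
    assume "measure M {x} \<noteq> 0"
    then have "measure M {x} > 0" using measure_nonneg[of M "{x}"] by linarith
    then have "atom M {x}" using s by (auto simp: atom_def subset_singleton_iff)
    then show False using M(2) by blast
  qed
qed

section \<open>The Gaussian shift carried over to \<open>M\<close>\<close>

locale shift_model = gauss_shift \<mu> r + M: prob_space M
  for \<mu> :: "(int \<Rightarrow> real) measure" and r and M :: "'a measure" +
  fixes g :: "'a \<Rightarrow> int \<Rightarrow> real" and A :: "'a set" and B :: "(int \<Rightarrow> real) set"
  assumes iso: "mod0_iso M \<mu> g A B"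
begin

lemma A_sets: "A \<in> sets M" and B_sets: "B \<in> sets borel" and B_full: "measure \<mu> B = 1"
  and bij_g: "bij_betw g A B"
  and g_image: "\<And>C. C \<in> sets M \<Longrightarrow> C \<subseteq> A \<Longrightarrow> g ` C \<in> sets borel \<and> measure \<mu> (g ` C) = measure M C"
  and g_vimage: "\<And>D. D \<in> sets borel \<Longrightarrow> D \<subseteq> B \<Longrightarrow> g -` D \<inter> A \<in> sets M"
  using iso unfolding mod0_iso_def by auto

text \<open>B need not be invariant. Intersecting its translates over all integers gives a
  shift-invariant subset, still of full measure because there are countably many of them.\<close>

definition B1 :: "(int \<Rightarrow> real) set" where "B1 = (\<Inter>k. translate k -` B)"

definition A1 :: "'a set" where "A1 = g -` B1 \<inter> A"

definition h :: "(int \<Rightarrow> real) \<Rightarrow> 'a" where "h = the_inv_into A g"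

text \<open>The identity off the full set \<open>A1\<close> makes each map a bijection of the whole
  space, and integer exponents make the family a group, so inverses come for free.\<close>

definition transport :: "int \<Rightarrow> 'a \<Rightarrow> 'a" where
  "transport k x = (if x \<in> A1 then h (translate k (g x)) else x)"

lemma translate_vimage_sets: "C \<in> sets borel \<Longrightarrow> translate k -` C \<in> sets borel"
  using measurable_sets[OF translate_measurable, of C k] by simp

lemma translate_vimage_measure: "C \<in> sets borel \<Longrightarrow> measure \<mu> (translate k -` C) = measure \<mu> C"
  by (subst (2) distr_translate[of k, symmetric], subst measure_distr) auto

lemma B1_sets: "B1 \<in> sets borel"
proof -
  have "B1 = (\<Inter>k\<in>UNIV. translate k -` B)" by (simp add: B1_def)
  also have "\<dots> \<in> sets borel"
    by (rule sets.countable_INT'') (auto intro: translate_vimage_sets B_sets)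
  finally show ?thesis .
qed

lemma B1_subset: "B1 \<subseteq> B"
proof
  fix y assume "y \<in> B1"
  then have "translate 0 y \<in> B" unfolding B1_def by blast
  then show "y \<in> B" by (simp add: translate_0)
qed

lemma translate_B1_iff: "translate k y \<in> B1 \<longleftrightarrow> y \<in> B1"
proof
  assume y: "y \<in> B1"
  show "translate k y \<in> B1" unfolding B1_def
  proof (intro INT_I, unfold vimage_eq)
    show "translate j (translate k y) \<in> B" for j using y unfolding translate_translate B1_def by blast
  qed
next
  assume y: "translate k y \<in> B1"
  show "y \<in> B1" unfolding B1_def
  proof (intro INT_I, unfold vimage_eq)
    fix j
    have "translate (j - k) (translate k y) \<in> B" using y unfolding B1_def by blast
    then show "translate j y \<in> B" by (simp add: translate_translate)
  qed
qed

lemma B1_full: "measure \<mu> B1 = 1"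
proof -
  have "AE y in \<mu>. translate k y \<in> B" for k
  proof -
    have "measure \<mu> (translate k -` B) = 1" using translate_vimage_measure[OF B_sets] B_full by simp
    then have "AE y in \<mu>. y \<in> translate k -` B" using translate_vimage_sets[OF B_sets] by (subst (asm) prob_eq_1) auto
    then show ?thesis by simp
  qed
  then have "AE y in \<mu>. \<forall>k. translate k y \<in> B" by (simp add: AE_all_countable)
  then have "AE y in \<mu>. y \<in> B1" by (simp add: B1_def)
  then show ?thesis using B1_sets by (subst prob_eq_1) auto
qed

lemma A1_sets: "A1 \<in> sets M"
  unfolding A1_def by (rule g_vimage[OF B1_sets B1_subset])

lemma A1_subset: "A1 \<subseteq> A" by (simp add: A1_def)

lemma g_A1: "x \<in> A1 \<Longrightarrow> g x \<in> B1" by (simp add: A1_def)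

lemma h_B1: assumes "y \<in> B1" shows "h y \<in> A1" "g (h y) = y"
proof -
  have y: "y \<in> B" using assms B1_subset by blast
  have 1: "g (h y) = y" unfolding h_def by (rule f_the_inv_into_f_bij_betw[OF bij_g y])
  moreover have "h y \<in> A" using bij_betw_the_inv_into[OF bij_g] y unfolding h_def by (auto simp: bij_betw_def)
  ultimately show "h y \<in> A1" "g (h y) = y" using assms by (auto simp: A1_def)
qed

lemma h_g: "x \<in> A1 \<Longrightarrow> h (g x) = x"
  unfolding h_def using bij_g A1_subset by (intro the_inv_into_f_f) (auto simp: bij_betw_def)

lemma transport_A1: assumes "x \<in> A1" shows "transport k x \<in> A1" "g (transport k x) = translate k (g x)"
  using h_B1[of "translate k (g x)"] g_A1[OF assms] translate_B1_iff assms by (simp_all add: transport_def)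

lemma transport_0: "transport 0 x = x"
  by (simp add: transport_def translate_0 h_g)

lemma transport_transport: "transport j (transport k x) = transport (j + k) x"
proof (cases "x \<in> A1")
  case True
  have "transport j (transport k x) = h (translate j (g (transport k x)))"
    using transport_A1(1)[OF True, of k] by (simp only: transport_def[of j] if_True)
  also have "\<dots> = h (translate (j + k) (g x))" unfolding transport_A1(2)[OF True] translate_translate ..
  finally show ?thesis using True by (simp only: transport_def[of "j + k"] if_True)
next
  case False
  then show ?thesis by (simp add: transport_def)
qed

lemma transport_funpow: "transport 1 ^^ n = transport (int n)"
proof (induction n)
  case 0
  show ?case by (simp add: fun_eq_iff transport_0)
next
  case (Suc n)
  then show ?case by (simp add: fun_eq_iff transport_transport)
qed

lemma transport_space: "x \<in> space M \<Longrightarrow> transport k x \<in> space M"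
  using transport_A1(1)[of x k] sets.sets_into_space[OF A1_sets] by (cases "x \<in> A1") (auto simp: transport_def)

definition model_set :: "'a set \<Rightarrow> (int \<Rightarrow> real) set" where "model_set C = g ` (C \<inter> A1)"

lemma model_set_sets: "C \<in> sets M \<Longrightarrow> model_set C \<in> sets borel"
  unfolding model_set_def using g_image[of "C \<inter> A1"] A1_sets A1_subset by auto

lemma mem_model_set_iff: "x \<in> A1 \<Longrightarrow> g x \<in> model_set C \<longleftrightarrow> x \<in> C"
  unfolding model_set_def using inj_on_image_mem_iff[of g A x "C \<inter> A1"] bij_g A1_subset
  by (auto simp: bij_betw_def)

lemma transport_mem_iff: "x \<in> A1 \<Longrightarrow> transport k x \<in> C \<longleftrightarrow> translate k (g x) \<in> model_set C"
  using mem_model_set_iff[OF transport_A1(1), of x k C] transport_A1(2) by simp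

lemma model_set_subset: "model_set C \<subseteq> B1"
  using g_A1 by (auto simp: model_set_def)

text \<open>The dictionary between the two spaces: a set in M and a subset of B1 that correspond
  under g on the full set \<open>A1\<close> have equal measure, whatever happens outside.\<close>

lemma measure_model:
  assumes E: "E \<in> sets M" and E': "E' \<subseteq> B1" and eq: "\<And>x. x \<in> A1 \<Longrightarrow> x \<in> E \<longleftrightarrow> g x \<in> E'"
  shows "measure M E = measure \<mu> E'"
proof -
  have im: "g ` (E \<inter> A1) = E'"
  proof (intro equalityI subsetI)
    fix y assume "y \<in> E'"
    then show "y \<in> g ` (E \<inter> A1)" using h_B1[of y] E' eq[of "h y"] by (intro image_eqI[of _ _ "h y"]) auto
  qed (use eq in auto)
  have "measure M A1 = 1"
  proof -
    have "g ` A1 = B1"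
    proof (intro equalityI subsetI)
      fix y assume "y \<in> B1"
      then show "y \<in> g ` A1" using h_B1[of y] by (intro image_eqI[of _ _ "h y"]) auto
    qed (use g_A1 in auto)
    then show ?thesis using g_image[OF A1_sets A1_subset] B1_full by simp
  qed
  then have "AE x in M. x \<in> A1" using A1_sets by (simp add: M.prob_eq_1)
  then have "measure M (E \<inter> A1) = measure M E"
    using E A1_sets by (intro M.finite_measure_eq_AE) (auto elim: eventually_mono)
  moreover have "E \<inter> A1 \<in> sets M" "E \<inter> A1 \<subseteq> A" using E A1_sets A1_subset by auto
  then have "measure M (E \<inter> A1) = measure \<mu> E'"
    using g_image[of "E \<inter> A1"] im by simp
  ultimately show ?thesis by simp
qed

lemma transport_vimage_sets: 
  assumes C: "C \<in> sets M" shows "transport k -` C \<inter> space M \<in> sets M"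
proof -
  define D where "D = translate k -` model_set C"
  have D: "D \<in> sets borel" unfolding D_def by (intro translate_vimage_sets model_set_sets C)
  have DB: "D \<subseteq> B" unfolding D_def using model_set_subset translate_B1_iff B1_subset by blast
  have "transport k -` C \<inter> space M = ((g -` D \<inter> A) \<inter> A1) \<union> (C - A1)"
  proof (intro equalityI subsetI)
    fix x assume x: "x \<in> transport k -` C \<inter> space M"
    show "x \<in> ((g -` D \<inter> A) \<inter> A1) \<union> (C - A1)"
    proof (cases "x \<in> A1")
      case True
      then show ?thesis using x transport_mem_iff[OF True] A1_subset by (auto simp: D_def)
    next
      case False
      then show ?thesis using x by (simp add: transport_def)
    qed
  next
    fix x assume x: "x \<in> ((g -` D \<inter> A) \<inter> A1) \<union> (C - A1)"
    show "x \<in> transport k -` C \<inter> space M"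
    proof (cases "x \<in> A1")
      case True
      then show ?thesis using x transport_mem_iff[OF True] sets.sets_into_space[OF A1_sets] by (auto simp: D_def)
    next
      case False
      then show ?thesis using x sets.sets_into_space[OF C] by (auto simp: transport_def)
    qed
  qed
  then show ?thesis using g_vimage[OF D DB] A1_sets C by auto
qed

lemma transport_measurable: "transport k \<in> measurable M M"
  using transport_space transport_vimage_sets by (intro measurableI) auto

lemma transport_bij: "bij_betw (transport k) (space M) (space M)"
  by (rule bij_betwI[of _ _ _ "transport (- k)"]) (auto simp: transport_transport transport_0 transport_space)

lemma transport_inverse: "x \<in> space M \<Longrightarrow> the_inv_into (space M) (transport k) x = transport (- k) x"
  by (rule the_inv_into_f_eq) (use transport_bij in \<open>auto simp: bij_betw_def transport_transport transport_0 transport_space\<close>)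

lemma transport_MPT: "transport 1 \<in> MPT M"
  unfolding MPT_def
proof (intro CollectI conjI)
  show "bij_betw (transport 1) (space M) (space M)" by (rule transport_bij)
  show "transport 1 \<in> measurable M M" by (rule transport_measurable)
  show "the_inv_into (space M) (transport 1) \<in> measurable M M"
    using transport_measurable[of "- 1"] by (subst measurable_cong[OF transport_inverse]) auto
  show "distr M M (transport 1) = M"
  proof (rule measure_eqI)
    fix C assume "C \<in> sets (distr M M (transport 1))"
    then have C: "C \<in> sets M" by simp
    have D: "translate 1 -` model_set C \<subseteq> B1" using model_set_subset translate_B1_iff by blast
    have "measure M (transport 1 -` C \<inter> space M) = measure \<mu> (translate 1 -` model_set C)"
      using transport_mem_iff sets.sets_into_space[OF A1_sets]
      by (intro measure_model transport_vimage_sets C D) auto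
    also have "\<dots> = measure \<mu> (model_set C)" by (intro translate_vimage_measure model_set_sets C)
    also have "\<dots> = measure M C"
      by (intro measure_model[symmetric] C model_set_subset) (simp add: mem_model_set_iff)
    finally show "emeasure (distr M M (transport 1)) C = emeasure M C"
      using C by (simp add: emeasure_distr[OF transport_measurable] M.emeasure_eq_measure)
  qed simp
qed

lemma transport_weakly_mixing: "weakly_mixing M (transport 1)"
  unfolding weakly_mixing_def
proof (intro ballI)
  fix C D assume C: "C \<in> sets M" and D: "D \<in> sets M"
  have mC: "measure M C = measure \<mu> (model_set C)" and mD: "measure M D = measure \<mu> (model_set D)"
    by (intro measure_model C D model_set_subset; simp add: mem_model_set_iff)+
  have "measure M ((transport 1 ^^ n) -` C \<inter> D) = measure \<mu> (translate (int n) -` model_set C \<inter> model_set D)" for n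
  proof (rule measure_model)
    have "(transport 1 ^^ n) -` C \<inter> D = (transport (int n) -` C \<inter> space M) \<inter> D"
      using sets.sets_into_space[OF D] by (auto simp: transport_funpow)
    then show "(transport 1 ^^ n) -` C \<inter> D \<in> sets M" using transport_vimage_sets[OF C] D by auto
    show "translate (int n) -` model_set C \<inter> model_set D \<subseteq> B1" using model_set_subset by blast
    show "x \<in> (transport 1 ^^ n) -` C \<inter> D \<longleftrightarrow> g x \<in> translate (int n) -` model_set C \<inter> model_set D" if "x \<in> A1" for x
      using that by (simp add: transport_funpow transport_mem_iff mem_model_set_iff)
  qed
  then show "(\<lambda>N. (\<Sum>n<N. \<bar>measure M ((transport 1 ^^ n) -` C \<inter> D) - measure M C * measure M D\<bar>) / real N) \<longlonglongrightarrow> 0"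
    using cesaro_mixing[OF model_set_sets[OF C] model_set_sets[OF D]] unfolding cesaro_null_def mC mD by simp
qed

text \<open>The forward image under the k-th iterate is the preimage under the transport by -k,
  which explains the sign on the model side.\<close>

lemma measure_sym_diff_transport:
  assumes C: "C \<in> sets M"
  shows "measure M (sym_diff C ((transport 1 ^^ k) ` C))
    = measure \<mu> (sym_diff (model_set C) (translate (- int k) -` model_set C))"
proof (rule measure_model)
  have im: "(transport 1 ^^ k) ` C = transport (- int k) -` C \<inter> space M"
  proof (intro equalityI subsetI)
    fix x assume "x \<in> (transport 1 ^^ k) ` C"
    then show "x \<in> transport (- int k) -` C \<inter> space M"
      using sets.sets_into_space[OF C] by (auto simp: transport_funpow transport_transport transport_0 intro!: transport_space)
  next
    fix x assume "x \<in> transport (- int k) -` C \<inter> space M"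
    then show "x \<in> (transport 1 ^^ k) ` C"
      by (intro image_eqI[of _ _ "transport (- int k) x"]) (auto simp: transport_funpow transport_transport transport_0)
  qed
  show "sym_diff C ((transport 1 ^^ k) ` C) \<in> sets M"
    unfolding im using transport_vimage_sets[OF C] C by auto
  show "sym_diff (model_set C) (translate (- int k) -` model_set C) \<subseteq> B1"
    using model_set_subset translate_B1_iff by blast
  show "x \<in> sym_diff C ((transport 1 ^^ k) ` C) \<longleftrightarrow> g x \<in> sym_diff (model_set C) (translate (- int k) -` model_set C)"
    if x: "x \<in> A1" for x
    unfolding im using x sets.sets_into_space[OF A1_sets] by (auto simp: transport_mem_iff mem_model_set_iff)
qed

lemma transport_IP_rigid:
  assumes b: "\<And>e. e > 0 \<Longrightarrow> \<exists>K. \<forall>F. finite F \<and> (\<forall>j\<in>F. K \<le> j) \<longrightarrow> 1 - r (int (\<Sum>j\<in>F. b j)) < e"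
  shows "IP_rigid M (transport 1) b"
  unfolding IP_rigid_def
proof (intro ballI tendstoI)
  fix C and e :: real assume C: "C \<in> sets M" and e: "e > 0"
  obtain d where d: "d > 0" 
    "\<And>k. 1 - r k < d \<Longrightarrow> measure \<mu> (sym_diff (model_set C) (translate k -` model_set C)) < e"
    using translate_rigid[OF model_set_sets[OF C] e] by blast
  obtain K where K: "\<forall>F. finite F \<and> (\<forall>j\<in>F. K \<le> j) \<longrightarrow> 1 - r (int (\<Sum>j\<in>F. b j)) < d"
    using b[OF d(1)] by (rule exE)
  have "dist (measure M (sym_diff C ((transport 1 ^^ (\<Sum>j\<in>F. b j)) ` C))) 0 < e"
    if F: "finite F \<and> F \<noteq> {} \<and> F \<subseteq> {1..} \<and> (\<forall>j\<in>F. K \<le> j)" for F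
  proof -
    \<comment> \<open>The covariance is even, so the sign of the translation does not
      matter.\<close>
    have "1 - r (- int (\<Sum>j\<in>F. b j)) < d" unfolding r_minus using K F by blast
    then show ?thesis unfolding measure_sym_diff_transport[OF C] using d(2) by simp
  qed
  then show "\<forall>\<^sub>F F in IP_filter. dist (measure M (sym_diff C ((transport 1 ^^ (\<Sum>j\<in>F. b j)) ` C))) 0 < e"
    unfolding eventually_IP_filter by (intro exI[of _ K] allI impI)
qed

end

lemma erdos_taylor_strict_mono:
  assumes "erdos_taylor b" shows "strict_mono_on {1..} b"
proof (rule strict_mono_onI)
  obtain a where a: "\<And>n. n \<ge> 1 \<Longrightarrow> a n \<ge> 1" and rec: "\<And>n. n \<ge> 1 \<Longrightarrow> b (Suc n) = a n * b n + 1"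
    using erdos_taylorE[OF assms] by metis
  have step: "b n < b (Suc n)" if "n \<ge> 1" for n
  proof -
    have "1 * b n \<le> a n * b n" by (rule mult_right_mono[OF a[OF that]]) simp
    then show ?thesis using rec[OF that] by linarith
  qed
  fix m n :: nat assume "m \<in> {1..}" "n \<in> {1..}" "m < n"
  then have "1 \<le> m" "Suc m \<le> n" by auto
  from this(2) show "b m < b n"
  proof (induction n rule: dec_induct)
    case base
    show ?case by (rule step[OF \<open>1 \<le> m\<close>])
  next
    case (step n)
    then show ?case using \<open>\<And>n. 1 \<le> n \<Longrightarrow> b n < b (Suc n)\<close>[of n] \<open>1 \<le> m\<close> by simp
  qed
qed

section \<open>Condition (i) implies condition (ii)\<close>

lemma summable_imp_IPRWM:
  assumes M: "standard_nonatomic_prob_space M" and b: "erdos_taylor b"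
    and s: "summable (\<lambda>n. (real (b (Suc n)) / real (b (Suc (Suc n))))\<^sup>2)"
  shows "b \<in> IPRWM M"
proof -
  obtain n a where n: "n \<ge> 1" and fg: "fast_growth (\<lambda>k. b (n + k)) a"
    by (rule fast_growth_of_summable[OF b s])
  interpret fast_growth "\<lambda>k. b (n + k)" a by (rule fg)
  obtain l where l: "n = Suc l" using n by (cases n) auto
  have s': "summable (\<lambda>k. (real (b (n + k)) / real (b (n + Suc k)))\<^sup>2)"
  proof -
    have "summable (\<lambda>k. (\<lambda>n. (real (b (Suc n)) / real (b (Suc (Suc n))))\<^sup>2) (k + l))"
      using s by (subst summable_iff_shift)
    then show ?thesis unfolding l by (simp add: add.commute)
  qed
  have "psd_kernel (\<lambda>i j. corr (i - j))"
    unfolding psd_kernel_def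
  proof (intro conjI allI impI)
    show "corr (i - j) = corr (j - i)" for i j using corr_minus[of "j - i"] by simp
  qed (rule corr_psd)
  then obtain \<mu> :: "(int \<Rightarrow> real) measure" where \<mu>: "prob_space \<mu>" "sets \<mu> = sets borel"
    "\<forall>l. (CLINT x|\<mu>. iexp (lform l x)) = complex_of_real (exp (- cov_form corr l l / 2))"
    by (elim exE[OF gaussian_process_exists] conjE)
  interpret gauss_shift \<mu> corr
  proof (rule gauss_shift.intro)
    show "cesaro_null (\<lambda>n. (corr (int n + m))\<^sup>2)" for m
      unfolding cesaro_null_def by (rule corr_cesaro)
  qed (rule \<mu>(1) \<mu>(2) \<mu>(3)[rule_format] corr_minus corr_zero abs_corr_le)+
  have P: "prob_space M" "standard_borel M" using M by (auto simp: standard_nonatomic_prob_space_def)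
  obtain g A B where "mod0_iso M \<mu> g A B"
    using standard_mod0_iso[OF P ballI[OF nonatomic_singleton_null[OF M]] \<mu>(1)
      standard_borel_borel[OF \<mu>(2)] ballI[OF singleton_null]] by blast
  then interpret shift_model \<mu> corr M g A B
    by (intro shift_model.intro shift_model_axioms.intro gauss_shift_axioms P(1))
  have "IP_rigid M (transport 1) b"
  proof (rule transport_IP_rigid)
    fix e :: real assume "e > 0"
    then obtain K where K: "\<forall>F. finite F \<and> (\<forall>j\<in>F. K \<le> j) \<longrightarrow> 1 - corr (int (\<Sum>j\<in>F. b (n + j))) < e"
      using corr_rigid[OF s'] by blast
    show "\<exists>K. \<forall>F. finite F \<and> (\<forall>j\<in>F. K \<le> j) \<longrightarrow> 1 - corr (int (\<Sum>j\<in>F. b j)) < e"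
    \<comment> \<open>\<open>corr_rigid\<close> counts indices from the start \<open>n\<close> of
      the tail; the threshold \<open>n + K\<close> allows F to be shifted down by
      \<open>n\<close>.\<close>
    proof (intro exI[of _ "n + K"] allI impI)
      fix F assume F: "finite F \<and> (\<forall>j\<in>F. n + K \<le> j)"
      define G where "G = (\<lambda>j. j - n) ` F"
      have ge: "n \<le> j" if "j \<in> F" for j using bspec[OF conjunct2[OF F] that] by simp
      have inj: "inj_on (\<lambda>j. j - n) F" by (rule inj_on_diff_nat) (rule ge)
      have "(\<Sum>j\<in>G. b (n + j)) = (\<Sum>j\<in>F. b j)"
        unfolding G_def sum.reindex[OF inj] using ge by (intro sum.cong) (simp_all add: comp_def)
      moreover have "finite G \<and> (\<forall>j\<in>G. K \<le> j)" using F by (auto simp: G_def)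
      ultimately show "1 - corr (int (\<Sum>j\<in>F. b j)) < e" using spec[OF K, of G] by simp
    qed
  qed
  then show ?thesis
    unfolding IPRWM_def using erdos_taylor_strict_mono[OF b] erdos_taylor_pos[OF b] transport_MPT transport_weakly_mixing
    by (intro CollectI conjI allI impI bexI[of _ "transport 1"])
qed

theorem proposition4:
  fixes b :: "nat \<Rightarrow> nat" and M :: "'a measure"
  assumes "standard_nonatomic_prob_space M"
    and "erdos_taylor b"
  shows "(summable (\<lambda>n. (real (b (Suc n)) / real (b (Suc (Suc n))))\<^sup>2) \<longleftrightarrow> b \<in> IPRWM M)
       \<and> (b \<in> IPRWM M \<longleftrightarrow> uncountable (G2 b))"
  using IPRWM_imp_summable[OF assms] summable_imp_IPRWM[OF assms]
    summable_imp_uncountable_G2[OF assms(2)] uncountable_G2_imp_summable[OF assms(2)]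
  by blast

end
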